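(* Let $M$ be a regular analytic surface in $\mathbb R^3_1$ and let ${\rm p}\in M$ be a lightlike umbilic point. If the $LD$ has a singularity at ${\rm p}$ which is $\mathcal R$-equivalent to a quasi-homogeneous singularity, then $m_u({\rm p})$ is equal to the Milnor number of the singularity of the $LD$ at ${\rm p}$.
   Context: $\mathbb R^3_1$ is $\mathbb R^3$ with the pseudo-scalar product $\langle u,v\rangle=u_0v_0+u_1v_1-u_2v_2$; $\langle u\times v,w\rangle=\det(u,v,w)$. For a local parametrisation $\mathbf x(u,v)$ of $M$, put $E=\langle \mathbf x_u,\mathbf x_u\rangle$, $F=\langle \mathbf x_u,\mathbf x_v\rangle$, $G=\langle \mathbf x_v,\mathbf x_v\rangle$, $\bar l=\langle \mathbf x_u\times \mathbf x_v,\mathbf x_{uu}\rangle$, $\bar m=\langle \mathbf x_u\times \mathbf x_v,\mathbf x_{uv}\rangle$, $\bar n=\langle \mathbf x_u\times \mathbf x_v,\mathbf x_{vv}\rangle$, $\mathfrak a=F\bar n-G\bar m$, $\mathfrak b=E\bar n-G\bar l$, $\mathfrak c=E\bar m-F\bar l$. The locus of degeneracy $LD$ (where the induced metric is degenerate) is the zero set of $\delta=F^2-EG$. A lightlike umbilic point is a point ${\rm p}=\mathbf x(q)$ on the $LD$ with $\mathfrak a(q)=\mathfrak b(q)=\mathfrak c(q)=0$; near such a point $M$ can be written as a graph $z=f(x,y)$ ($z$ the timelike coordinate), and then $\delta=f_x^2+f_y^2-1$. The singularity of the $LD$ at ${\rm p}$ is that of the germ of $\delta$ at $q$; it is $\mathcal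 R$-equivalent to a quasi-homogeneous singularity if $\delta\circ h=P$ for some germ of a diffeomorphism $h$ and some quasi-homogeneous polynomial $P$, i.e. $P=r_1uP_u+r_2vP_v$ for some strictly positive rational numbers $r_1,r_2$. Its Milnor number is $\mu(\delta)=\dim_{\mathbb C}\mathcal O_2/\langle\delta_x,\delta_y\rangle$, with $\mathcal O_2$ the ring of germs (at $q$) of holomorphic functions in two variables (real analytic germs complexified). Multiplicity: with $m(h,k)=\dim_{\mathbb C}\mathcal O_2/\langle h,k\rangle$, $m_u({\rm p})=m(\mathfrak b,\mathfrak c)$ if $E(q)\neq0$, $m(\mathfrak a,\mathfrak c)$ if $F(q)\ne 0$, $m(\mathfrak a,\mathfrak b)$ if $G(q)\neq 0$ (at least one of these holds). *)

theory Defs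
  imports "HOL-Analysis.Analysis" "HOL-Algebra.Embedded_Algebras" "HOL-Algebra.QuotRing"
    "HOL-Library.Extended_Nat"
begin

section \<open>Functions of two variables\<close>

definition pdu :: "(real \<times> real \<Rightarrow> 'a::real_normed_vector) \<Rightarrow> real \<times> real \<Rightarrow> 'a"
  where "pdu f p = vector_derivative (\<lambda>t. f (t, snd p)) (at (fst p))"

definition pdv :: "(real \<times> real \<Rightarrow> 'a::real_normed_vector) \<Rightarrow> real \<times> real \<Rightarrow> 'a"
  where "pdv f p = vector_derivative (\<lambda>t. f (fst p, t)) (at (snd p))"

text \<open>
  Analyticity at a point: the function is the sum of a power series on a polydisc around it, and
  hence is analytic on that whole polydisc. The same definition gives the real analytic functions
  of two real variables and the holomorphic functions of two complex variables.
\<close>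

definition analytic2_at :: "('k::real_normed_field \<times> 'k \<Rightarrow> 'k) \<Rightarrow> 'k \<times> 'k \<Rightarrow> bool"
  where "analytic2_at f p \<longleftrightarrow>
    (\<exists>(c :: nat \<Rightarrow> nat \<Rightarrow> 'k) (r::real). r > 0 \<and>
      (\<forall>s t. norm s < r \<longrightarrow> norm t < r \<longrightarrow>
        ((\<lambda>(i, j). c i j * s ^ i * t ^ j) has_sum f (p + (s, t))) UNIV))"

text \<open>Functions of class $C^k$ on an open set.\<close>

fun Ck_on :: "nat \<Rightarrow> (real \<times> real) set \<Rightarrow> (real \<times> real \<Rightarrow> real) \<Rightarrow> bool"
  where
    "Ck_on 0 V f \<longleftrightarrow> continuous_on V f"
  | "Ck_on (Suc k) V f \<longleftrightarrow>
      (\<forall>p\<in>V. f differentiable (at p)) \<and> Ck_on k V (pdu f) \<and> Ck_on k V (pdv f)"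

definition smooth_map_on :: "(real \<times> real) set \<Rightarrow> (real \<times> real \<Rightarrow> real \<times> real) \<Rightarrow> bool"
  where "smooth_map_on V h \<longleftrightarrow> (\<forall>k. Ck_on k V (fst \<circ> h) \<and> Ck_on k V (snd \<circ> h))"

definition diffeo_germ ::
    "(real \<times> real \<Rightarrow> real \<times> real) \<Rightarrow> real \<times> real \<Rightarrow> real \<times> real \<Rightarrow> bool"
  where "diffeo_germ h p q \<longleftrightarrow>
    (\<exists>V W g. open V \<and> open W \<and> p \<in> V \<and> h p = q \<and> homeomorphism V W h g \<and>
      smooth_map_on V h \<and> smooth_map_on W g)"

definition R_equivalent ::
    "(real \<times> real \<Rightarrow> real) \<Rightarrow> real \<times> real \<Rightarrow> (real \<times> real \<Rightarrow> real) \<Rightarrow> real \<times> real \<Rightarrow> bool"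
  where "R_equivalent f q P p \<longleftrightarrow>
    (\<exists>h. diffeo_germ h p q \<and> (\<forall>\<^sub>F s in nhds p. f (h s) = P s))"

definition quasi_homogeneous :: "(real \<times> real \<Rightarrow> real) \<Rightarrow> bool"
  where "quasi_homogeneous P \<longleftrightarrow> real_polynomial_function P \<and>
    (\<exists>r1 r2 :: rat. r1 > 0 \<and> r2 > 0 \<and>
      (\<forall>u v. P (u, v) = of_rat r1 * u * pdu P (u, v) + of_rat r2 * v * pdv P (u, v)))"


section \<open>Germs of holomorphic functions and intersection numbers\<close>

text \<open>
  A germ is the set of all functions that agree with a given one near the base point; the values
  away from the base point are irrelevant.
\<close>

definition germ :: "complex \<times> complex \<Rightarrow> (complex \<times> complex \<Rightarrow> complex) \<Rightarrow>
    (complex \<times> complex \<Rightarrow> complex) set"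
  where "germ z f = {g. \<forall>\<^sub>F w in nhds z. g w = f w}"

definition O2 :: "complex \<times> complex \<Rightarrow> (complex \<times> complex \<Rightarrow> complex) set ring"
  where "O2 z =
    \<lparr>carrier = {germ z f | f. analytic2_at f z},
     mult = (\<lambda>A B. {h. \<exists>f\<in>A. \<exists>g\<in>B. \<forall>\<^sub>F w in nhds z. h w = f w * g w}),
     one = germ z (\<lambda>w. 1),
     zero = germ z (\<lambda>w. 0),
     add = (\<lambda>A B. {h. \<exists>f\<in>A. \<exists>g\<in>B. \<forall>\<^sub>F w in nhds z. h w = f w + g w})\<rparr>"

lemma O2_mult_germ: "germ z f \<otimes>\<^bsub>O2 z\<^esub> germ z g = germ z (\<lambda>w. f w * g w)"
proof (intro Set.set_eqI iffI)
  fix h assume "h \<in> germ z f \<otimes>\<^bsub>O2 z\<^esub> germ z g"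
  then obtain f' g' where "\<forall>\<^sub>F w in nhds z. f' w = f w" "\<forall>\<^sub>F w in nhds z. g' w = g w"
    "\<forall>\<^sub>F w in nhds z. h w = f' w * g' w"
    by (auto simp: O2_def germ_def)
  then have "\<forall>\<^sub>F w in nhds z. h w = f w * g w"
    by eventually_elim simp
  then show "h \<in> germ z (\<lambda>w. f w * g w)"
    by (simp add: germ_def)
next
  fix h assume "h \<in> germ z (\<lambda>w. f w * g w)"
  then have "\<forall>\<^sub>F w in nhds z. h w = f w * g w"
    by (simp add: germ_def)
  moreover have "f \<in> germ z f" "g \<in> germ z g"
    by (simp_all add: germ_def)
  ultimately show "h \<in> germ z f \<otimes>\<^bsub>O2 z\<^esub> germ z g"
    unfolding O2_def by (simp, blast)
qed

lemma O2_add_germ: "germ z f \<oplus>\<^bsub>O2 z\<^esub> germ z g = germ z (\<lambda>w. f w + g w)"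
proof (intro Set.set_eqI iffI)
  fix h assume "h \<in> germ z f \<oplus>\<^bsub>O2 z\<^esub> germ z g"
  then obtain f' g' where "\<forall>\<^sub>F w in nhds z. f' w = f w" "\<forall>\<^sub>F w in nhds z. g' w = g w"
    "\<forall>\<^sub>F w in nhds z. h w = f' w + g' w"
    by (auto simp: O2_def germ_def)
  then have "\<forall>\<^sub>F w in nhds z. h w = f w + g w"
    by eventually_elim simp
  then show "h \<in> germ z (\<lambda>w. f w + g w)"
    by (simp add: germ_def)
next
  fix h assume "h \<in> germ z (\<lambda>w. f w + g w)"
  then have "\<forall>\<^sub>F w in nhds z. h w = f w + g w"
    by (simp add: germ_def)
  moreover have "f \<in> germ z f" "g \<in> germ z g"
    by (simp_all add: germ_def)
  ultimately show "h \<in> germ z f \<oplus>\<^bsub>O2 z\<^esub> germ z g"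
    unfolding O2_def by (simp, blast)
qed

text \<open>
  The dimension of the quotient of \<open>O2 z\<close> by an ideal over the image of the constant germs, i.e.
  over the complex numbers; it is \<open>\<infinity>\<close> if the quotient is not finite-dimensional.
\<close>

definition quotient_dim :: "complex \<times> complex \<Rightarrow> (complex \<times> complex \<Rightarrow> complex) set set \<Rightarrow> enat"
  where "quotient_dim z I =
    (let Q = O2 z Quot I;
         K = range (\<lambda>c::complex. I +>\<^bsub>O2 z\<^esub> germ z (\<lambda>w. c))
     in if \<exists>n. ring.dimension Q n K (carrier Q)
        then enat (THE n. ring.dimension Q n K (carrier Q)) else \<infinity>)"

definition cpoint :: "real \<times> real \<Rightarrow> complex \<times> complex"
  where "cpoint q = (of_real (fst q), of_real (snd q))"

text \<open>
  The complexification of a germ of a real analytic function: the functions that are holomorphic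
  near \<open>q\<close> and extend it. By the identity theorem these form exactly one germ of \<open>O2\<close>.
\<close>

definition complexify :: "real \<times> real \<Rightarrow> (real \<times> real \<Rightarrow> real) \<Rightarrow>
    (complex \<times> complex \<Rightarrow> complex) set"
  where "complexify q f =
    {F. analytic2_at F (cpoint q) \<and> (\<forall>\<^sub>F s in nhds q. F (cpoint s) = of_real (f s))}"

definition intersection_mult ::
    "real \<times> real \<Rightarrow> (real \<times> real \<Rightarrow> real) \<Rightarrow> (real \<times> real \<Rightarrow> real) \<Rightarrow> enat"
  where "intersection_mult q h k =
    quotient_dim (cpoint q) (Idl\<^bsub>O2 (cpoint q)\<^esub> {complexify q h, complexify q k})"

definition milnor_number :: "real \<times> real \<Rightarrow> (real \<times> real \<Rightarrow> real) \<Rightarrow> enat"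
  where "milnor_number q f = intersection_mult q (pdu f) (pdv f)"


section \<open>Surfaces in Minkowski 3-space\<close>

text \<open>The timelike coordinate is the third one.\<close>

definition mink :: "real^3 \<Rightarrow> real^3 \<Rightarrow> real"
  where "mink u v = u $ 1 * v $ 1 + u $ 2 * v $ 2 - u $ 3 * v $ 3"

definition mink_cross :: "real^3 \<Rightarrow> real^3 \<Rightarrow> real^3"
  where "mink_cross u v =
    vector [cross3 u v $ 1, cross3 u v $ 2, - (cross3 u v $ 3)]"

lemma mink_mink_cross: "mink (mink_cross u v) w = det (vector [u, v, w] :: real^3^3)"
  by (simp add: mink_def mink_cross_def cross3_def det_3 algebra_simps)

definition local_parametrisation ::
    "(real^3) set \<Rightarrow> (real \<times> real) set \<Rightarrow> (real \<times> real \<Rightarrow> real^3) \<Rightarrow> bool"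
  where "local_parametrisation M U x \<longleftrightarrow>
    open U \<and> (\<forall>p\<in>U. \<forall>i. analytic2_at (\<lambda>s. x s $ i) p) \<and>
    (\<forall>p\<in>U. \<forall>a b. a *\<^sub>R pdu x p + b *\<^sub>R pdv x p = 0 \<longrightarrow> a = 0 \<and> b = 0) \<and>
    openin (top_of_set M) (x ` U) \<and> (\<exists>g. homeomorphism U (x ` U) x g)"

definition regular_analytic_surface :: "(real^3) set \<Rightarrow> bool"
  where "regular_analytic_surface M \<longleftrightarrow>
    (\<forall>p\<in>M. \<exists>U x. local_parametrisation M U x \<and> p \<in> x ` U)"

definition coef_E :: "(real \<times> real \<Rightarrow> real^3) \<Rightarrow> real \<times> real \<Rightarrow> real"
  where "coef_E x s = mink (pdu x s) (pdu x s)"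

definition coef_F :: "(real \<times> real \<Rightarrow> real^3) \<Rightarrow> real \<times> real \<Rightarrow> real"
  where "coef_F x s = mink (pdu x s) (pdv x s)"

definition coef_G :: "(real \<times> real \<Rightarrow> real^3) \<Rightarrow> real \<times> real \<Rightarrow> real"
  where "coef_G x s = mink (pdv x s) (pdv x s)"

definition coef_l :: "(real \<times> real \<Rightarrow> real^3) \<Rightarrow> real \<times> real \<Rightarrow> real"
  where "coef_l x s = mink (mink_cross (pdu x s) (pdv x s)) (pdu (pdu x) s)"

definition coef_m :: "(real \<times> real \<Rightarrow> real^3) \<Rightarrow> real \<times> real \<Rightarrow> real"
  where "coef_m x s = mink (mink_cross (pdu x s) (pdv x s)) (pdv (pdu x) s)"

definition coef_n :: "(real \<times> real \<Rightarrow> real^3) \<Rightarrow> real \<times> real \<Rightarrow> real"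
  where "coef_n x s = mink (mink_cross (pdu x s) (pdv x s)) (pdv (pdv x) s)"

definition coef_a :: "(real \<times> real \<Rightarrow> real^3) \<Rightarrow> real \<times> real \<Rightarrow> real"
  where "coef_a x s = coef_F x s * coef_n x s - coef_G x s * coef_m x s"

definition coef_b :: "(real \<times> real \<Rightarrow> real^3) \<Rightarrow> real \<times> real \<Rightarrow> real"
  where "coef_b x s = coef_E x s * coef_n x s - coef_G x s * coef_l x s"

definition coef_c :: "(real \<times> real \<Rightarrow> real^3) \<Rightarrow> real \<times> real \<Rightarrow> real"
  where "coef_c x s = coef_E x s * coef_m x s - coef_F x s * coef_l x s"

definition LD_delta :: "(real \<times> real \<Rightarrow> real^3) \<Rightarrow> real \<times> real \<Rightarrow> real"
  where "LD_delta x s = (coef_F x s)\<^sup>2 - coef_E x s * coef_G x s"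

definition lightlike_umbilic :: "(real \<times> real \<Rightarrow> real^3) \<Rightarrow> real \<times> real \<Rightarrow> bool"
  where "lightlike_umbilic x q \<longleftrightarrow>
    LD_delta x q = 0 \<and> coef_a x q = 0 \<and> coef_b x q = 0 \<and> coef_c x q = 0"

definition LD_singular :: "(real \<times> real \<Rightarrow> real^3) \<Rightarrow> real \<times> real \<Rightarrow> bool"
  where "LD_singular x q \<longleftrightarrow>
    LD_delta x q = 0 \<and> pdu (LD_delta x) q = 0 \<and> pdv (LD_delta x) q = 0"

text \<open>
  The cases overlap. The definite description makes their agreement part of the meaning: for the
  description to denote anything, the applicable intersection numbers must coincide.
\<close>

definition umbilic_mult :: "(real \<times> real \<Rightarrow> real^3) \<Rightarrow> real \<times> real \<Rightarrow> enat"
  where "umbilic_mult x q = (THE m.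
    (coef_E x q \<noteq> 0 \<longrightarrow> m = intersection_mult q (coef_b x) (coef_c x)) \<and>
    (coef_F x q \<noteq> 0 \<longrightarrow> m = intersection_mult q (coef_a x) (coef_c x)) \<and>
    (coef_G x q \<noteq> 0 \<longrightarrow> m = intersection_mult q (coef_a x) (coef_b x)))"

end

theory Submission
  imports Defs
begin

text \<open>
  Put \<open>\<delta> = F\<^sup>2 - E G\<close>. The relation \<open>E \<aa> - F \<bb> + G \<cc> = 0\<close> shows that the ideals generated by the pairs of
  \<open>\<aa>, \<bb>, \<cc>\<close> that enter the multiplicity are one and the same ideal, and the theorem says that this
  ideal has the same codimension as the gradient ideal \<open>\<langle>\<delta>\<^sub>u, \<delta>\<^sub>v\<rangle>\<close>.

  Geometry. Let \<open>N = x\<^sub>u \<times> x\<^sub>v\<close>. Then \<open>\<delta> = \<langle>N, N\<rangle>\<close>, so that \<open>N\<close> is tangent along the locus of degeneracy.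
  Choose a constant vector \<open>T\<close> that is not orthogonal to \<open>N(q)\<close> and expand
  \<open>D N = \<alpha> x\<^sub>u + \<beta> x\<^sub>v + \<delta> T\<close> with \<open>D = \<langle>N, T\<rangle>\<close> (\<open>mink_cramer\<close>). Pairing this with \<open>N\<^sub>u\<close> and \<open>N\<^sub>v\<close>
  gives \<open>D \<delta>\<^sub>u / 2 = - \<alpha> l - \<beta> m\<close> and \<open>D \<delta>\<^sub>v / 2 = - \<alpha> m - \<beta> n\<close> modulo \<open>\<delta>\<close>, pairing it with \<open>x\<^sub>u\<close> and \<open>x\<^sub>v\<close> gives
  \<open>\<alpha> E + \<beta> F = \<alpha> F + \<beta> G = 0\<close> modulo \<open>\<delta>\<close>. Eliminating \<open>\<alpha>\<close>, one finds that for \<open>E(q) \<noteq> 0\<close> the pair \<open>(\<bb>, \<cc>)\<close>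
  is, modulo \<open>\<delta>\<close>, an invertible matrix times \<open>(\<delta>\<^sub>u, \<delta>\<^sub>v)\<close> (\<open>umbilic_ideal_identities\<close>). The case
  \<open>G(q) \<noteq> 0\<close> is obtained by exchanging \<open>u\<close> and \<open>v\<close>; if \<open>F(q) \<noteq> 0\<close> then \<open>E(q) \<noteq> 0\<close> because \<open>\<delta>(q) = 0\<close>.

  Quasi-homogeneity. It remains to absorb \<open>\<delta>\<close>. Transporting the Euler relation of \<open>P\<close> by the diffeomorphism
  yields \<open>\<delta> = R \<delta>\<^sub>u + S \<delta>\<^sub>v\<close> with \<open>R(q) = S(q) = 0\<close> (\<open>quasi_homogeneous_euler_relation\<close>). If \<open>R\<close> and
  \<open>S\<close> were analytic, the two ideals would coincide. But the diffeomorphism is only smooth, and so are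
  \<open>R\<close> and \<open>S\<close>; all that survives is that they have Taylor polynomials, so that the ideals agree modulo
  every power of the maximal ideal.

  Algebra. This is enough for the codimensions (\<open>intersection_mult_eq_if_equal_mod_powers\<close>). If one of
  the ideals, say \<open>J\<close>, has finite codimension, then linear dependence of the powers of a coordinate
  modulo \<open>J\<close> shows that \<open>J\<close> contains a power of each coordinate, hence a power of the maximal ideal;
  remainders of high order then lie in the maximal ideal times \<open>J\<close> and can be moved into the
  coefficients of the matrix without spoiling its invertibility, as in Nakayama's lemma. So the ideals are
  equal. Otherwise both codimensions are infinite.
\<close>

section \<open>Absolutely convergent power series in two variables\<close>

definition mon :: "'k::comm_semiring_1 \<times> 'k \<Rightarrow> nat \<times> nat \<Rightarrow> 'k"
  where "mon w a = fst w ^ fst a * snd w ^ snd a"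

definition deg :: "nat \<times> nat \<Rightarrow> nat"
  where "deg a = fst a + snd a"

lemma mon_add: "mon w (a + b) = mon w a * mon w b"
  by (simp add: mon_def power_add mult_ac)

lemma deg_add: "deg (a + b) = deg a + deg b"
  by (simp add: deg_def)

lemma norm_mon_le:
  fixes w :: "'k::real_normed_field \<times> 'k"
  assumes "norm (fst w) \<le> \<rho>" "norm (snd w) \<le> \<rho>"
  shows "norm (mon w a) \<le> \<rho> ^ deg a"
proof -
  have "0 \<le> \<rho>" using assms(1) norm_ge_zero order_trans by blast
  then show ?thesis
    unfolding mon_def deg_def power_add norm_mult norm_power
    by (intro mult_mono power_mono assms) auto
qed

lemma abs_summable_times:
  fixes f :: "'a \<Rightarrow> 'c::real_normed_field" and g :: "'b \<Rightarrow> 'c"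
  assumes "f abs_summable_on A" "g abs_summable_on B"
  shows "(\<lambda>(a, b). f a * g b) abs_summable_on A \<times> B"
proof (rule summable_on_SigmaI)
  show "((\<lambda>y. norm (case (a, y) of (a, b) \<Rightarrow> f a * g b)) has_sum
      (norm (f a) * (\<Sum>\<^sub>\<infinity>y\<in>B. norm (g y)))) B" for a
    using assms(2) by (auto simp: norm_mult intro!: has_sum_cmult_right has_sum_infsum)
  show "(\<lambda>a. norm (f a) * (\<Sum>\<^sub>\<infinity>y\<in>B. norm (g y))) summable_on A"
    using assms(1) by (rule summable_on_cmult_left)
qed auto

lemma summable_deg_power:
  fixes x :: real
  assumes "0 \<le> x" "x < 1"
  shows "(\<lambda>a. x ^ deg a) summable_on UNIV"
proof -
  have g: "(\<lambda>i. x ^ i) summable_on (UNIV :: nat set)"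
    using assms by (intro summable_nonneg_imp_summable_on) (auto simp: summable_geometric_iff)
  then have g': "(\<lambda>i. norm (x ^ i)) summable_on (UNIV :: nat set)"
    using assms by simp
  have "(\<lambda>(i, j). x ^ i * x ^ j) summable_on (UNIV :: nat set) \<times> (UNIV :: nat set)"
    by (rule abs_summable_summable, rule abs_summable_times[OF g' g'])
  then show ?thesis
    by (simp add: deg_def power_add case_prod_unfold)
qed

text \<open>
  Bounded terms are all that is needed to pass from unconditional to absolute convergence of a power
  series, because they give a geometric majorant on every smaller polydisc.
\<close>

lemma summable_on_imp_bounded_terms:
  fixes f :: "'a \<Rightarrow> 'b::real_normed_vector"
  assumes "f summable_on A"
  obtains B where "B \<ge> 0" "\<And>a. a \<in> A \<Longrightarrow> norm (f a) \<le> B"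
proof -
  obtain S where S: "(f has_sum S) A"
    using assms summable_on_def by blast
  obtain X where X: "finite X" "X \<subseteq> A"
    and *: "\<And>Y. finite Y \<Longrightarrow> X \<subseteq> Y \<Longrightarrow> Y \<subseteq> A \<Longrightarrow> dist (sum f Y) S < 1"
    using tendstoD[OF S[unfolded has_sum_def], of 1]
    by (auto simp: eventually_finite_subsets_at_top)
  have "norm (f a) \<le> 2 + sum (\<lambda>a. norm (f a)) X" if "a \<in> A" for a
  proof (cases "a \<in> X")
    case True
    then have "norm (f a) \<le> sum (\<lambda>a. norm (f a)) X"
      using X by (intro member_le_sum) auto
    then show ?thesis by simp
  next
    case False
    have "dist (sum f (insert a X)) S < 1" "dist (sum f X) S < 1"
      using X that by (auto intro!: *)
    then have "dist (f a + sum f X) (sum f X) < 2"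
      using False X dist_triangle_half_l[of "f a + sum f X" S 2 "sum f X"] by (simp add: dist_commute)
    then have "norm (f a) < 2" by (simp add: dist_norm)
    moreover have "0 \<le> sum (\<lambda>a. norm (f a)) X" by (simp add: sum_nonneg)
    ultimately show ?thesis by simp
  qed
  moreover have "2 + sum (\<lambda>a. norm (f a)) X \<ge> 0"
    by (simp add: add_nonneg_nonneg sum_nonneg)
  ultimately show ?thesis using that by blast
qed

text \<open>
  Analyticity in a form that is stable under the ring operations: the closed polydisc and the
  summability of the majorant make all rearrangements of the double series legitimate. The
  coefficients and the radius are explicit because later arguments compare coefficients.
\<close>

definition expands ::
    "('k::{real_normed_field,banach} \<times> 'k \<Rightarrow> 'k) \<Rightarrow> 'k \<times> 'k \<Rightarrow> (nat \<times> nat \<Rightarrow> 'k) \<Rightarrow> real \<Rightarrow> bool"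
  where "expands f p c r \<longleftrightarrow> r > 0 \<and> (\<lambda>a. norm (c a) * r ^ deg a) summable_on UNIV \<and>
    (\<forall>w. norm (fst w) \<le> r \<longrightarrow> norm (snd w) \<le> r \<longrightarrow> ((\<lambda>a. c a * mon w a) has_sum f (p + w)) UNIV)"

lemma expands_pos: "expands f p c r \<Longrightarrow> 0 < r"
  by (simp add: expands_def)

lemma expands_summable: "expands f p c r \<Longrightarrow> (\<lambda>a. norm (c a) * r ^ deg a) summable_on UNIV"
  by (simp add: expands_def)

lemma expands_has_sum:
  "expands f p c r \<Longrightarrow> norm (fst w) \<le> r \<Longrightarrow> norm (snd w) \<le> r \<Longrightarrow>
    ((\<lambda>a. c a * mon w a) has_sum f (p + w)) UNIV"
  by (auto simp only: expands_def)

lemma summable_norm_lower_radius: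
  assumes "\<And>a. norm (c a) * \<sigma> ^ deg a \<le> B" "0 \<le> \<rho>" "\<rho> < \<sigma>"
  shows "(\<lambda>a. norm (c a) * \<rho> ^ deg a) summable_on UNIV"
proof (rule summable_on_comparison_test)
  show "(\<lambda>a. B * (\<rho> / \<sigma>) ^ deg a) summable_on UNIV"
    using assms by (intro summable_on_cmult_right summable_deg_power) auto
  fix a
  have "norm (c a) * \<rho> ^ deg a = norm (c a) * \<sigma> ^ deg a * (\<rho> / \<sigma>) ^ deg a"
    using assms by (simp add: power_divide)
  also have "\<dots> \<le> B * (\<rho> / \<sigma>) ^ deg a"
    using assms by (intro mult_right_mono) auto
  finally show "norm (c a) * \<rho> ^ deg a \<le> B * (\<rho> / \<sigma>) ^ deg a" .
  show "0 \<le> norm (c a) * \<rho> ^ deg a" using assms by simp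
qed

lemma summable_mon:
  fixes c :: "nat \<times> nat \<Rightarrow> 'k::{real_normed_field,banach}"
  assumes "(\<lambda>a. norm (c a) * r ^ deg a) summable_on UNIV"
    and "norm (fst w) \<le> r" "norm (snd w) \<le> r"
  shows "(\<lambda>a. norm (c a * mon w a)) summable_on UNIV"
  using assms(1)
proof (rule summable_on_comparison_test)
  show "norm (c a * mon w a) \<le> norm (c a) * r ^ deg a" for a
    unfolding norm_mult by (intro mult_left_mono norm_mon_le assms) auto
qed auto

lemma expandsI:
  assumes "r > 0" "(\<lambda>a. norm (c a) * r ^ deg a) summable_on UNIV"
  shows "expands (\<lambda>z. \<Sum>\<^sub>\<infinity>a. c a * mon (z - p) a) p c r"
  unfolding expands_def
proof (intro conjI allI impI assms)
  fix w :: "'a \<times> 'a" assume "norm (fst w) \<le> r" "norm (snd w) \<le> r"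
  then have "(\<lambda>a. c a * mon w a) summable_on UNIV"
    by (intro abs_summable_summable[OF summable_mon[OF assms(2)]])
  then show "((\<lambda>a. c a * mon w a) has_sum (\<Sum>\<^sub>\<infinity>a. c a * mon (p + w - p) a)) UNIV"
    by simp
qed

lemma analytic2_at_iff_expands: "analytic2_at f p \<longleftrightarrow> (\<exists>c r. expands f p c r)"
proof
  assume "analytic2_at f p"
  then obtain d r where r: "r > 0"
    and *: "\<And>s t. norm s < r \<Longrightarrow> norm t < r \<Longrightarrow>
        ((\<lambda>(i, j). d i j * s ^ i * t ^ j) has_sum f (p + (s, t))) UNIV"
    unfolding analytic2_at_def by blast
  define c where "c = (\<lambda>(i, j). d i j)"
  have hs: "((\<lambda>a. c a * mon w a) has_sum f (p + w)) UNIV"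
    if "norm (fst w) < r" "norm (snd w) < r" for w
    using *[OF that] by (simp add: c_def mon_def case_prod_unfold mult_ac)
  define w :: "'a \<times> 'a" where "w = (of_real (r/2), of_real (r/2))"
  have "(\<lambda>a. c a * mon w a) summable_on UNIV"
    using hs[of w] r unfolding summable_on_def by (auto simp: w_def)
  then obtain B where B: "\<And>a. norm (c a * mon w a) \<le> B"
    by (rule summable_on_imp_bounded_terms) auto
  have "norm (c a) * (r/2) ^ deg a \<le> B" for a
    using B[of a] r by (simp add: norm_mult w_def mon_def deg_def power_add norm_power norm_divide)
  then have "(\<lambda>a. norm (c a) * (r/4) ^ deg a) summable_on UNIV"
    by (rule summable_norm_lower_radius) (use r in auto)
  then have "expands f p c (r/4)"
    unfolding expands_def using hs r by auto
  then show "\<exists>c r. expands f p c r" by blast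
next
  assume "\<exists>c r. expands f p c r"
  then obtain c r where "expands f p c r" by blast
  then show "analytic2_at f p"
    unfolding analytic2_at_def expands_def
    by (intro exI[of _ "\<lambda>i j. c (i, j)"] exI[of _ r])
      (auto simp: mon_def case_prod_unfold mult_ac)
qed

lemma expands_imp_analytic2: "expands f p c r \<Longrightarrow> analytic2_at f p"
  by (auto simp: analytic2_at_iff_expands)

lemma analytic2E:
  assumes "analytic2_at f p"
  obtains c r where "expands f p c r"
  using assms by (auto simp: analytic2_at_iff_expands)

lemma expands_mono:
  assumes "expands f p c r" "0 < r'" "r' \<le> r"
  shows "expands f p c r'"
proof -
  have "(\<lambda>a. norm (c a) * r' ^ deg a) summable_on UNIV"
    by (rule summable_on_comparison_test[of "\<lambda>a. norm (c a) * r ^ deg a"])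
      (use assms in \<open>auto simp: expands_def intro!: mult_left_mono power_mono\<close>)
  then show ?thesis using assms by (auto simp: expands_def)
qed

lemma expands_mon_norm:
  assumes "expands f p c r" "norm (fst w) \<le> r" "norm (snd w) \<le> r"
  shows "(\<lambda>a. norm (c a * mon w a)) summable_on UNIV"
  using expands_summable[OF assms(1)] assms(2,3) by (rule summable_mon)

lemma eventually_nhds_shift_iff:
  fixes p :: "'a::real_normed_vector"
  shows "(\<forall>\<^sub>F z in nhds p. Q z) \<longleftrightarrow> (\<forall>\<^sub>F w in nhds 0. Q (p + w))"
proof -
  have "nhds p = filtermap (\<lambda>w. p + w) (nhds 0)"
    using filtermap_nhds_shift[of "-p" 0] by (simp add: add.commute)
  then show ?thesis by (simp add: eventually_filtermap)
qed

lemma eventually_nhds_polydisc: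
  assumes "r > 0"
  shows "\<forall>\<^sub>F w in nhds (0 :: 'a::real_normed_vector \<times> 'b::real_normed_vector).
    norm (fst w) \<le> r \<and> norm (snd w) \<le> r"
  unfolding eventually_nhds_metric
proof (intro exI[of _ r] conjI allI impI assms)
  fix w :: "'a \<times> 'b" assume "dist w 0 < r"
  then have "norm w < r" by (simp add: dist_norm)
  then show "norm (fst w) \<le> r" "norm (snd w) \<le> r"
    using norm_fst_le[of "fst w" "snd w"] norm_snd_le[of "snd w" "fst w"] by auto
qed

lemma eventually_nhds_polydiscE:
  assumes "\<forall>\<^sub>F w in nhds (0 :: 'a::real_normed_vector \<times> 'b::real_normed_vector). Q w"
  obtains r where "r > 0" "\<And>w. norm (fst w) \<le> r \<Longrightarrow> norm (snd w) \<le> r \<Longrightarrow> Q w"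
proof -
  obtain e where e: "e > 0" "\<And>w. dist w 0 < e \<Longrightarrow> Q w"
    using assms unfolding eventually_nhds_metric by auto
  show ?thesis
  proof (rule that[of "e/3"])
    fix w :: "'a \<times> 'b" assume "norm (fst w) \<le> e/3" "norm (snd w) \<le> e/3"
    then have "norm w \<le> e/3 + e/3" using norm_Pair_le[of "fst w" "snd w"] by simp
    then show "Q w" using e by (intro e(2)) (simp add: dist_norm)
  qed (use e in simp)
qed

lemma expands_cong:
  assumes "expands f p c r" "\<forall>\<^sub>F z in nhds p. g z = f z"
  obtains r' where "0 < r'" "r' \<le> r" "expands g p c r'"
proof -
  obtain e where e: "e > 0" "\<And>w. norm (fst w) \<le> e \<Longrightarrow> norm (snd w) \<le> e \<Longrightarrow> g (p + w) = f (p + w)"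
    using eventually_nhds_polydiscE[OF assms(2)[unfolded eventually_nhds_shift_iff[where p = p]]] by metis
  have "expands f p c (min e r)"
    by (rule expands_mono[OF assms(1)]) (use e assms(1) in \<open>auto simp: expands_def\<close>)
  then have "expands g p c (min e r)"
    using e by (auto simp: expands_def)
  then show ?thesis
    using that[of "min e r"] by (auto simp: expands_def)
qed

lemma analytic2_cong:
  fixes f :: "'k::{real_normed_field,banach} \<times> 'k \<Rightarrow> 'k"
  assumes "analytic2_at f p" "\<forall>\<^sub>F z in nhds p. g z = f z"
  shows "analytic2_at g p"
proof -
  obtain c r where "expands f p c r" using assms(1) by (rule analytic2E)
  then obtain r' where "expands g p c r'" using assms(2) by (rule expands_cong)
  then show ?thesis by (rule expands_imp_analytic2)
qed

text \<open>
  Polynomials, seen as power series with finitely many coefficients; only the coordinates and the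
  constants need this, everything else is built by ring operations.
\<close>

lemma expands_finite:
  assumes "finite S" "\<And>a. a \<notin> S \<Longrightarrow> c a = 0" "\<And>w. f (p + w) = (\<Sum>a\<in>S. c a * mon w a)"
  shows "expands f p c 1"
  unfolding expands_def
proof (intro conjI allI impI)
  have "(\<lambda>a. norm (c a) * 1 ^ deg a) summable_on S" using assms by simp
  then show "(\<lambda>a. norm (c a) * 1 ^ deg a) summable_on UNIV"
    by (subst (asm) summable_on_cong_neutral[of UNIV]) (use assms in auto)
  fix w :: "'a \<times> 'a"
  have "((\<lambda>a. c a * mon w a) has_sum (\<Sum>a\<in>S. c a * mon w a)) S"
    using assms by simp
  then show "((\<lambda>a. c a * mon w a) has_sum f (p + w)) UNIV"
    by (subst (asm) has_sum_cong_neutral[of UNIV]) (use assms in auto)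
qed simp

lemma analytic2_const [simp]: "analytic2_at (\<lambda>_. k :: 'k::{real_normed_field,banach}) p"
  by (rule expands_imp_analytic2, rule expands_finite[of "{(0,0)}" "\<lambda>a. if a = (0,0) then k else 0"])
    (auto simp: mon_def)

lemma analytic2_fst [simp]: "analytic2_at (fst :: 'k::{real_normed_field,banach} \<times> 'k \<Rightarrow> 'k) p"
  by (rule expands_imp_analytic2, rule expands_finite[of "{(0,0), (1,0)}"
        "\<lambda>a. if a = (0,0) then fst p else if a = (1,0) then 1 else 0"])
    (auto simp: mon_def)

lemma analytic2_snd [simp]: "analytic2_at (snd :: 'k::{real_normed_field,banach} \<times> 'k \<Rightarrow> 'k) p"
  by (rule expands_imp_analytic2, rule expands_finite[of "{(0,0), (0,1)}"
        "\<lambda>a. if a = (0,0) then snd p else if a = (0,1) then 1 else 0"])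
    (auto simp: mon_def)

lemma expands_add:
  assumes "expands f p c r" "expands g p d r"
  shows "expands (\<lambda>z. f z + g z) p (\<lambda>a. c a + d a) r"
  unfolding expands_def
proof (intro conjI allI impI)
  show "r > 0" using assms by (simp add: expands_def)
  have "(\<lambda>a. norm (c a) * r ^ deg a + norm (d a) * r ^ deg a) summable_on UNIV"
    using assms by (intro summable_on_add) (auto simp: expands_def)
  then show "(\<lambda>a. norm (c a + d a) * r ^ deg a) summable_on UNIV"
    by (rule summable_on_comparison_test)
      (use \<open>r > 0\<close> in \<open>auto simp: distrib_right[symmetric] intro!: mult_right_mono norm_triangle_ineq\<close>)
  fix w :: "'a \<times> 'a" assume "norm (fst w) \<le> r" "norm (snd w) \<le> r"
  then have "((\<lambda>a. c a * mon w a) has_sum f (p + w)) UNIV"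
    "((\<lambda>a. d a * mon w a) has_sum g (p + w)) UNIV"
    using assms by (auto intro: expands_has_sum)
  then show "((\<lambda>a. (c a + d a) * mon w a) has_sum (f (p + w) + g (p + w))) UNIV"
    unfolding distrib_right by (rule has_sum_add)
qed

lemma expands_common:
  assumes "expands f p c r" "expands g p d r'"
  obtains s where "s \<le> r" "s \<le> r'" "expands f p c s" "expands g p d s"
  by (rule that[of "min r r'"])
    (use assms[THEN expands_pos] in \<open>auto intro!: expands_mono[OF assms(1)] expands_mono[OF assms(2)]\<close>)

lemma analytic2_add [simp]:
  assumes "analytic2_at f p" "analytic2_at g p"
  shows "analytic2_at (\<lambda>z. f z + g z :: 'k::{real_normed_field,banach}) p"
proof -
  obtain c r where f: "expands f p c r" using assms(1) by (rule analytic2E)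
  obtain d r' where g: "expands g p d r'" using assms(2) by (rule analytic2E)
  from f g obtain s where "expands f p c s" "expands g p d s"
    by (rule expands_common)
  then show ?thesis
    by (rule expands_imp_analytic2[OF expands_add])
qed

definition cauchy_product :: "(nat \<times> nat \<Rightarrow> 'k::comm_semiring_1) \<Rightarrow> (nat \<times> nat \<Rightarrow> 'k) \<Rightarrow> nat \<times> nat \<Rightarrow> 'k"
  where "cauchy_product c d e = (\<Sum>b \<in> {..fst e} \<times> {..snd e}. c b * d (e - b))"

text \<open>
  The absolutely convergent sum over all pairs \<open>(a, b)\<close> is regrouped along the fibres of
  \<open>(a, b) \<mapsto> a + b\<close>, which are finite.
\<close>

lemma has_sum_cauchy_product:
  fixes c d :: "nat \<times> nat \<Rightarrow> 'k::{real_normed_field,banach}"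
  assumes "(\<lambda>a. norm (c a * mon w a)) summable_on UNIV" "((\<lambda>a. c a * mon w a) has_sum A) UNIV"
    and "(\<lambda>a. norm (d a * mon w a)) summable_on UNIV" "((\<lambda>a. d a * mon w a) has_sum B) UNIV"
  shows "((\<lambda>e. cauchy_product c d e * mon w e) has_sum (A * B)) UNIV"
    and "(\<lambda>e. norm (cauchy_product c d e * mon w e)) summable_on UNIV"
proof -
  define h where "h = (\<lambda>(a, b). (c a * mon w a) * (d b * mon w b))"
  define T where "T = (SIGMA e:(UNIV :: (nat \<times> nat) set). {..fst e} \<times> {..snd e})"
  have ns: "(\<lambda>x. norm (h x)) summable_on UNIV \<times> UNIV"
    using abs_summable_times[OF assms(1,3)] by (simp add: h_def case_prod_unfold)
  have hs: "(h has_sum (A * B)) (UNIV \<times> UNIV)"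
  proof (rule has_sum_SigmaI)
    show "((\<lambda>y. h (x, y)) has_sum (c x * mon w x * B)) UNIV" for x
      unfolding h_def using has_sum_cmult_right[OF assms(4)] by simp
    show "((\<lambda>x. c x * mon w x * B) has_sum (A * B)) UNIV"
      by (rule has_sum_cmult_left[OF assms(2)])
    show "h summable_on UNIV \<times> UNIV" using ns by (rule abs_summable_summable)
  qed
  define \<phi> where "\<phi> = (\<lambda>(e, b). (b, e - b) :: (nat \<times> nat) \<times> (nat \<times> nat))"
  have bij: "bij_betw \<phi> T (UNIV \<times> UNIV)"
    by (rule bij_betwI[of _ _ _ "\<lambda>(a, b). (a + b, a)"])
      (auto simp: \<phi>_def T_def plus_prod_def prod_eq_iff)
  have hT: "h (\<phi> (e, b)) = c b * d (e - b) * mon w e" if "b \<in> {..fst e} \<times> {..snd e}" for e b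
  proof -
    have "b + (e - b) = e" using that by (auto simp: prod_eq_iff)
    then have "mon w e = mon w b * mon w (e - b)" by (metis mon_add)
    then show ?thesis by (simp add: h_def \<phi>_def mult_ac)
  qed
  have "((\<lambda>x. h (\<phi> x)) has_sum (A * B)) T"
    using hs by (subst has_sum_reindex_bij_betw[OF bij])
  then have "((\<lambda>e. \<Sum>b\<in>{..fst e} \<times> {..snd e}. h (\<phi> (e, b))) has_sum (A * B)) UNIV"
    unfolding T_def by (rule has_sum_SigmaD) auto
  then show "((\<lambda>e. cauchy_product c d e * mon w e) has_sum (A * B)) UNIV"
    by (rule has_sum_cong[THEN iffD1, rotated])
      (auto simp: cauchy_product_def sum_distrib_right hT intro!: sum.cong)
  have "(\<lambda>x. norm (h (\<phi> x))) summable_on T"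
    using ns by (subst summable_on_reindex_bij_betw[OF bij, of "\<lambda>x. norm (h x)"])
  then have "(\<lambda>e. \<Sum>\<^sub>\<infinity>b\<in>{..fst e} \<times> {..snd e}. norm (h (\<phi> (e, b)))) summable_on UNIV"
    unfolding T_def by (intro summable_on_Sigma_banach[of "\<lambda>e b. norm (h (\<phi> (e, b)))"])
      (simp add: case_prod_unfold)
  then have "(\<lambda>e. \<Sum>b\<in>{..fst e} \<times> {..snd e}. norm (h (\<phi> (e, b)))) summable_on UNIV"
    by simp
  then show "(\<lambda>e. norm (cauchy_product c d e * mon w e)) summable_on UNIV"
  proof (rule summable_on_comparison_test)
    fix e
    have "cauchy_product c d e * mon w e = (\<Sum>b\<in>{..fst e} \<times> {..snd e}. h (\<phi> (e, b)))"
      by (simp add: cauchy_product_def sum_distrib_right hT)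
    then show "norm (cauchy_product c d e * mon w e) \<le> (\<Sum>b\<in>{..fst e} \<times> {..snd e}. norm (h (\<phi> (e, b))))"
      by (simp add: norm_sum)
  qed auto
qed

lemma norm_mon_diagonal:
  "r \<ge> 0 \<Longrightarrow> norm (c * mon (of_real r, of_real r) a) = norm (c :: 'k::real_normed_field) * r ^ deg a"
  by (simp add: norm_mult mon_def deg_def power_add norm_power)

lemma expands_mult:
  assumes f: "expands f p c r" and g: "expands g p d r"
  shows "expands (\<lambda>z. f z * g z) p (cauchy_product c d) r"
  unfolding expands_def
proof (intro conjI allI impI)
  show r: "r > 0" using f by (simp add: expands_def)
  let ?w = "(of_real r, of_real r) :: 'a \<times> 'a"
  have "(\<lambda>e. norm (cauchy_product c d e * mon ?w e)) summable_on UNIV"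
    by (rule has_sum_cauchy_product(2)[OF expands_mon_norm[OF f] has_sum_infsum[OF abs_summable_summable[OF
            expands_mon_norm[OF f]]] expands_mon_norm[OF g] has_sum_infsum[OF abs_summable_summable[OF
            expands_mon_norm[OF g]]]]) (use r in auto)
  then show "(\<lambda>a. norm (cauchy_product c d a) * r ^ deg a) summable_on UNIV"
    using r by (simp add: norm_mon_diagonal)
  fix w :: "'a \<times> 'a" assume "norm (fst w) \<le> r" "norm (snd w) \<le> r"
  then show "((\<lambda>a. cauchy_product c d a * mon w a) has_sum (f (p + w) * g (p + w))) UNIV"
    by (intro has_sum_cauchy_product(1) expands_mon_norm[OF f] expands_mon_norm[OF g])
      (use f g in \<open>auto intro: expands_has_sum\<close>)
qed

lemma analytic2_mult [simp]:
  assumes "analytic2_at f p" "analytic2_at g p"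
  shows "analytic2_at (\<lambda>z. f z * g z :: 'k::{real_normed_field,banach}) p"
proof -
  obtain c r where f: "expands f p c r" using assms(1) by (rule analytic2E)
  obtain d r' where g: "expands g p d r'" using assms(2) by (rule analytic2E)
  from f g obtain s where "expands f p c s" "expands g p d s"
    by (rule expands_common)
  then show ?thesis
    by (rule expands_imp_analytic2[OF expands_mult])
qed

lemma analytic2_uminus [simp]:
  "analytic2_at f p \<Longrightarrow> analytic2_at (\<lambda>z. - f z :: 'k::{real_normed_field,banach}) p"
  using analytic2_mult[OF analytic2_const[where k="-1" and p=p], of f] by simp

lemma analytic2_diff [simp]:
  "analytic2_at f p \<Longrightarrow> analytic2_at g p \<Longrightarrow>
    analytic2_at (\<lambda>z. f z - g z :: 'k::{real_normed_field,banach}) p"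
  using analytic2_add[OF _ analytic2_uminus, of f p g] by simp

lemma analytic2_power [simp]:
  "analytic2_at f p \<Longrightarrow> analytic2_at (\<lambda>z. f z ^ n :: 'k::{real_normed_field,banach}) p"
  by (induction n) auto

lemma analytic2_sum [simp]:
  "(\<And>i. i \<in> I \<Longrightarrow> analytic2_at (f i) p) \<Longrightarrow>
    analytic2_at (\<lambda>z. \<Sum>i\<in>I. f i z :: 'k::{real_normed_field,banach}) p"
  by (induction I rule: infinite_finite_induct) auto

section \<open>Reciprocals\<close>

text \<open>
  The formal reciprocal, found by solving for the Cauchy product to be \<open>1\<close> degree by degree.
\<close>

function inv_coeff :: "(nat \<times> nat \<Rightarrow> 'k::field) \<Rightarrow> nat \<times> nat \<Rightarrow> 'k"
  where "inv_coeff c e =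
    (if e = (0, 0) then inverse (c (0, 0))
     else - inverse (c (0, 0)) *
       (\<Sum>b \<in> {..fst e} \<times> {..snd e} - {(0, 0)}. c b * inv_coeff c (e - b)))"
  by pat_completeness auto
termination
  by (relation "Wellfounded.measure (\<lambda>(c, e). deg e)") (auto simp: deg_def)

declare inv_coeff.simps [simp del]

lemma cauchy_product_inv_coeff:
  assumes "c (0, 0) \<noteq> 0"
  shows "cauchy_product c (inv_coeff c) e = (if e = (0, 0) then 1 else 0)"
proof (cases "e = (0, 0)")
  case True
  then show ?thesis using assms by (simp add: cauchy_product_def inv_coeff.simps[of c "(0,0)"] zero_prod_def)
next
  case False
  have "e - (0, 0) = e" by (simp add: prod_eq_iff)
  then have "cauchy_product c (inv_coeff c) e = c (0, 0) * inv_coeff c e +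
      (\<Sum>b \<in> {..fst e} \<times> {..snd e} - {(0, 0)}. c b * inv_coeff c (e - b))"
    unfolding cauchy_product_def by (subst sum.remove[of _ "(0,0)"]) auto
  also have "c (0, 0) * inv_coeff c e =
      - (\<Sum>b \<in> {..fst e} \<times> {..snd e} - {(0, 0)}. c b * inv_coeff c (e - b))"
    using assms False by (subst inv_coeff.simps) (simp add: field_simps)
  finally show ?thesis using False by simp
qed

text \<open>
  Cauchy's majorant argument: on a polydisc so small that the non-constant terms of \<open>c\<close> are dominated
  by the constant one, the recursion cannot increase the weighted size of the coefficients.
\<close>

lemma inv_coeff_bound:
  fixes c :: "nat \<times> nat \<Rightarrow> 'k::{real_normed_field,banach}"
  assumes "0 \<le> \<rho>" "c (0, 0) \<noteq> 0"
    and sm: "(\<lambda>a. norm (c a) * \<rho> ^ deg a) summable_on UNIV"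
    and small: "(\<Sum>\<^sub>\<infinity>a\<in>- {(0, 0)}. norm (c a) * \<rho> ^ deg a) \<le> norm (c (0, 0))"
  shows "norm (inv_coeff c e) * \<rho> ^ deg e \<le> inverse (norm (c (0, 0)))"
proof (induction "deg e" arbitrary: e rule: less_induct)
  case less
  show ?case
  proof (cases "e = (0, 0)")
    case True
    then show ?thesis by (simp add: inv_coeff.simps deg_def norm_inverse)
  next
    case False
    let ?S = "{..fst e} \<times> {..snd e} - {(0, 0)}"
    let ?k = "inverse (norm (c (0, 0)))"
    have "norm (\<Sum>b \<in> ?S. c b * inv_coeff c (e - b)) * \<rho> ^ deg e
        \<le> (\<Sum>b \<in> ?S. norm (c b * inv_coeff c (e - b))) * \<rho> ^ deg e"
      using assms(1) by (intro mult_right_mono norm_sum) auto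
    also have "\<dots> = (\<Sum>b \<in> ?S. (norm (c b) * \<rho> ^ deg b) * (norm (inv_coeff c (e - b)) * \<rho> ^ deg (e - b)))"
      unfolding sum_distrib_right
    proof (rule sum.cong)
      fix b assume "b \<in> ?S"
      then have "deg e = deg b + deg (e - b)" by (auto simp: deg_def)
      then show "norm (c b * inv_coeff c (e - b)) * \<rho> ^ deg e =
          (norm (c b) * \<rho> ^ deg b) * (norm (inv_coeff c (e - b)) * \<rho> ^ deg (e - b))"
        by (simp add: norm_mult power_add)
    qed auto
    also have "\<dots> \<le> (\<Sum>b \<in> ?S. (norm (c b) * \<rho> ^ deg b) * ?k)"
    proof (rule sum_mono)
      fix b assume "b \<in> ?S"
      then have "deg (e - b) < deg e" by (cases b; cases e) (auto simp: deg_def)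
      then show "norm (c b) * \<rho> ^ deg b * (norm (inv_coeff c (e - b)) * \<rho> ^ deg (e - b))
          \<le> norm (c b) * \<rho> ^ deg b * ?k"
        using assms(1) by (intro mult_left_mono less) auto
    qed
    also have "\<dots> = (\<Sum>b \<in> ?S. norm (c b) * \<rho> ^ deg b) * ?k"
      by (simp add: sum_distrib_right)
    also have "(\<Sum>b \<in> ?S. norm (c b) * \<rho> ^ deg b) \<le> (\<Sum>\<^sub>\<infinity>a\<in>- {(0, 0)}. norm (c a) * \<rho> ^ deg a)"
      using sm assms(1) by (intro finite_sum_le_infsum summable_on_subset_banach[OF sm]) auto
    then have "(\<Sum>b \<in> ?S. norm (c b) * \<rho> ^ deg b) * ?k \<le> norm (c (0, 0)) * ?k"
      using small by (intro mult_right_mono) auto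
    also have "\<dots> = 1" using assms(2) by simp
    finally have *: "norm (\<Sum>b \<in> ?S. c b * inv_coeff c (e - b)) * \<rho> ^ deg e \<le> 1" .
    have "norm (inv_coeff c e) * \<rho> ^ deg e
        = ?k * (norm (\<Sum>b \<in> ?S. c b * inv_coeff c (e - b)) * \<rho> ^ deg e)"
      using False by (subst inv_coeff.simps) (simp add: norm_mult norm_inverse)
    also have "\<dots> \<le> ?k * 1" by (intro mult_left_mono *) auto
    finally show ?thesis by simp
  qed
qed

lemma expands_value: "expands f p c r \<Longrightarrow> f p = c (0, 0)"
proof -
  assume *: "expands f p c r"
  have "((\<lambda>a. c a * mon 0 a) has_sum f (p + 0)) UNIV"
    using * by (intro expands_has_sum) (auto dest: expands_pos)
  moreover have "((\<lambda>a. c a * mon 0 a) has_sum c (0, 0)) UNIV"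
    by (rule has_sum_finite_neutralI[of "{(0,0)}"]) (auto simp: mon_def)
  ultimately show ?thesis by (auto dest: has_sum_unique)
qed

text \<open>
  The reciprocal is given as a function that is inverse near \<open>p\<close> only, since all later uses concern germs.
\<close>

lemma analytic2_reciprocal:
  fixes f :: "'k::{real_normed_field,banach} \<times> 'k \<Rightarrow> 'k"
  assumes "analytic2_at f p" "f p \<noteq> 0"
  obtains g where "analytic2_at g p" "\<forall>\<^sub>F z in nhds p. f z * g z = 1"
proof -
  obtain c r where f: "expands f p c r" using assms(1) by (rule analytic2E)
  have r: "r > 0" using f by (rule expands_pos)
  have c0: "c (0, 0) \<noteq> 0" using assms(2) expands_value[OF f] by simp
  define B where "B = (\<Sum>\<^sub>\<infinity>a. norm (c a) * r ^ deg a)"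
  have "norm (c (0,0)) * r ^ deg (0,0) \<le> B"
    unfolding B_def using finite_sum_le_infsum[OF expands_summable[OF f], of "{(0,0)}"] r by simp
  then have B: "B > 0" using c0 by (simp add: deg_def) (meson less_le_trans zero_less_norm_iff)
  \<comment> \<open>The non-constant terms scale at least linearly with the radius, which dictates this choice.\<close>
  define \<rho> where "\<rho> = min 1 (norm (c (0,0)) / B) * r"
  have \<rho>: "0 < \<rho>" "\<rho> \<le> r" "\<rho> * B \<le> norm (c (0,0)) * r"
    using B c0 r by (auto simp: \<rho>_def mult_le_cancel_right1 min_def field_simps)
  have f': "expands f p c \<rho>" using f \<rho>(1,2) by (rule expands_mono)
  have "(\<Sum>\<^sub>\<infinity>a\<in>- {(0, 0)}. norm (c a) * \<rho> ^ deg a)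
      \<le> (\<Sum>\<^sub>\<infinity>a\<in>- {(0, 0)}. \<rho> / r * (norm (c a) * r ^ deg a))"
  proof (rule infsum_mono)
    show "(\<lambda>a. norm (c a) * \<rho> ^ deg a) summable_on - {(0, 0)}"
      by (rule summable_on_subset_banach[OF expands_summable[OF f']]) auto
    show "(\<lambda>a. \<rho> / r * (norm (c a) * r ^ deg a)) summable_on - {(0, 0)}"
      by (rule summable_on_cmult_right[OF summable_on_subset_banach[OF expands_summable[OF f]]]) auto
    fix a :: "nat \<times> nat" assume "a \<in> - {(0, 0)}"
    then obtain n where n: "deg a = Suc n" by (cases "deg a") (auto simp: deg_def prod_eq_iff)
    have "\<rho> ^ deg a \<le> \<rho> * r ^ n"
      unfolding n power_Suc using \<rho> by (intro mult_left_mono power_mono) auto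
    also have "\<dots> = \<rho> / r * r ^ deg a" using r n by simp
    finally show "norm (c a) * \<rho> ^ deg a \<le> \<rho> / r * (norm (c a) * r ^ deg a)"
      using mult_left_mono[of "\<rho> ^ deg a" "\<rho> / r * r ^ deg a" "norm (c a)"]
      by (simp add: mult.left_commute)
  qed
  also have "\<dots> = \<rho> / r * (\<Sum>\<^sub>\<infinity>a\<in>- {(0, 0)}. norm (c a) * r ^ deg a)"
    by (rule infsum_cmult_right')
  also have "\<dots> \<le> \<rho> / r * B"
    unfolding B_def using r \<rho>(1) expands_summable[OF f]
    by (intro mult_left_mono infsum_mono_neutral summable_on_subset_banach[OF expands_summable[OF f]]) auto
  also have "\<dots> \<le> norm (c (0, 0))" using \<rho>(3) r by (simp add: field_simps)
  finally have small: "(\<Sum>\<^sub>\<infinity>a\<in>- {(0, 0)}. norm (c a) * \<rho> ^ deg a) \<le> norm (c (0, 0))" .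
  have bd: "norm (inv_coeff c e) * \<rho> ^ deg e \<le> inverse (norm (c (0, 0)))" for e
    using \<rho> by (intro inv_coeff_bound c0 small expands_summable[OF f']) auto
  have "(\<lambda>e. norm (inv_coeff c e) * (\<rho>/2) ^ deg e) summable_on UNIV"
    by (rule summable_norm_lower_radius[OF bd]) (use \<rho> in auto)
  then have g: "expands (\<lambda>z. \<Sum>\<^sub>\<infinity>a. inv_coeff c a * mon (z - p) a) p (inv_coeff c) (\<rho>/2)"
    (is "expands ?g _ _ _") using \<rho> by (intro expandsI) auto
  have f'': "expands f p c (\<rho>/2)" by (rule expands_mono[OF f]) (use \<rho> in auto)
  have fg: "expands (\<lambda>z. f z * ?g z) p (cauchy_product c (inv_coeff c)) (\<rho>/2)"
    by (rule expands_mult[OF f'' g])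
  have eq: "f (p + w) * ?g (p + w) = 1" if "norm (fst w) \<le> \<rho>/2 \<and> norm (snd w) \<le> \<rho>/2" for w
  proof -
    have "((\<lambda>a. cauchy_product c (inv_coeff c) a * mon w a) has_sum (f (p + w) * ?g (p + w))) UNIV"
      using expands_has_sum[OF fg, of w] that by simp
    moreover have "((\<lambda>a. cauchy_product c (inv_coeff c) a * mon w a) has_sum 1) UNIV"
      by (rule has_sum_finite_neutralI[of "{(0,0)}"]) (auto simp: mon_def cauchy_product_inv_coeff[where c = c, OF c0])
    ultimately show ?thesis by (rule has_sum_unique)
  qed
  have "\<forall>\<^sub>F w in nhds 0. f (p + w) * ?g (p + w) = 1"
    by (rule eventually_mono[OF eventually_nhds_polydisc[of "\<rho>/2"]]) (use \<rho>(1) in simp, rule eq)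
  then have "\<forall>\<^sub>F z in nhds p. f z * ?g z = 1"
    by (subst eventually_nhds_shift_iff)
  with expands_imp_analytic2[OF g] show ?thesis by (rule that)
qed

section \<open>Order of vanishing and the identity theorem\<close>

definition vanishes_to_order ::
    "nat \<Rightarrow> ('a::real_normed_vector \<Rightarrow> 'b::real_normed_vector) \<Rightarrow> 'a \<Rightarrow> bool"
  where "vanishes_to_order N f p \<longleftrightarrow> (\<exists>C. \<forall>\<^sub>F w in nhds 0. norm (f (p + w)) \<le> C * norm w ^ N)"

lemma finite_deg_less [simp]: "finite {a. deg a < N}"
  by (rule finite_subset[of _ "{..<N} \<times> {..<N}"]) (auto simp: deg_def)

lemma expands_remainder:
  assumes f: "expands f p c r"
  shows "vanishes_to_order N (\<lambda>z. f z - (\<Sum>a | deg a < N. c a * mon (z - p) a)) p"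
proof -
  define S where "S = {a. deg a < N}"
  have r: "r > 0" using f by (rule expands_pos)
  define B where "B = (\<Sum>\<^sub>\<infinity>a\<in>-S. norm (c a) * r ^ deg a)"
  have sm: "(\<lambda>a. norm (c a) * r ^ deg a) summable_on -S"
    by (rule summable_on_subset_banach[OF expands_summable[OF f]]) auto
  have *: "norm (f (p + w) - (\<Sum>a\<in>S. c a * mon w a)) \<le> B / r ^ N * norm w ^ N"
    if w: "norm w \<le> r" for w
  proof -
    have w': "norm (fst w) \<le> norm w" "norm (snd w) \<le> norm w"
      using norm_fst_le[of "fst w" "snd w"] norm_snd_le[of "snd w" "fst w"] by auto
    have hs: "((\<lambda>a. c a * mon w a) has_sum (f (p + w) - (\<Sum>a\<in>S. c a * mon w a))) (UNIV - S)"
      by (rule has_sum_Diff) (use w w' in \<open>auto intro!: expands_has_sum[OF f] simp: S_def\<close>)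
    have "norm (f (p + w) - (\<Sum>a\<in>S. c a * mon w a))
        \<le> (\<Sum>\<^sub>\<infinity>a\<in>-S. (norm (c a) * r ^ deg a) * (norm w / r) ^ N)"
    proof (rule norm_infsum_le)
      show "((\<lambda>a. c a * mon w a) has_sum (f (p + w) - (\<Sum>a\<in>S. c a * mon w a))) (-S)"
        using hs by (simp add: Compl_eq_Diff_UNIV)
      show "((\<lambda>a. norm (c a) * r ^ deg a * (norm w / r) ^ N) has_sum
          (\<Sum>\<^sub>\<infinity>a\<in>-S. (norm (c a) * r ^ deg a) * (norm w / r) ^ N)) (-S)"
        by (intro has_sum_infsum summable_on_cmult_left sm)
      fix a assume "a \<in> -S"
      then have N: "N \<le> deg a" by (simp add: S_def)
      have "norm (c a * mon w a) \<le> norm (c a) * norm w ^ deg a"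
        unfolding norm_mult by (intro mult_left_mono norm_mon_le w') auto
      also have "norm w ^ deg a = r ^ deg a * (norm w / r) ^ deg a"
        using r by (simp add: power_divide)
      also have "(norm w / r) ^ deg a \<le> (norm w / r) ^ N"
        using r w N by (intro power_decreasing) auto
      finally show "norm (c a * mon w a) \<le> (norm (c a) * r ^ deg a) * (norm w / r) ^ N"
        using r by (simp add: mult_left_mono mult.assoc)
    qed
    also have "\<dots> = B * (norm w / r) ^ N" unfolding B_def by (rule infsum_cmult_left')
    finally show ?thesis by (simp add: power_divide)
  qed
  show ?thesis
    unfolding vanishes_to_order_def
  proof (intro exI[of _ "B / r ^ N"])
    have "\<forall>\<^sub>F w in nhds (0 :: 'a \<times> 'a). norm w \<le> r"
      using r by (auto simp: eventually_nhds_metric dist_norm intro!: exI[of _ r])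
    then show "\<forall>\<^sub>F w in nhds 0. norm (f (p + w) - (\<Sum>a | deg a < N. c a * mon (p + w - p) a))
        \<le> B / r ^ N * norm w ^ N"
      by eventually_elim (use * in \<open>simp add: S_def\<close>)
  qed
qed

text \<open>
  A polynomial of degree less than \<open>N\<close> that is of size \<open>O(x^N)\<close> at \<open>0\<close> is zero: let \<open>x\<close> tend to \<open>0\<close>,
  divide by \<open>x\<close>, and repeat.
\<close>

lemma poly_coeffs_vanish:
  fixes h :: "nat \<Rightarrow> 'k::real_normed_field"
  assumes "\<forall>\<^sub>F x in at_right (0::real). norm (\<Sum>n<N. of_real x ^ n * h n) \<le> C * x ^ N" "n < N"
  shows "h n = 0"
  using assms
proof (induction N arbitrary: h n)
  case (Suc N)
  have tend: "((\<lambda>x. \<Sum>n<Suc N. of_real x ^ n * h n) \<longlongrightarrow> (\<Sum>n<Suc N. of_real 0 ^ n * h n)) (at_right 0)"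
    by (intro tendsto_intros)
  have "((\<lambda>x. \<Sum>n<Suc N. of_real x ^ n * h n) \<longlongrightarrow> 0) (at_right (0::real))"
  proof (rule Lim_null_comparison[OF Suc.prems(1)])
    show "((\<lambda>x. C * x ^ Suc N) \<longlongrightarrow> 0) (at_right 0)"
      by (rule tendsto_eq_intros refl | simp)+
  qed
  then have "(\<Sum>n<Suc N. of_real (0::real) ^ n * h n) = 0"
    using tendsto_unique[OF _ tend] by simp
  then have h0: "h 0 = 0"
    by (simp add: sum.lessThan_Suc_shift del: sum.lessThan_Suc)
  have "\<forall>\<^sub>F x in at_right (0::real). norm (\<Sum>n<N. of_real x ^ n * h (Suc n)) \<le> C * x ^ N"
    using Suc.prems(1) eventually_at_right_less[of 0]
  proof eventually_elim
    case (elim x)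
    have "(\<Sum>n<Suc N. of_real x ^ n * h n) = of_real x * (\<Sum>n<N. of_real x ^ n * h (Suc n))"
      by (simp add: sum.lessThan_Suc_shift h0 sum_distrib_left mult_ac del: sum.lessThan_Suc)
    then have "x * norm (\<Sum>n<N. of_real x ^ n * h (Suc n)) \<le> x * (C * x ^ N)"
      using elim by (simp add: norm_mult mult_ac)
    then show ?case using elim by simp
  qed
  then have "h (Suc m) = 0" if "m < N" for m
    using Suc.IH[of "\<lambda>n. h (Suc n)" m] that by simp
  then show ?case using h0 Suc.prems(2) by (cases n) auto
qed simp

definition real_pair :: "real \<times> real \<Rightarrow> 'k::real_normed_field \<times> 'k"
  where "real_pair w = (of_real (fst w), of_real (snd w))"

lemma norm_real_pair [simp]: "norm (real_pair w) = norm w"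
  by (cases w) (simp add: real_pair_def norm_Pair)

lemma real_pair_0 [simp]: "real_pair 0 = 0"
  by (simp add: real_pair_def zero_prod_def)

lemma real_pair_add: "real_pair (v + w) = real_pair v + real_pair w"
  by (simp add: real_pair_def)

lemma tendsto_real_pair: "filterlim (real_pair :: _ \<Rightarrow> 'k::real_normed_field \<times> 'k) (nhds (real_pair w)) (nhds w)"
proof -
  have "isCont (real_pair :: _ \<Rightarrow> 'k \<times> 'k) w"
    unfolding real_pair_def by (intro continuous_intros)
  then show ?thesis by (simp add: isCont_def tendsto_at_iff_tendsto_nhds)
qed

text \<open>
  Smallness is required only at the real points near \<open>p\<close>. For complex coefficients this contains the
  identity theorem (a function that vanishes at the real points vanishes); for real coefficients it
  turns a growth estimate into the vanishing of the low-order coefficients. Restricting to the line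
  of slope \<open>y\<close> makes the Taylor polynomial a polynomial in one variable that is too small not to vanish;
  its coefficients are in turn polynomials in \<open>y\<close> that vanish for every \<open>y\<close>.
\<close>

lemma expands_coeff_eq_0:
  assumes f: "expands f p c r"
    and O: "\<exists>C. \<forall>\<^sub>F w in nhds 0. norm (f (p + real_pair w)) \<le> C * norm w ^ N"
    and a: "deg a < N"
  shows "c a = 0"
proof -
  define T where "T = (\<lambda>w. \<Sum>a | deg a < N. c a * mon (real_pair w) a)"
  obtain C where C: "\<forall>\<^sub>F w in nhds 0. norm (f (p + real_pair w)) \<le> C * norm w ^ N"
    using O by blast
  obtain D where "\<forall>\<^sub>F w in nhds 0. norm (f (p + w) - (\<Sum>a | deg a < N. c a * mon (p + w - p) a)) \<le> D * norm w ^ N"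
    using expands_remainder[OF f, of N] unfolding vanishes_to_order_def by blast
  then have "\<forall>\<^sub>F w in nhds 0. norm (f (p + real_pair w) - T w) \<le> D * norm w ^ N"
    using eventually_compose_filterlim[OF _ tendsto_real_pair[of 0, simplified]]
    by (fastforce simp: T_def)
  with C have T: "\<forall>\<^sub>F w in nhds 0. norm (T w) \<le> (C + D) * norm w ^ N"
  proof eventually_elim
    case (elim w)
    have "norm (T w) \<le> norm (f (p + real_pair w)) + norm (f (p + real_pair w) - T w)"
      by (metis norm_minus_commute norm_triangle_sub)
    with elim show ?case by (simp add: distrib_right)
  qed
  define h where "h = (\<lambda>y n. \<Sum>j<Suc n. of_real y ^ j * c (n - j, j))"
  have Tray: "T (x, x * y) = (\<Sum>n<N. of_real x ^ n * h y n)" for x y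
  proof -
    have "T (x, x * y) = (\<Sum>a | deg a < N. of_real x ^ deg a * (of_real y ^ snd a * c a))"
      by (simp add: T_def mon_def real_pair_def deg_def power_add power_mult_distrib mult_ac)
    also have "\<dots> = (\<Sum>(n, j) \<in> (SIGMA n:{..<N}. {..<Suc n}). of_real x ^ n * (of_real y ^ j * c (n - j, j)))"
      by (rule sum.reindex_bij_witness[of _ "\<lambda>(n, j). (n - j, j)" "\<lambda>a. (deg a, snd a)"])
        (auto simp: deg_def)
    also have "\<dots> = (\<Sum>n<N. of_real x ^ n * h y n)"
      by (subst sum.Sigma[symmetric]) (auto simp: h_def sum_distrib_left simp del: sum.lessThan_Suc)
    finally show ?thesis .
  qed
  have h0: "h y n = 0" if "n < N" for y n
  proof (rule poly_coeffs_vanish[OF _ that])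
    have "filterlim (\<lambda>x. (x, x * y)) (nhds (0, 0 * y)) (at_right (0::real))"
      by (intro tendsto_intros)
    then have "filterlim (\<lambda>x. (x, x * y)) (nhds 0) (at_right (0::real))"
      by (simp add: zero_prod_def)
    from eventually_compose_filterlim[OF T this] eventually_at_right_less[of 0]
    show "\<forall>\<^sub>F x in at_right 0. norm (\<Sum>n<N. of_real x ^ n * h y n) \<le> (C + D) * norm (1::real, y) ^ N * x ^ N"
    proof eventually_elim
      case (elim x)
      have "(x, x * y) = x *\<^sub>R (1, y)" by simp
      then have nr: "norm (x, x * y) = x * norm (1::real, y)"
        using elim(2) norm_scaleR[of x "(1::real, y)"] by simp
      have "norm (\<Sum>n<N. of_real x ^ n * h y n) \<le> (C + D) * (x * norm (1::real, y)) ^ N"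
        using elim(1) unfolding Tray nr .
      also have "\<dots> = (C + D) * norm (1::real, y) ^ N * x ^ N"
        by (simp add: power_mult_distrib)
      finally show ?case .
    qed
  qed
  have "c (n - j, j) = 0" if "n < N" "j < Suc n" for n j
    by (rule poly_coeffs_vanish[where N = "Suc n" and h = "\<lambda>j. c (n - j, j)" and C = 0, OF _ that(2)])
      (use h0[OF that(1)] in \<open>simp add: h_def\<close>)
  from this[of "deg a" "snd a"] a show ?thesis by (simp add: deg_def)
qed

lemma expands_uniq:
  assumes "expands f p c r" "norm (fst w) \<le> r" "norm (snd w) \<le> r"
    and "((\<lambda>a. c a * mon w a) has_sum S) UNIV"
  shows "f (p + w) = S"
  using expands_has_sum[OF assms(1-3)] assms(4) by (rule has_sum_unique)

lemma summable_shift: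
  fixes c :: "nat \<times> nat \<Rightarrow> 'k::{real_normed_field,banach}"
  assumes "(\<lambda>a. norm (c a) * r ^ deg a) summable_on UNIV" "r > 0"
  shows "(\<lambda>a. norm (c (a + b)) * r ^ deg a) summable_on UNIV"
proof -
  have inj: "inj (\<lambda>a. a + b)" by simp
  have "(\<lambda>a. norm (c a) * r ^ deg a) summable_on range (\<lambda>a. a + b)"
    by (rule summable_on_subset_banach[OF assms(1)]) auto
  then have "(\<lambda>a. norm (c (a + b)) * r ^ deg (a + b)) summable_on UNIV"
    by (subst (asm) summable_on_reindex[OF inj]) (simp add: o_def)
  then have "(\<lambda>a. norm (c (a + b)) * r ^ deg (a + b) * inverse (r ^ deg b)) summable_on UNIV"
    by (rule summable_on_cmult_left)
  then show ?thesis using assms(2) by (simp add: deg_add power_add mult.assoc)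
qed

text \<open>
  If every monomial that occurs is divisible by \<open>s^k\<close> or by \<open>t^k\<close>, then so is the function, with analytic
  quotients. Two generators replace the \<open>N + 1\<close> monomials that generate the \<open>N\<close>-th power of the maximal
  ideal, and this is all that later arguments need of those powers.
\<close>

lemma split_off_powers:
  fixes f :: "'k::{real_normed_field,banach} \<times> 'k \<Rightarrow> 'k"
  assumes f: "expands f p c r" and c: "\<And>a. fst a < k \<Longrightarrow> snd a < k \<Longrightarrow> c a = 0"
  obtains f1 f2 where "analytic2_at f1 p" "analytic2_at f2 p"
    "\<forall>\<^sub>F z in nhds p. f z = (fst z - fst p) ^ k * f1 z + (snd z - snd p) ^ k * f2 z"
proof -
  have r: "r > 0" using f by (rule expands_pos)
  define c1 where "c1 = (\<lambda>a. c (a + (k, 0)))"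
  define c2 where "c2 = (\<lambda>a. if fst a < k then c (a + (0, k)) else 0)"
  have s1: "(\<lambda>a. norm (c1 a) * r ^ deg a) summable_on UNIV"
    unfolding c1_def by (rule summable_shift[OF expands_summable[OF f] r])
  have "(\<lambda>a. norm (c (a + (0, k))) * r ^ deg a) summable_on UNIV"
    by (rule summable_shift[OF expands_summable[OF f] r])
  then have s2: "(\<lambda>a. norm (c2 a) * r ^ deg a) summable_on UNIV"
    by (rule summable_on_comparison_test) (use r in \<open>auto simp: c2_def\<close>)
  define f1 where "f1 = (\<lambda>z. \<Sum>\<^sub>\<infinity>a. c1 a * mon (z - p) a)"
  define f2 where "f2 = (\<lambda>z. \<Sum>\<^sub>\<infinity>a. c2 a * mon (z - p) a)"
  have e1: "expands f1 p c1 r" unfolding f1_def by (rule expandsI[OF r s1])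
  have e2: "expands f2 p c2 r" unfolding f2_def by (rule expandsI[OF r s2])
  have eq: "f (p + w) = fst w ^ k * f1 (p + w) + snd w ^ k * f2 (p + w)"
    if w: "norm (fst w) \<le> r \<and> norm (snd w) \<le> r" for w
  proof (rule expands_uniq[OF f])
    define g where "g = (\<lambda>a. c a * mon w a)"
    define gA where "gA = (\<lambda>a. if k \<le> fst a then g a else 0)"
    define gB where "gB = (\<lambda>a. if fst a < k \<and> k \<le> snd a then g a else 0)"
    have inj: "inj (\<lambda>a :: nat \<times> nat. a + b)" for b by simp
    have "((\<lambda>a. fst w ^ k * (c1 a * mon w a)) has_sum (fst w ^ k * f1 (p + w))) UNIV"
      using w by (intro has_sum_cmult_right expands_has_sum[OF e1]) auto
    also have "(\<lambda>a. fst w ^ k * (c1 a * mon w a)) = gA \<circ> (\<lambda>a. a + (k, 0))"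
      by (rule ext) (simp add: gA_def g_def c1_def mon_add, simp add: mon_def mult_ac)
    finally have "(gA has_sum (fst w ^ k * f1 (p + w))) (range (\<lambda>a. a + (k, 0)))"
      by (subst has_sum_reindex[OF inj])
    then have A: "(gA has_sum (fst w ^ k * f1 (p + w))) UNIV"
    proof (rule has_sum_cong_neutral[THEN iffD1, rotated -1])
      fix a assume "a \<in> UNIV - range (\<lambda>a :: nat \<times> nat. a + (k, 0))"
      moreover have "a = (fst a - k, snd a) + (k, 0)" if "k \<le> fst a" using that by (simp add: prod_eq_iff)
      ultimately have "\<not> k \<le> fst a" by blast
      then show "gA a = 0" by (simp add: gA_def)
    qed auto
    have "((\<lambda>a. snd w ^ k * (c2 a * mon w a)) has_sum (snd w ^ k * f2 (p + w))) UNIV"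
      using w by (intro has_sum_cmult_right expands_has_sum[OF e2]) auto
    also have "(\<lambda>a. snd w ^ k * (c2 a * mon w a)) = gB \<circ> (\<lambda>a. a + (0, k))"
      by (rule ext) (simp add: gB_def g_def c2_def mon_add, simp add: mon_def mult_ac)
    finally have "(gB has_sum (snd w ^ k * f2 (p + w))) (range (\<lambda>a. a + (0, k)))"
      by (subst has_sum_reindex[OF inj])
    then have B: "(gB has_sum (snd w ^ k * f2 (p + w))) UNIV"
    proof (rule has_sum_cong_neutral[THEN iffD1, rotated -1])
      fix a assume "a \<in> UNIV - range (\<lambda>a :: nat \<times> nat. a + (0, k))"
      moreover have "a = (fst a, snd a - k) + (0, k)" if "k \<le> snd a" using that by (simp add: prod_eq_iff)
      ultimately have "\<not> k \<le> snd a" by blast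
      then show "gB a = 0" by (simp add: gB_def)
    qed auto
    have "gA a + gB a = c a * mon w a" for a
      using c[of a] unfolding gA_def gB_def g_def by (cases "k \<le> fst a"; cases "k \<le> snd a") simp_all
    with has_sum_add[OF A B]
    show "((\<lambda>a. c a * mon w a) has_sum (fst w ^ k * f1 (p + w) + snd w ^ k * f2 (p + w))) UNIV"
      by simp
  qed (use w in auto)
  have "\<forall>\<^sub>F w in nhds 0. f (p + w) = fst w ^ k * f1 (p + w) + snd w ^ k * f2 (p + w)"
    using eventually_nhds_polydisc[OF r] by (rule eventually_mono) (rule eq)
  then have "\<forall>\<^sub>F z in nhds p. f z = (fst z - fst p) ^ k * f1 z + (snd z - snd p) ^ k * f2 z"
    by (subst eventually_nhds_shift_iff) simp
  with expands_imp_analytic2[OF e1] expands_imp_analytic2[OF e2] show ?thesis by (rule that)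
qed

section \<open>Partial derivatives of analytic functions\<close>

text \<open>
  Along a horizontal line the double series becomes a power series in one variable, whose coefficients are the
  inner sums; it may be differentiated term by term. The radius shrinks twice: once to absorb the factor
  \<open>Suc (fst a)\<close>, once to regain summability from boundedness.
\<close>

lemma expands_pdu_aux:
  fixes f :: "real \<times> real \<Rightarrow> real"
  assumes f: "expands f p c r" and d: "d = (\<lambda>a. of_nat (Suc (fst a)) * c (a + (1, 0)))"
  shows "expands (pdu f) p d (r/4)"
    and "\<And>w. norm (fst w) \<le> r/4 \<Longrightarrow> norm (snd w) \<le> r/4 \<Longrightarrow>
      ((\<lambda>t. f (t, snd (p + w))) has_vector_derivative pdu f (p + w)) (at (fst (p + w)))"
proof -
  have r: "r > 0" using f by (rule expands_pos)
  obtain B where B: "\<And>a. norm (norm (c a) * r ^ deg a) \<le> B"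
    using summable_on_imp_bounded_terms[OF expands_summable[OF f]] by (metis UNIV_I)
  have "norm (d a) * (r/2) ^ deg a \<le> B / r" for a
  proof -
    have "real (Suc (fst a)) \<le> 2 ^ fst a"
      using less_exp[of "fst a"] by (metis Suc_leI of_nat_le_iff of_nat_numeral of_nat_power)
    also have "\<dots> \<le> 2 ^ deg a" by (simp add: deg_def)
    finally have "norm (d a) * (r/2) ^ deg a \<le> norm (c (a + (1,0))) * 2 ^ deg a * (r/2) ^ deg a"
      unfolding d norm_mult using r
      by (intro mult_right_mono) (auto simp: mult.commute intro!: mult_right_mono)
    also have "\<dots> = norm (c (a + (1,0))) * r ^ deg (a + (1,0)) / r"
      using r by (simp add: power_divide deg_add) (simp add: deg_def)
    also have "\<dots> \<le> B / r" using B[of "a + (1,0)"] r by (intro divide_right_mono) auto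
    finally show ?thesis .
  qed
  then have sd: "(\<lambda>a. norm (d a) * (r/4) ^ deg a) summable_on UNIV"
    by (rule summable_norm_lower_radius) (use r in auto)
  have main: "((\<lambda>a. d a * mon w a) has_sum pdu f (p + w)) UNIV \<and>
      ((\<lambda>t. f (t, snd (p + w))) has_vector_derivative pdu f (p + w)) (at (fst (p + w)))"
    if w: "norm (fst w) \<le> r/4" "norm (snd w) \<le> r/4" for w
  proof -
    define A where "A = (\<lambda>i. \<Sum>\<^sub>\<infinity>j. c (i, j) * snd w ^ j)"
    have hs: "((\<lambda>(i, j). c (i, j) * x ^ i * snd w ^ j) has_sum f (p + (x, snd w))) (UNIV \<times> UNIV)"
      if "\<bar>x\<bar> \<le> r" for x
      using expands_has_sum[OF f, of "(x, snd w)"] that w r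
      by (simp add: mon_def case_prod_unfold mult_ac)
    have Asum: "((\<lambda>j. c (i, j) * snd w ^ j) has_sum A i) UNIV" for i
      unfolding A_def
    proof (rule has_sum_infsum)
      have "(\<lambda>(i, j). c (i, j) * r ^ i * snd w ^ j) summable_on UNIV \<times> UNIV"
        using hs[of r] r unfolding summable_on_def by auto
      then have "(\<lambda>j. c (i, j) * r ^ i * snd w ^ j) summable_on UNIV"
        by (drule_tac summable_on_SigmaD1[of "\<lambda>i j. c (i, j) * r ^ i * snd w ^ j"]) auto
      then have "(\<lambda>j. inverse (r ^ i) * (c (i, j) * r ^ i * snd w ^ j)) summable_on UNIV"
        by (rule summable_on_cmult_right)
      then show "(\<lambda>j. c (i, j) * snd w ^ j) summable_on UNIV" using r by (simp add: field_simps)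
    qed
    have fs: "(\<lambda>i. A i * x ^ i) sums f (p + (x, snd w))" if "\<bar>x\<bar> \<le> r" for x
    proof (rule has_sum_imp_sums, rule has_sum_SigmaD[OF hs[OF that]])
      fix i
      show "((\<lambda>j. case (i, j) of (i, j) \<Rightarrow> c (i, j) * x ^ i * snd w ^ j) has_sum (A i * x ^ i)) UNIV"
        using has_sum_cmult_left[OF Asum[of i], of "x ^ i"] by (simp add: mult_ac)
    qed
    have "((\<lambda>x. \<Sum>i. A i * x ^ i) has_field_derivative (\<Sum>i. diffs A i * fst w ^ i)) (at (fst w))"
      by (rule termdiffs_strong'[of r]) (use fs w r in \<open>auto simp: sums_iff\<close>)
    then have "((\<lambda>x. f (p + (x, snd w))) has_field_derivative (\<Sum>i. diffs A i * fst w ^ i)) (at (fst w))"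
    proof (rule has_field_derivative_transform_within_open[of _ _ _ "{-r<..<r}"])
      show "fst w \<in> {-r<..<r}" using w r by auto
      show "(\<Sum>i. A i * x ^ i) = f (p + (x, snd w))" if "x \<in> {-r<..<r}" for x
        using fs[of x] that by (auto simp: sums_iff)
    qed auto
    then have "((\<lambda>t. f (p + (t - fst p, snd w))) has_field_derivative (\<Sum>i. diffs A i * fst w ^ i) * 1) (at (fst p + fst w))"
      by (intro DERIV_chain2[where g = "\<lambda>t. t - fst p"]) (auto intro!: derivative_eq_intros)
    moreover have "(\<lambda>t. f (p + (t - fst p, snd w))) = (\<lambda>t. f (t, snd (p + w)))"
      by (cases p) (simp add: fun_eq_iff)
    ultimately have der: "((\<lambda>t. f (t, snd (p + w))) has_vector_derivative (\<Sum>i. diffs A i * fst w ^ i)) (at (fst (p + w)))"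
      by (simp add: has_real_derivative_iff_has_vector_derivative)
    then have pd: "pdu f (p + w) = (\<Sum>i. diffs A i * fst w ^ i)"
      unfolding pdu_def by (rule vector_derivative_at)
    have "(\<lambda>a. d a * mon w a) summable_on UNIV"
      by (rule abs_summable_summable, rule summable_mon[OF sd]) (use w in auto)
    then obtain S where S: "((\<lambda>a. d a * mon w a) has_sum S) (UNIV \<times> UNIV)"
      unfolding summable_on_def by auto
    have "((\<lambda>i. diffs A i * fst w ^ i) has_sum S) UNIV"
    proof (rule has_sum_SigmaD[OF S])
      fix i
      show "((\<lambda>j. d (i, j) * mon w (i, j)) has_sum (diffs A i * fst w ^ i)) UNIV"
        using has_sum_cmult_left[OF Asum[of "Suc i"], of "of_nat (Suc i) * fst w ^ i"]
        by (simp add: d mon_def diffs_def mult_ac)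
    qed
    then have "S = pdu f (p + w)"
      using pd has_sum_imp_sums sums_unique by metis
    then show ?thesis using S der pd by simp
  qed
  show "expands (pdu f) p d (r/4)"
    unfolding expands_def using r sd main by (auto simp only: zero_less_divide_iff zero_less_numeral)
  show "((\<lambda>t. f (t, snd (p + w))) has_vector_derivative pdu f (p + w)) (at (fst (p + w)))"
    if "norm (fst w) \<le> r/4" "norm (snd w) \<le> r/4" for w
    using main[OF that] by blast
qed

lemmas expands_pdu = expands_pdu_aux(1)[OF _ refl]

lemma expands_swap:
  assumes f: "expands f p c r"
  shows "expands (f \<circ> prod.swap) (prod.swap p) (c \<circ> prod.swap) r"
  unfolding expands_def
proof (intro conjI allI impI)
  show "r > 0" using f by (rule expands_pos)
  have b: "bij (prod.swap :: nat \<times> nat \<Rightarrow> _)" by simp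
  show "(\<lambda>a. norm ((c \<circ> prod.swap) a) * r ^ deg a) summable_on UNIV"
    using expands_summable[OF f] summable_on_reindex_bij_betw[OF b, of "\<lambda>a. norm (c a) * r ^ deg a"]
    by (simp add: deg_def add.commute)
  fix w :: "'a \<times> 'a" assume "norm (fst w) \<le> r" "norm (snd w) \<le> r"
  then have "((\<lambda>a. c a * mon (prod.swap w) a) has_sum f (p + prod.swap w)) UNIV"
    by (intro expands_has_sum[OF f]) auto
  then show "((\<lambda>a. (c \<circ> prod.swap) a * mon w a) has_sum (f \<circ> prod.swap) (prod.swap p + w)) UNIV"
    using has_sum_reindex_bij_betw[OF b, of "\<lambda>a. c a * mon (prod.swap w) a"]
    by (simp add: mon_def mult_ac plus_prod_def)
qed

lemma pdv_eq_pdu_swap: "pdv f = pdu (f \<circ> prod.swap) \<circ> prod.swap"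
  by (rule ext) (simp add: pdv_def pdu_def)

lemma expands_pdv:
  fixes f :: "real \<times> real \<Rightarrow> real"
  assumes "expands f p c r"
  shows "expands (pdv f) p (\<lambda>a. of_nat (Suc (snd a)) * c (a + (0, 1))) (r/4)"
  using expands_swap[OF expands_pdu[OF expands_swap[OF assms]]]
  by (simp add: pdv_eq_pdu_swap o_def plus_prod_def)

lemma analytic2_pdu [simp]: "analytic2_at f p \<Longrightarrow> analytic2_at (pdu f) p"
  by (erule analytic2E) (rule expands_imp_analytic2[OF expands_pdu])

lemma analytic2_pdv [simp]: "analytic2_at f p \<Longrightarrow> analytic2_at (pdv f) p"
  by (erule analytic2E) (rule expands_imp_analytic2[OF expands_pdv])

lemma pdu_pdv_commute:
  assumes "analytic2_at f p"
  shows "pdv (pdu f) p = pdu (pdv f) p"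
proof -
  obtain c r where f: "expands f p c r" using assms by (rule analytic2E)
  show ?thesis
    using expands_value[OF expands_pdv[OF expands_pdu[OF f]]]
      expands_value[OF expands_pdu[OF expands_pdv[OF f]]] by simp
qed

text \<open>
  The remainder of the Taylor polynomial of degree one is quadratic.
\<close>

lemma analytic2_has_derivative:
  assumes "analytic2_at f p"
  shows "(f has_derivative (\<lambda>w. fst w * pdu f p + snd w * pdv f p)) (at p)"
proof -
  obtain c r where f: "expands f p c r" using assms by (rule analytic2E)
  have pd: "pdu f p = c (1, 0)" "pdv f p = c (0, 1)"
    using expands_value[OF expands_pdu[OF f]] expands_value[OF expands_pdv[OF f]] by simp_all
  have S: "{a. deg a < 2} = {(0,0), (1,0), (0,1)}"
    by (auto simp: deg_def numeral_2_eq_2 less_Suc_eq)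
  obtain C where C: "\<forall>\<^sub>F w in nhds 0. norm (f (p + w) - (c (0,0) + (fst w * c (1,0) + snd w * c (0,1)))) \<le> C * norm w ^ 2"
    using expands_remainder[OF f, of 2] unfolding vanishes_to_order_def S
    by (auto simp: mon_def mult_ac)
  have *: "\<forall>\<^sub>F w in at 0. norm (norm (f (p + w) - f p - (fst w * pdu f p + snd w * pdv f p)) / norm w) \<le> C * norm w"
    using C[THEN eventually_nhds_conv_at[THEN iffD1, THEN conjunct1]] eventually_neq_at_within[of 0 0 UNIV]
  proof eventually_elim
    case (elim w)
    have "norm (f (p + w) - f p - (fst w * pdu f p + snd w * pdv f p)) \<le> C * norm w ^ 2"
      using elim by (simp add: expands_value[OF f] pd algebra_simps)
    then show ?case using elim(2)
      by (simp add: divide_simps power2_eq_square mult_ac)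
  qed
  have "((\<lambda>w. norm (f (p + w) - f p - (fst w * pdu f p + snd w * pdv f p)) / norm w) \<longlongrightarrow> 0) (at 0)"
  proof (rule Lim_null_comparison[OF *])
    show "((\<lambda>w :: real \<times> real. C * norm w) \<longlongrightarrow> 0) (at 0)"
      by (rule tendsto_eq_intros refl | simp)+
  qed
  moreover have "bounded_linear (\<lambda>w. fst w * pdu f p + snd w * pdv f p)"
    by (intro bounded_linear_add bounded_linear_mult_const bounded_linear_fst bounded_linear_snd)
  ultimately show ?thesis by (simp only: has_derivative_at)
qed

lemma pd_of_has_derivative:
  assumes "(f has_derivative D) (at p)"
  shows "((\<lambda>t. f (t, snd p)) has_vector_derivative D (1, 0)) (at (fst p))"
    and "((\<lambda>t. f (fst p, t)) has_vector_derivative D (0, 1)) (at (snd p))"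
    and "pdu f p = D (1, 0)" and "pdv f p = D (0, 1)"
proof -
  interpret D: bounded_linear D using assms by (rule has_derivative_bounded_linear)
  have "((\<lambda>t. f (t, snd p)) has_derivative (\<lambda>h. D (h, 0))) (at (fst p))"
    by (rule has_derivative_compose[of "\<lambda>t. (t, snd p)", where f' = "\<lambda>h. (h, 0)"])
      (use assms in \<open>auto intro!: derivative_eq_intros\<close>)
  moreover have "(\<lambda>h. D (h, 0)) = (\<lambda>h. h *\<^sub>R D (1, 0))"
    by (simp add: D.scaleR[symmetric])
  ultimately show u: "((\<lambda>t. f (t, snd p)) has_vector_derivative D (1, 0)) (at (fst p))"
    by (simp add: has_vector_derivative_def)
  have "((\<lambda>t. f (fst p, t)) has_derivative (\<lambda>h. D (0, h))) (at (snd p))"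
    by (rule has_derivative_compose[of "\<lambda>t. (fst p, t)", where f' = "\<lambda>h. (0, h)"])
      (use assms in \<open>auto intro!: derivative_eq_intros\<close>)
  moreover have "(\<lambda>h. D (0, h)) = (\<lambda>h. h *\<^sub>R D (0, 1))"
    by (simp add: D.scaleR[symmetric])
  ultimately show v: "((\<lambda>t. f (fst p, t)) has_vector_derivative D (0, 1)) (at (snd p))"
    by (simp add: has_vector_derivative_def)
  show "pdu f p = D (1, 0)" "pdv f p = D (0, 1)"
    unfolding pdu_def pdv_def using u v by (auto intro: vector_derivative_at)
qed

section \<open>Germs and ideals with two generators\<close>

lemma germ_eq_iff: "germ z f = germ z g \<longleftrightarrow> (\<forall>\<^sub>F w in nhds z. f w = g w)"
proof
  assume "germ z f = germ z g"
  moreover have "f \<in> germ z f" by (simp add: germ_def)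
  ultimately show "\<forall>\<^sub>F w in nhds z. f w = g w" by (simp add: germ_def)
next
  assume *: "\<forall>\<^sub>F w in nhds z. f w = g w"
  show "germ z f = germ z g"
    unfolding germ_def
  proof (intro Collect_cong iffI)
    fix h
    show "\<forall>\<^sub>F w in nhds z. h w = g w" if "\<forall>\<^sub>F w in nhds z. h w = f w"
      using * that by eventually_elim simp
    show "\<forall>\<^sub>F w in nhds z. h w = f w" if "\<forall>\<^sub>F w in nhds z. h w = g w"
      using * that by eventually_elim simp
  qed
qed

lemma carrier_O2: "carrier (O2 z) = {germ z f | f. analytic2_at f z}"
  by (simp add: O2_def)

lemma germ_in_carrier [simp]: "analytic2_at f z \<Longrightarrow> germ z f \<in> carrier (O2 z)"
  by (auto simp: carrier_O2)

lemma carrier_O2E: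
  assumes "A \<in> carrier (O2 z)" obtains f where "analytic2_at f z" "A = germ z f"
  using assms by (auto simp: carrier_O2)

lemma one_O2: "\<one>\<^bsub>O2 z\<^esub> = germ z (\<lambda>w. 1)" and zero_O2: "\<zero>\<^bsub>O2 z\<^esub> = germ z (\<lambda>w. 0)"
  by (simp_all add: O2_def)

lemma O2_cring: "cring (O2 z)"
proof (intro cringI abelian_groupI comm_monoidI)
  fix A assume "A \<in> carrier (O2 z)"
  then obtain f where f: "analytic2_at f z" "A = germ z f" by (rule carrier_O2E)
  have "germ z (\<lambda>w. - f w) \<oplus>\<^bsub>O2 z\<^esub> A = \<zero>\<^bsub>O2 z\<^esub>"
    by (simp add: f O2_add_germ zero_O2)
  moreover have "germ z (\<lambda>w. - f w) \<in> carrier (O2 z)" using f by simp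
  ultimately show "\<exists>B\<in>carrier (O2 z). B \<oplus>\<^bsub>O2 z\<^esub> A = \<zero>\<^bsub>O2 z\<^esub>" by blast
qed (auto elim!: carrier_O2E simp: O2_add_germ O2_mult_germ one_O2 zero_O2 algebra_simps)

definition span2 :: "complex \<times> complex \<Rightarrow> (complex \<times> complex \<Rightarrow> complex) \<Rightarrow>
    (complex \<times> complex \<Rightarrow> complex) \<Rightarrow> (complex \<times> complex \<Rightarrow> complex) set set"
  where "span2 z f g = {germ z (\<lambda>w. a w * f w + b w * g w) | a b. analytic2_at a z \<and> analytic2_at b z}"

lemma germ_in_span2_iff:
  "germ z h \<in> span2 z f g \<longleftrightarrow>
    (\<exists>a b. analytic2_at a z \<and> analytic2_at b z \<and> (\<forall>\<^sub>F w in nhds z. h w = a w * f w + b w * g w))"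
  by (auto simp: span2_def germ_eq_iff)

lemma ideal_span2:
  assumes "analytic2_at f z" "analytic2_at g z"
  shows "ideal (span2 z f g) (O2 z)"
proof -
  interpret cring "O2 z" by (rule O2_cring)
  have mult: "A \<otimes>\<^bsub>O2 z\<^esub> B \<in> span2 z f g" if B: "B \<in> span2 z f g" and A: "A \<in> carrier (O2 z)" for A B
  proof -
    obtain k where k: "analytic2_at k z" "A = germ z k" using A by (rule carrier_O2E)
    obtain a b where ab: "analytic2_at a z" "analytic2_at b z" "B = germ z (\<lambda>w. a w * f w + b w * g w)"
      using B by (auto simp: span2_def)
    show ?thesis
      unfolding k ab O2_mult_germ germ_in_span2_iff
      using k ab by (intro exI[of _ "\<lambda>w. k w * a w"] exI[of _ "\<lambda>w. k w * b w"]) (simp add: algebra_simps)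
  qed
  have sub: "span2 z f g \<subseteq> carrier (O2 z)" using assms by (auto simp: span2_def)
  show ?thesis
  proof (rule idealI[OF ring_axioms])
    show "subgroup (span2 z f g) (add_monoid (O2 z))"
    proof (rule add.subgroupI)
      have "germ z (\<lambda>w. 0) \<in> span2 z f g"
        unfolding germ_in_span2_iff by (intro exI[of _ "\<lambda>w. 0"]) simp
      then show "span2 z f g \<noteq> {}" by blast
    next
      fix A assume A: "A \<in> span2 z f g"
      then have "\<ominus>\<^bsub>O2 z\<^esub> A = (\<ominus>\<^bsub>O2 z\<^esub> \<one>\<^bsub>O2 z\<^esub>) \<otimes>\<^bsub>O2 z\<^esub> A"
        using sub l_minus[of "\<one>\<^bsub>O2 z\<^esub>" A] by auto
      then show "\<ominus>\<^bsub>O2 z\<^esub> A \<in> span2 z f g" using mult[OF A] by simp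
    next
      fix A B assume "A \<in> span2 z f g" "B \<in> span2 z f g"
      then obtain a b c d where "analytic2_at a z" "analytic2_at b z" "A = germ z (\<lambda>w. a w * f w + b w * g w)"
        "analytic2_at c z" "analytic2_at d z" "B = germ z (\<lambda>w. c w * f w + d w * g w)"
        by (auto simp: span2_def)
      moreover from this have "A \<oplus>\<^bsub>O2 z\<^esub> B = germ z (\<lambda>w. (a w + c w) * f w + (b w + d w) * g w)"
        by (simp add: O2_add_germ algebra_simps)
      ultimately show "A \<oplus>\<^bsub>O2 z\<^esub> B \<in> span2 z f g"
        unfolding span2_def mem_Collect_eq
        by (intro exI[of _ "\<lambda>w. a w + c w"] exI[of _ "\<lambda>w. b w + d w"]) simp
    qed (use sub in auto)
    fix A B assume *: "B \<in> span2 z f g" "A \<in> carrier (O2 z)"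
    show "A \<otimes>\<^bsub>O2 z\<^esub> B \<in> span2 z f g" by (rule mult[OF *])
    then show "B \<otimes>\<^bsub>O2 z\<^esub> A \<in> span2 z f g" using * sub m_comm by auto
  qed
qed

lemma Idl_eq_span2:
  assumes "analytic2_at f z" "analytic2_at g z"
  shows "Idl\<^bsub>O2 z\<^esub> {germ z f, germ z g} = span2 z f g"
proof
  interpret cring "O2 z" by (rule O2_cring)
  have sub: "{germ z f, germ z g} \<subseteq> carrier (O2 z)" using assms by auto
  have "germ z f \<in> span2 z f g"
    unfolding germ_in_span2_iff by (intro exI[of _ "\<lambda>w. 1"] exI[of _ "\<lambda>w. 0"]) simp
  moreover have "germ z g \<in> span2 z f g"
    unfolding germ_in_span2_iff by (intro exI[of _ "\<lambda>w. 0"] exI[of _ "\<lambda>w. 1"]) simp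
  ultimately show "Idl\<^bsub>O2 z\<^esub> {germ z f, germ z g} \<subseteq> span2 z f g"
    by (intro genideal_minimal ideal_span2 assms) auto
  interpret I: ideal "Idl\<^bsub>O2 z\<^esub> {germ z f, germ z g}" "O2 z" by (rule genideal_ideal[OF sub])
  have in_I: "germ z f \<in> Idl\<^bsub>O2 z\<^esub> {germ z f, germ z g}" "germ z g \<in> Idl\<^bsub>O2 z\<^esub> {germ z f, germ z g}"
    using genideal_self[OF sub] by auto
  show "span2 z f g \<subseteq> Idl\<^bsub>O2 z\<^esub> {germ z f, germ z g}"
  proof
    fix A assume "A \<in> span2 z f g"
    then obtain a b where ab: "analytic2_at a z" "analytic2_at b z" "A = germ z (\<lambda>w. a w * f w + b w * g w)"
      by (auto simp: span2_def)
    have "A = germ z a \<otimes>\<^bsub>O2 z\<^esub> germ z f \<oplus>\<^bsub>O2 z\<^esub> germ z b \<otimes>\<^bsub>O2 z\<^esub> germ z g"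
      by (simp add: ab O2_add_germ O2_mult_germ)
    also have "\<dots> \<in> Idl\<^bsub>O2 z\<^esub> {germ z f, germ z g}"
      using ab by (intro additive_subgroup.a_closed[OF I.is_additive_subgroup] I.I_l_closed in_I) auto
    finally show "A \<in> Idl\<^bsub>O2 z\<^esub> {germ z f, germ z g}" .
  qed
qed

lemma span2_subset:
  assumes f: "germ z f1 \<in> span2 z g1 g2" "germ z f2 \<in> span2 z g1 g2"
    and g: "analytic2_at g1 z" "analytic2_at g2 z"
  shows "span2 z f1 f2 \<subseteq> span2 z g1 g2"
proof
  interpret I: ideal "span2 z g1 g2" "O2 z" by (rule ideal_span2[OF g])
  fix A assume "A \<in> span2 z f1 f2"
  then obtain a b where ab: "analytic2_at a z" "analytic2_at b z" "A = germ z (\<lambda>w. a w * f1 w + b w * f2 w)"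
    by (auto simp: span2_def)
  have "A = germ z a \<otimes>\<^bsub>O2 z\<^esub> germ z f1 \<oplus>\<^bsub>O2 z\<^esub> germ z b \<otimes>\<^bsub>O2 z\<^esub> germ z f2"
    by (simp add: ab O2_add_germ O2_mult_germ)
  also have "\<dots> \<in> span2 z g1 g2"
    using ab by (intro additive_subgroup.a_closed[OF I.is_additive_subgroup] I.I_l_closed f) auto
  finally show "A \<in> span2 z g1 g2" .
qed

text \<open>
  Cramer's rule over the local ring: \<open>B\<close> is invertible as soon as its determinant does not vanish at \<open>z\<close>.
\<close>

lemma span2_subset_of_matrix:
  fixes f1 f2 g1 g2 :: "complex \<times> complex \<Rightarrow> complex"
  assumes g: "analytic2_at g1 z" "analytic2_at g2 z"
    and A: "analytic2_at a11 z" "analytic2_at a12 z" "analytic2_at a21 z" "analytic2_at a22 z"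
    and B: "analytic2_at b11 z" "analytic2_at b12 z" "analytic2_at b21 z" "analytic2_at b22 z"
    and det: "b11 z * b22 z - b12 z * b21 z \<noteq> 0"
    and e1: "\<forall>\<^sub>F w in nhds z. b11 w * f1 w + b12 w * f2 w = a11 w * g1 w + a12 w * g2 w"
    and e2: "\<forall>\<^sub>F w in nhds z. b21 w * f1 w + b22 w * f2 w = a21 w * g1 w + a22 w * g2 w"
  shows "span2 z f1 f2 \<subseteq> span2 z g1 g2"
proof -
  have "analytic2_at (\<lambda>w. b11 w * b22 w - b12 w * b21 w) z" using B by simp
  then obtain D where D: "analytic2_at D z" "\<forall>\<^sub>F w in nhds z. (b11 w * b22 w - b12 w * b21 w) * D w = 1"
    using det by (rule analytic2_reciprocal)
  have "germ z f1 \<in> span2 z g1 g2"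
    unfolding germ_in_span2_iff
  proof (intro exI conjI)
    show "\<forall>\<^sub>F w in nhds z. f1 w = (D w * (b22 w * a11 w - b12 w * a21 w)) * g1 w
        + (D w * (b22 w * a12 w - b12 w * a22 w)) * g2 w"
      using e1 e2 D(2)
    proof eventually_elim
      case (elim w)
      have "f1 w = (b11 w * b22 w - b12 w * b21 w) * D w * f1 w" using elim(3) by simp
      also have "\<dots> = D w * (b22 w * (b11 w * f1 w + b12 w * f2 w) - b12 w * (b21 w * f1 w + b22 w * f2 w))"
        by (simp add: algebra_simps)
      finally show ?case unfolding elim(1,2) by (simp add: algebra_simps)
    qed
  qed (use A B D in auto)
  moreover have "germ z f2 \<in> span2 z g1 g2"
    unfolding germ_in_span2_iff
  proof (intro exI conjI)
    show "\<forall>\<^sub>F w in nhds z. f2 w = (D w * (b11 w * a21 w - b21 w * a11 w)) * g1 w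
        + (D w * (b11 w * a22 w - b21 w * a12 w)) * g2 w"
      using e1 e2 D(2)
    proof eventually_elim
      case (elim w)
      have "f2 w = (b11 w * b22 w - b12 w * b21 w) * D w * f2 w" using elim(3) by simp
      also have "\<dots> = D w * (b11 w * (b21 w * f1 w + b22 w * f2 w) - b21 w * (b11 w * f1 w + b12 w * f2 w))"
        by (simp add: algebra_simps)
      finally show ?case unfolding elim(1,2) by (simp add: algebra_simps)
    qed
  qed (use A B D in auto)
  ultimately show ?thesis using g by (rule span2_subset)
qed

lemma span2_eq_of_matrix:
  fixes f1 f2 g1 g2 :: "complex \<times> complex \<Rightarrow> complex"
  assumes f: "analytic2_at f1 z" "analytic2_at f2 z" and g: "analytic2_at g1 z" "analytic2_at g2 z"
    and A: "analytic2_at a11 z" "analytic2_at a12 z" "analytic2_at a21 z" "analytic2_at a22 z"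
    and B: "analytic2_at b11 z" "analytic2_at b12 z" "analytic2_at b21 z" "analytic2_at b22 z"
    and det: "b11 z * b22 z - b12 z * b21 z \<noteq> 0" "a11 z * a22 z - a12 z * a21 z \<noteq> 0"
    and e1: "\<forall>\<^sub>F w in nhds z. b11 w * f1 w + b12 w * f2 w = a11 w * g1 w + a12 w * g2 w"
    and e2: "\<forall>\<^sub>F w in nhds z. b21 w * f1 w + b22 w * f2 w = a21 w * g1 w + a22 w * g2 w"
  shows "span2 z f1 f2 = span2 z g1 g2"
proof
  show "span2 z f1 f2 \<subseteq> span2 z g1 g2"
    by (rule span2_subset_of_matrix[OF g A B det(1) e1 e2])
  show "span2 z g1 g2 \<subseteq> span2 z f1 f2"
    by (rule span2_subset_of_matrix[OF f B A det(2)])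
      (use e1 e2 in \<open>auto elim: eventually_mono\<close>)
qed

section \<open>Ideals of finite codimension\<close>

text \<open>
  The scalars as a structure of their own: their image in a nontrivial quotient is then a subfield, as the
  dimension theory of algebras over a subfield demands.
\<close>

definition complex_ring :: "complex ring"
  where "complex_ring = \<lparr>carrier = UNIV, mult = (*), one = 1, zero = 0, add = (+)\<rparr>"

lemma field_complex_ring: "field complex_ring"
proof (rule cring.cring_fieldI2)
  show "cring complex_ring"
  proof (intro cringI abelian_groupI comm_monoidI)
    fix x assume "x \<in> carrier complex_ring"
    show "\<exists>y\<in>carrier complex_ring. y \<oplus>\<^bsub>complex_ring\<^esub> x = \<zero>\<^bsub>complex_ring\<^esub>"
      by (rule bexI[of _ "- x"]) (simp_all add: complex_ring_def)
  qed (auto simp: complex_ring_def algebra_simps)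
  fix a assume "a \<in> carrier complex_ring" "a \<noteq> \<zero>\<^bsub>complex_ring\<^esub>"
  then show "\<exists>b\<in>carrier complex_ring. a \<otimes>\<^bsub>complex_ring\<^esub> b = \<one>\<^bsub>complex_ring\<^esub>"
    by (intro bexI[of _ "inverse a"]) (auto simp: complex_ring_def)
qed (simp add: complex_ring_def)

lemma combine_powers:
  assumes s: "analytic2_at s z"
  shows "ring.combine (O2 z) (map (\<lambda>c. germ z (\<lambda>w. c)) cs)
      (map (\<lambda>i. germ z (\<lambda>w. s w ^ i)) [m..<m + length cs])
    = germ z (\<lambda>w. \<Sum>i<length cs. cs ! i * s w ^ (m + i))"
proof (induction cs arbitrary: m)
  interpret cring "O2 z" by (rule O2_cring)
  case Nil
  then show ?case by (simp add: zero_O2)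
next
  interpret cring "O2 z" by (rule O2_cring)
  case (Cons c cs)
  have "[m..<m + length (c # cs)] = m # [Suc m..<Suc m + length cs]"
    using upt_conv_Cons[of m "m + length (c # cs)"] by (simp del: upt_Suc)
  then show ?case
    using Cons[of "Suc m"]
    by (simp add: O2_mult_germ O2_add_germ sum.lessThan_Suc_shift germ_eq_iff del: sum.lessThan_Suc upt_Suc)
qed

text \<open>
  A nonzero polynomial in \<open>s\<close> is a power of \<open>s\<close> times a function that does not vanish at \<open>z\<close>, hence a unit.
\<close>

lemma power_in_ideal_if_polynomial:
  assumes I: "ideal I (O2 z)" and s: "analytic2_at s z" "s z = 0"
    and p: "germ z (\<lambda>w. \<Sum>i<n. c i * s w ^ i) \<in> I" and nz: "j < n" "c j \<noteq> 0"
  shows "\<exists>k. germ z (\<lambda>w. s w ^ k) \<in> I"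
proof -
  interpret I: ideal I "O2 z" by (rule I)
  define k where "k = (LEAST i. c i \<noteq> 0)"
  have ck: "c k \<noteq> 0" unfolding k_def by (rule LeastI[of _ j]) (rule nz)
  have below: "c i = 0" if "i < k" for i
    using not_less_Least[of i "\<lambda>i. c i \<noteq> 0"] that unfolding k_def by blast
  have "k \<le> j" unfolding k_def by (rule Least_le) (rule nz)
  then have kn: "k < n" using nz by simp
  define u where "u = (\<lambda>w. \<Sum>i<n - k. c (k + i) * s w ^ i)"
  have u: "analytic2_at u z" unfolding u_def using s by simp
  have "u z = c k"
    unfolding u_def s(2) using kn by (subst sum.remove[of _ 0]) auto
  then obtain v where v: "analytic2_at v z" "\<forall>\<^sub>F w in nhds z. u w * v w = 1"
    using analytic2_reciprocal[OF u] ck by metis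
  have pu: "(\<Sum>i<n. c i * s w ^ i) = s w ^ k * u w" for w
  proof -
    have "(\<Sum>i<n. c i * s w ^ i) = (\<Sum>i\<in>{k..<n}. c i * s w ^ i)"
      using below by (intro sum.mono_neutral_right) auto
    also have "\<dots> = (\<Sum>i<n - k. c (k + i) * s w ^ (k + i))"
      by (rule sum.reindex_bij_witness[of _ "\<lambda>i. k + i" "\<lambda>i. i - k"]) auto
    finally show ?thesis by (simp add: u_def sum_distrib_left power_add mult_ac)
  qed
  have "germ z v \<otimes>\<^bsub>O2 z\<^esub> germ z (\<lambda>w. \<Sum>i<n. c i * s w ^ i) \<in> I"
    using v by (intro I.I_l_closed p) auto
  also have "germ z v \<otimes>\<^bsub>O2 z\<^esub> germ z (\<lambda>w. \<Sum>i<n. c i * s w ^ i) = germ z (\<lambda>w. s w ^ k)"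
    unfolding O2_mult_germ germ_eq_iff pu using v(2)
    by eventually_elim (simp add: mult.left_commute mult.commute)
  finally show ?thesis by blast
qed

text \<open>
  In a quotient of dimension \<open>n\<close> the \<open>n + 1\<close> elements \<open>1, s, \<dots>, s^n\<close> are linearly dependent. The unit
  ideal is treated apart, because in the trivial quotient the scalars do not form a field.
\<close>

lemma power_in_ideal_if_finite_codim:
  assumes I: "ideal I (O2 z)" and fin: "quotient_dim z I \<noteq> \<infinity>"
    and s: "analytic2_at s z" "s z = 0"
  shows "\<exists>k. germ z (\<lambda>w. s w ^ k) \<in> I"
proof (cases "germ z (\<lambda>w. 1) \<in> I")
  case True
  then show ?thesis by (intro exI[of _ 0]) simp
next
  case False
  define R where "R = O2 z"
  define Q where "Q = R Quot I"
  define h where "h = (\<lambda>A. I +>\<^bsub>R\<^esub> A)"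
  define K where "K = range (\<lambda>c::complex. h (germ z (\<lambda>w. c)))"
  interpret R: cring R unfolding R_def by (rule O2_cring)
  interpret I: ideal I R using I by (simp add: R_def)
  interpret hom: ring_hom_ring R Q h
    unfolding Q_def h_def by (rule I.rcos_ring_hom_ring)
  have hz: "h A = \<zero>\<^bsub>Q\<^esub> \<longleftrightarrow> A \<in> I" if "A \<in> carrier R" for A
    using that I.rcos_const_imp_mem R.a_rcos_zero[OF I.ideal_axioms]
    by (auto simp: h_def Q_def FactRing_def)
  obtain n where n: "ring.dimension Q n K (carrier Q)"
    using fin unfolding quotient_dim_def Let_def K_def Q_def R_def h_def by (auto split: if_splits)
  interpret C: field complex_ring by (rule field_complex_ring)
  have "ring_hom_ring complex_ring Q (\<lambda>c. h (germ z (\<lambda>w. c)))"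
  proof (rule ring_hom_ringI2[OF C.ring_axioms hom.S.ring_axioms], rule ring_hom_memI)
    fix c d :: complex
    have "germ z (\<lambda>w. c * d) = germ z (\<lambda>w. c) \<otimes>\<^bsub>R\<^esub> germ z (\<lambda>w. d)"
      "germ z (\<lambda>w. c + d) = germ z (\<lambda>w. c) \<oplus>\<^bsub>R\<^esub> germ z (\<lambda>w. d)"
      by (simp_all add: R_def O2_mult_germ O2_add_germ)
    moreover have car: "germ z (\<lambda>w. k) \<in> carrier R" for k by (simp add: R_def)
    ultimately show "h (germ z (\<lambda>w. c \<otimes>\<^bsub>complex_ring\<^esub> d)) = h (germ z (\<lambda>w. c)) \<otimes>\<^bsub>Q\<^esub> h (germ z (\<lambda>w. d))"
      "h (germ z (\<lambda>w. c \<oplus>\<^bsub>complex_ring\<^esub> d)) = h (germ z (\<lambda>w. c)) \<oplus>\<^bsub>Q\<^esub> h (germ z (\<lambda>w. d))"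
      using hom.hom_mult[OF car car] hom.hom_add[OF car car] by (simp_all add: complex_ring_def)
  next
    show "h (germ z (\<lambda>w. \<one>\<^bsub>complex_ring\<^esub>)) = \<one>\<^bsub>Q\<^esub>"
      using hom.hom_one by (simp add: complex_ring_def R_def one_O2)
  qed (simp add: R_def)
  then interpret hc: ring_hom_ring complex_ring Q "\<lambda>c. h (germ z (\<lambda>w. c))" .
  have "\<one>\<^bsub>Q\<^esub> \<noteq> \<zero>\<^bsub>Q\<^esub>"
    using hz[of "\<one>\<^bsub>R\<^esub>"] False hom.hom_one by (simp add: R_def one_O2)
  from hc.img_is_subfield(2)[OF C.carrier_is_subfield this]
  have K: "subfield K Q" by (simp add: K_def complex_ring_def)
  define Us where "Us = map h (map (\<lambda>i. germ z (\<lambda>w. s w ^ i)) [0..<Suc n])"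
  have pow: "germ z (\<lambda>w. s w ^ i) \<in> carrier R" for i using s by (simp add: R_def)
  then have Us: "set Us \<subseteq> carrier Q" by (auto simp: Us_def)
  have "\<not> hom.S.independent K Us"
    using hom.S.independent_length_le_dimension[OF K n _ Us] by (auto simp: Us_def)
  then obtain Ks where Ks: "length Ks = length Us" "hom.S.combine Ks Us = \<zero>\<^bsub>Q\<^esub>"
      "set Ks \<subseteq> K" "set Ks \<noteq> {\<zero>\<^bsub>Q\<^esub>}"
    using hom.S.dependent_imp_non_trivial_combine[OF K Us] by blast
  define pre where "pre = (\<lambda>k. SOME c. k = h (germ z (\<lambda>w. c)))"
  have pre: "h (germ z (\<lambda>w. pre k)) = k" if "k \<in> K" for k
    using that someI_ex[of "\<lambda>c. k = h (germ z (\<lambda>w. c))"] unfolding pre_def K_def by auto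
  define cs where "cs = map pre Ks"
  have len: "length cs = Suc n" using Ks(1) by (simp add: cs_def Us_def)
  have Ks_eq: "Ks = map h (map (\<lambda>c. germ z (\<lambda>w. c)) cs)"
    using Ks(3) pre by (auto simp: cs_def intro!: map_idI[symmetric])
  have "\<zero>\<^bsub>Q\<^esub> = h (R.combine (map (\<lambda>c. germ z (\<lambda>w. c)) cs) (map (\<lambda>i. germ z (\<lambda>w. s w ^ i)) [0..<Suc n]))"
    unfolding Ks(2)[symmetric] Ks_eq Us_def
    by (rule hom.combine_hom) (use pow in \<open>auto simp: R_def\<close>)
  also have "R.combine (map (\<lambda>c. germ z (\<lambda>w. c)) cs) (map (\<lambda>i. germ z (\<lambda>w. s w ^ i)) [0..<Suc n])
      = germ z (\<lambda>w. \<Sum>i<Suc n. cs ! i * s w ^ i)"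
    using combine_powers[OF s(1), of cs 0] unfolding len R_def by simp
  finally have inI: "germ z (\<lambda>w. \<Sum>i<Suc n. cs ! i * s w ^ i) \<in> I"
    using hz[of "germ z (\<lambda>w. \<Sum>i<Suc n. cs ! i * s w ^ i)"] s by (simp add: R_def del: sum.lessThan_Suc)
  obtain j where j: "j < Suc n" "cs ! j \<noteq> 0"
  proof (rule ccontr)
    assume "\<not> thesis"
    then have z: "cs ! j = 0" if "j < Suc n" for j using that \<open>\<And>j. j < Suc n \<Longrightarrow> cs ! j \<noteq> 0 \<Longrightarrow> thesis\<close> by blast
    have "h (germ z (\<lambda>w. 0)) = \<zero>\<^bsub>Q\<^esub>" using hom.hom_zero by (simp add: R_def zero_O2)
    then have "set Ks \<subseteq> {\<zero>\<^bsub>Q\<^esub>}"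
      using z len unfolding Ks_eq by (auto simp: in_set_conv_nth)
    moreover have "Ks \<noteq> []" using Ks(1) by (auto simp: Us_def)
    ultimately show False using Ks(4) by (cases Ks) auto
  qed
  show ?thesis
    using power_in_ideal_if_polynomial[OF assms(1) s inI j] .
qed

section \<open>Complexification\<close>

lemma cpoint_eq_real_pair: "cpoint = real_pair"
  by (auto simp: cpoint_def real_pair_def fun_eq_iff)

lemma cpoint_add: "cpoint (p + w) = cpoint p + real_pair w"
  by (simp add: cpoint_eq_real_pair real_pair_add)

definition extension :: "real \<times> real \<Rightarrow> (real \<times> real \<Rightarrow> real) \<Rightarrow> (complex \<times> complex \<Rightarrow> complex) \<Rightarrow> bool"
  where "extension q f F \<longleftrightarrow>
    analytic2_at F (cpoint q) \<and> (\<forall>\<^sub>F s in nhds q. F (cpoint s) = of_real (f s))"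

lemma complexify_eq_extensions: "complexify q f = {F. extension q f F}"
  by (simp add: complexify_def extension_def)

lemma extension_exists:
  assumes "analytic2_at f q"
  obtains F where "extension q f F"
proof -
  obtain c r where f: "expands f q c r" using assms by (rule analytic2E)
  define C where "C = (\<lambda>a. complex_of_real (c a))"
  have r: "r > 0" using f by (rule expands_pos)
  have "(\<lambda>a. norm (C a) * r ^ deg a) summable_on UNIV"
    using expands_summable[OF f] by (simp add: C_def)
  then have F: "expands (\<lambda>z. \<Sum>\<^sub>\<infinity>a. C a * mon (z - cpoint q) a) (cpoint q) C r" (is "expands ?F _ _ _")
    by (rule expandsI[OF r])
  have eq: "?F (cpoint (q + w)) = of_real (f (q + w))" if "norm (fst w) \<le> r \<and> norm (snd w) \<le> r" for w
    unfolding cpoint_add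
  proof (rule expands_uniq[OF F])
    have "((\<lambda>a. complex_of_real (c a * mon w a)) has_sum of_real (f (q + w))) UNIV"
      using that by (intro has_sum_of_real expands_has_sum[OF f]) auto
    then show "((\<lambda>a. C a * mon (real_pair w) a) has_sum complex_of_real (f (q + w))) UNIV"
      by (simp add: C_def mon_def real_pair_def)
  qed (use that in \<open>auto simp: real_pair_def\<close>)
  have "\<forall>\<^sub>F w in nhds 0. ?F (cpoint (q + w)) = of_real (f (q + w))"
    using eventually_nhds_polydisc[OF r] by (rule eventually_mono) (rule eq)
  then have "\<forall>\<^sub>F s in nhds q. ?F (cpoint s) = of_real (f s)"
    by (subst eventually_nhds_shift_iff)
  then have "extension q f ?F"
    using expands_imp_analytic2[OF F] by (simp add: extension_def)
  then show ?thesis by (rule that)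
qed

text \<open>
  Order of vanishing of the real function at \<open>q\<close> controls its complexification, since both have the same
  coefficients.
\<close>

lemma extension_vanishing_coeffs:
  assumes F: "expands F (cpoint q) c r" and ext: "\<forall>\<^sub>F s in nhds q. F (cpoint s) = of_real (f s)"
    and van: "vanishes_to_order N f q" and a: "deg a < N"
  shows "c a = 0"
proof (rule expands_coeff_eq_0[OF F _ a])
  obtain C where C: "\<forall>\<^sub>F w in nhds 0. norm (f (q + w)) \<le> C * norm w ^ N"
    using van by (auto simp: vanishes_to_order_def)
  have "\<forall>\<^sub>F w in nhds 0. norm (F (cpoint q + real_pair w)) \<le> C * norm w ^ N"
    using C ext[unfolded eventually_nhds_shift_iff[where p = q]]
    by eventually_elim (simp add: cpoint_add)
  then show "\<exists>C. \<forall>\<^sub>F w in nhds 0. norm (F (cpoint q + real_pair w)) \<le> C * norm w ^ N" ..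
qed

lemma extension_unique:
  assumes "extension q f F" "extension q f G"
  shows "\<forall>\<^sub>F w in nhds (cpoint q). F w = G w"
proof -
  have "analytic2_at (\<lambda>w. F w - G w) (cpoint q)"
    using assms by (simp add: extension_def)
  then obtain c r where H: "expands (\<lambda>w. F w - G w) (cpoint q) c r" by (rule analytic2E)
  have ext: "\<forall>\<^sub>F s in nhds q. F (cpoint s) - G (cpoint s) = of_real 0"
    using assms[unfolded extension_def, THEN conjunct2] by eventually_elim simp
  have c: "c a = 0" for a
    by (rule extension_vanishing_coeffs[OF H ext, of "Suc (deg a)"])
      (auto simp: vanishes_to_order_def intro: exI[of _ 0])
  have eq: "F (cpoint q + w) = G (cpoint q + w)" if "norm (fst w) \<le> r \<and> norm (snd w) \<le> r" for w
    using expands_uniq[OF H, of w 0] that c by simp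
  have "\<forall>\<^sub>F w in nhds 0. F (cpoint q + w) = G (cpoint q + w)"
    using eventually_nhds_polydisc[OF expands_pos[OF H]] by (rule eventually_mono) (rule eq)
  then show ?thesis by (subst eventually_nhds_shift_iff)
qed

lemma complexify_eq_germ:
  assumes F: "extension q f F"
  shows "complexify q f = germ (cpoint q) F"
  unfolding complexify_eq_extensions germ_def
proof (intro Collect_cong iffI)
  fix G
  show "\<forall>\<^sub>F w in nhds (cpoint q). G w = F w" if "extension q f G"
    using extension_unique[OF that F] .
  show "extension q f G" if *: "\<forall>\<^sub>F w in nhds (cpoint q). G w = F w"
  proof -
    have "filterlim cpoint (nhds (cpoint q)) (nhds q)"
      unfolding cpoint_eq_real_pair by (rule tendsto_real_pair)
    with * have "\<forall>\<^sub>F s in nhds q. G (cpoint s) = F (cpoint s)"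
      by (rule eventually_compose_filterlim)
    moreover have "\<forall>\<^sub>F s in nhds q. F (cpoint s) = of_real (f s)"
      using F by (simp add: extension_def)
    ultimately have "\<forall>\<^sub>F s in nhds q. G (cpoint s) = of_real (f s)"
      by eventually_elim simp
    with analytic2_cong[OF _ *] F show ?thesis by (simp add: extension_def)
  qed
qed

lemma extension_value: "extension q f F \<Longrightarrow> F (cpoint q) = of_real (f q)"
  by (auto simp: extension_def dest: eventually_nhds_x_imp_x)

lemma extension_analytic: "extension q f F \<Longrightarrow> analytic2_at F (cpoint q)"
  by (simp add: extension_def)

section \<open>Comparison of intersection numbers\<close>

lemma intersection_mult_eq_span2:
  assumes "extension q f F" "extension q g G"
  shows "intersection_mult q f g = quotient_dim (cpoint q) (span2 (cpoint q) F G)"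
  using assms by (simp add: intersection_mult_def complexify_eq_germ Idl_eq_span2 extension_analytic)

lemma common_power_in_ideal:
  assumes I: "ideal I (O2 z)" and fin: "quotient_dim z I \<noteq> \<infinity>"
  obtains k where "germ z (\<lambda>w. (fst w - fst z) ^ k) \<in> I" "germ z (\<lambda>w. (snd w - snd z) ^ k) \<in> I"
proof -
  interpret I: ideal I "O2 z" by (rule I)
  have up: "germ z (\<lambda>w. s w ^ (k + l)) \<in> I" if "analytic2_at s z" "germ z (\<lambda>w. s w ^ k) \<in> I" for s k l
  proof -
    have "germ z (\<lambda>w. s w ^ l) \<otimes>\<^bsub>O2 z\<^esub> germ z (\<lambda>w. s w ^ k) \<in> I"
      using that by (intro I.I_l_closed) auto
    then show ?thesis by (simp add: O2_mult_germ power_add mult.commute)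
  qed
  obtain k where k: "germ z (\<lambda>w. (fst w - fst z) ^ k) \<in> I"
    using power_in_ideal_if_finite_codim[OF I fin, of "\<lambda>w. fst w - fst z"] by auto
  obtain l where l: "germ z (\<lambda>w. (snd w - snd z) ^ l) \<in> I"
    using power_in_ideal_if_finite_codim[OF I fin, of "\<lambda>w. snd w - snd z"] by auto
  show ?thesis
    using that[of "k + l"] up[OF _ k, of l] up[OF _ l, of k] by (simp add: add.commute)
qed

text \<open>
  A function of order \<open>2 k + 2\<close> is a combination of \<open>s^(k+1)\<close> and \<open>t^(k+1)\<close>: a monomial divisible by neither has
  degree at most \<open>2 k\<close>. One factor \<open>s\<close> or \<open>t\<close> remains after \<open>s^k\<close> and \<open>t^k\<close> have been
  expressed by \<open>H1\<close> and \<open>H2\<close>, which makes the coefficients vanish at \<open>z\<close>.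
\<close>

lemma remainder_in_maximal_times_span2:
  fixes H1 H2 P :: "complex \<times> complex \<Rightarrow> complex" and q :: "real \<times> real"
  defines "z \<equiv> cpoint q"
  assumes H: "analytic2_at H1 z" "analytic2_at H2 z"
    and pow: "germ z (\<lambda>w. (fst w - fst z) ^ k) \<in> span2 z H1 H2"
      "germ z (\<lambda>w. (snd w - snd z) ^ k) \<in> span2 z H1 H2"
    and P: "extension q \<rho> P" and van: "vanishes_to_order (2 * k + 2) \<rho> q"
  obtains m1 m2 where "analytic2_at m1 z" "analytic2_at m2 z" "m1 z = 0" "m2 z = 0"
    "\<forall>\<^sub>F w in nhds z. P w = m1 w * H1 w + m2 w * H2 w"
proof -
  obtain c r where c: "expands P z c r"
    using extension_analytic[OF P] unfolding z_def by (rule analytic2E)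
  have c0: "c a = 0" if "fst a < Suc k" "snd a < Suc k" for a
    by (rule extension_vanishing_coeffs[OF c[unfolded z_def] _ van])
      (use P that in \<open>auto simp: extension_def deg_def\<close>)
  obtain u v where uv: "analytic2_at u z" "analytic2_at v z"
    "\<forall>\<^sub>F w in nhds z. P w = (fst w - fst z) ^ Suc k * u w + (snd w - snd z) ^ Suc k * v w"
    using split_off_powers[of P z c r "Suc k"] c c0 by blast
  obtain a b where ab: "analytic2_at a z" "analytic2_at b z"
    "\<forall>\<^sub>F w in nhds z. (fst w - fst z) ^ k = a w * H1 w + b w * H2 w"
    using pow(1) unfolding germ_in_span2_iff by blast
  obtain d e where de: "analytic2_at d z" "analytic2_at e z"
    "\<forall>\<^sub>F w in nhds z. (snd w - snd z) ^ k = d w * H1 w + e w * H2 w"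
    using pow(2) unfolding germ_in_span2_iff by blast
  show ?thesis
  proof (rule that)
    show "\<forall>\<^sub>F w in nhds z. P w
        = ((fst w - fst z) * (u w * a w) + (snd w - snd z) * (v w * d w)) * H1 w
        + ((fst w - fst z) * (u w * b w) + (snd w - snd z) * (v w * e w)) * H2 w"
      using uv(3) ab(3) de(3) by eventually_elim (simp add: algebra_simps)
  qed (use uv ab de in auto)
qed

text \<open>
  Two ideals whose generators are related by an invertible matrix up to terms of arbitrarily high order have the same
  codimension. When the ideal \<open>\<langle>H1, H2\<rangle>\<close>, which is either of the two, has finite codimension, the
  remainders are combinations of \<open>H1, H2\<close> with coefficients vanishing at the base point. They perturb
  the matrix acting on \<open>(g1, g2)\<close> or the identity matrix acting on \<open>(f1, f2)\<close>, and both remain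
  invertible. The matrix may depend on \<open>N\<close>, as it does when its entries come from Taylor polynomials.
\<close>

theorem intersection_mult_eq_if_equal_mod_powers:
  fixes f1 f2 g1 g2 :: "real \<times> real \<Rightarrow> real"
  assumes f: "analytic2_at f1 q" "analytic2_at f2 q" and g: "analytic2_at g1 q" "analytic2_at g2 q"
    and A: "\<And>N. \<exists>a11 a12 a21 a22. analytic2_at a11 q \<and> analytic2_at a12 q \<and>
      analytic2_at a21 q \<and> analytic2_at a22 q \<and> a11 q * a22 q - a12 q * a21 q \<noteq> 0 \<and>
      vanishes_to_order N (\<lambda>s. f1 s - (a11 s * g1 s + a12 s * g2 s)) q \<and>
      vanishes_to_order N (\<lambda>s. f2 s - (a21 s * g1 s + a22 s * g2 s)) q"
  shows "intersection_mult q f1 f2 = intersection_mult q g1 g2"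
proof -
  let ?z = "cpoint q"
  obtain F1 F2 G1 G2 where F1: "extension q f1 F1" and F2: "extension q f2 F2"
    and G1: "extension q g1 G1" and G2: "extension q g2 G2"
    using extension_exists f g by metis
  note an = extension_analytic[OF F1] extension_analytic[OF F2]
    extension_analytic[OF G1] extension_analytic[OF G2]
  have "span2 ?z F1 F2 = span2 ?z G1 G2"
    if H: "(H1, H2) \<in> {(F1, F2), (G1, G2)}" and fin: "quotient_dim ?z (span2 ?z H1 H2) \<noteq> \<infinity>" for H1 H2
  proof -
    have anH: "analytic2_at H1 ?z" "analytic2_at H2 ?z" using H an by auto
    obtain k where k: "germ ?z (\<lambda>w. (fst w - fst ?z) ^ k) \<in> span2 ?z H1 H2"
      "germ ?z (\<lambda>w. (snd w - snd ?z) ^ k) \<in> span2 ?z H1 H2"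
      using ideal_span2[OF anH] fin by (rule common_power_in_ideal)
    obtain a11 a12 a21 a22 where a: "analytic2_at a11 q" "analytic2_at a12 q" "analytic2_at a21 q"
      "analytic2_at a22 q" and det: "a11 q * a22 q - a12 q * a21 q \<noteq> 0"
      and van: "vanishes_to_order (2 * k + 2) (\<lambda>s. f1 s - (a11 s * g1 s + a12 s * g2 s)) q"
        "vanishes_to_order (2 * k + 2) (\<lambda>s. f2 s - (a21 s * g1 s + a22 s * g2 s)) q"
      using A[of "2 * k + 2"] by blast
    obtain A11 A12 A21 A22 where AA: "extension q a11 A11" "extension q a12 A12"
      "extension q a21 A21" "extension q a22 A22"
      using extension_exists a by metis
    note anA = AA[THEN extension_analytic]
    have "extension q (\<lambda>s. f1 s - (a11 s * g1 s + a12 s * g2 s))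
        (\<lambda>w. F1 w - (A11 w * G1 w + A12 w * G2 w))"
      unfolding extension_def
    proof
      show "\<forall>\<^sub>F s in nhds q. F1 (cpoint s) - (A11 (cpoint s) * G1 (cpoint s) + A12 (cpoint s) * G2 (cpoint s))
          = of_real (f1 s - (a11 s * g1 s + a12 s * g2 s))"
        using F1[unfolded extension_def, THEN conjunct2] AA(1,2)[unfolded extension_def, THEN conjunct2]
          G1[unfolded extension_def, THEN conjunct2] G2[unfolded extension_def, THEN conjunct2]
        by eventually_elim simp
    qed (use an anA in simp)
    from remainder_in_maximal_times_span2[OF anH k this van(1)]
    obtain m11 m12 where m1: "analytic2_at m11 ?z" "analytic2_at m12 ?z" "m11 ?z = 0" "m12 ?z = 0"
      "\<forall>\<^sub>F w in nhds ?z. F1 w - (A11 w * G1 w + A12 w * G2 w) = m11 w * H1 w + m12 w * H2 w" .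
    have "extension q (\<lambda>s. f2 s - (a21 s * g1 s + a22 s * g2 s))
        (\<lambda>w. F2 w - (A21 w * G1 w + A22 w * G2 w))"
      unfolding extension_def
    proof
      show "\<forall>\<^sub>F s in nhds q. F2 (cpoint s) - (A21 (cpoint s) * G1 (cpoint s) + A22 (cpoint s) * G2 (cpoint s))
          = of_real (f2 s - (a21 s * g1 s + a22 s * g2 s))"
        using F2[unfolded extension_def, THEN conjunct2] AA(3,4)[unfolded extension_def, THEN conjunct2]
          G1[unfolded extension_def, THEN conjunct2] G2[unfolded extension_def, THEN conjunct2]
        by eventually_elim simp
    qed (use an anA in simp)
    from remainder_in_maximal_times_span2[OF anH k this van(2)]
    obtain m21 m22 where m2: "analytic2_at m21 ?z" "analytic2_at m22 ?z" "m21 ?z = 0" "m22 ?z = 0"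
      "\<forall>\<^sub>F w in nhds ?z. F2 w - (A21 w * G1 w + A22 w * G2 w) = m21 w * H1 w + m22 w * H2 w" .
    have "A11 ?z * A22 ?z - A12 ?z * A21 ?z = of_real (a11 q * a22 q - a12 q * a21 q)"
      using AA[THEN extension_value] by simp
    with det have detA: "A11 ?z * A22 ?z - A12 ?z * A21 ?z \<noteq> 0"
      by (metis of_real_eq_0_iff)
    from H consider "H1 = G1" "H2 = G2" | "H1 = F1" "H2 = F2" by auto
    then show ?thesis
    proof cases
      case 1
      show ?thesis
      proof (rule span2_eq_of_matrix[where ?b11.0 = "\<lambda>w. 1" and ?b12.0 = "\<lambda>w. 0"
            and ?b21.0 = "\<lambda>w. 0" and ?b22.0 = "\<lambda>w. 1" and ?a11.0 = "\<lambda>w. A11 w + m11 w"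
            and ?a12.0 = "\<lambda>w. A12 w + m12 w" and ?a21.0 = "\<lambda>w. A21 w + m21 w"
            and ?a22.0 = "\<lambda>w. A22 w + m22 w"])
        show "\<forall>\<^sub>F w in nhds ?z. 1 * F1 w + 0 * F2 w = (A11 w + m11 w) * G1 w + (A12 w + m12 w) * G2 w"
          using m1(5) by eventually_elim (simp add: 1 algebra_simps)
        show "\<forall>\<^sub>F w in nhds ?z. 0 * F1 w + 1 * F2 w = (A21 w + m21 w) * G1 w + (A22 w + m22 w) * G2 w"
          using m2(5) by eventually_elim (simp add: 1 algebra_simps)
      qed (use an anA m1 m2 detA in simp_all)
    next
      case 2
      show ?thesis
      proof (rule span2_eq_of_matrix[where ?b11.0 = "\<lambda>w. 1 - m11 w" and ?b12.0 = "\<lambda>w. - m12 w"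
            and ?b21.0 = "\<lambda>w. - m21 w" and ?b22.0 = "\<lambda>w. 1 - m22 w" and ?a11.0 = A11
            and ?a12.0 = A12 and ?a21.0 = A21 and ?a22.0 = A22])
        show "\<forall>\<^sub>F w in nhds ?z. (1 - m11 w) * F1 w + - m12 w * F2 w = A11 w * G1 w + A12 w * G2 w"
          using m1(5) by eventually_elim (simp add: 2 algebra_simps)
        show "\<forall>\<^sub>F w in nhds ?z. - m21 w * F1 w + (1 - m22 w) * F2 w = A21 w * G1 w + A22 w * G2 w"
          using m2(5) by eventually_elim (simp add: 2 algebra_simps)
      qed (use an anA m1 m2 detA in simp_all)
    qed
  qed
  then have "quotient_dim ?z (span2 ?z F1 F2) = quotient_dim ?z (span2 ?z G1 G2)"
    by (metis insert_iff)
  then show ?thesis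
    using intersection_mult_eq_span2[OF F1 F2] intersection_mult_eq_span2[OF G1 G2] by simp
qed

section \<open>Polynomial jets of smooth functions\<close>

lemma isCont_imp_filterlim_nhds: "isCont f a \<Longrightarrow> filterlim f (nhds (f a)) (nhds a)"
  unfolding isCont_def tendsto_at_iff_tendsto_nhds .

lemma vanishes_add:
  assumes "vanishes_to_order N f p" "vanishes_to_order N g p"
  shows "vanishes_to_order N (\<lambda>s. f s + g s) p"
proof -
  obtain C D where "\<forall>\<^sub>F w in nhds 0. norm (f (p + w)) \<le> C * norm w ^ N"
    "\<forall>\<^sub>F w in nhds 0. norm (g (p + w)) \<le> D * norm w ^ N"
    using assms by (auto simp: vanishes_to_order_def)
  then have "\<forall>\<^sub>F w in nhds 0. norm (f (p + w) + g (p + w)) \<le> (C + D) * norm w ^ N"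
    by eventually_elim (metis (no_types, lifting) add_mono distrib_right norm_triangle_le)
  then show ?thesis by (auto simp: vanishes_to_order_def)
qed

lemma vanishes_mult:
  fixes f g :: "'a::real_normed_vector \<Rightarrow> 'b::real_normed_field"
  assumes "vanishes_to_order N f p" "vanishes_to_order M g p"
  shows "vanishes_to_order (N + M) (\<lambda>s. f s * g s) p"
proof -
  obtain C D where "\<forall>\<^sub>F w in nhds 0. norm (f (p + w)) \<le> C * norm w ^ N"
    "\<forall>\<^sub>F w in nhds 0. norm (g (p + w)) \<le> D * norm w ^ M"
    using assms by (auto simp: vanishes_to_order_def)
  then have "\<forall>\<^sub>F w in nhds 0. norm (f (p + w) * g (p + w)) \<le> (C * D) * norm w ^ (N + M)"
  proof eventually_elim
    case (elim w)
    have "norm (f (p + w)) * norm (g (p + w)) \<le> (C * norm w ^ N) * (D * norm w ^ M)"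
      using elim by (intro mult_mono) (auto intro: order_trans[OF norm_ge_zero])
    then show ?case by (simp add: norm_mult power_add mult_ac)
  qed
  then show ?thesis by (auto simp: vanishes_to_order_def)
qed

lemma vanishes_cong:
  assumes "vanishes_to_order N f p" "\<forall>\<^sub>F s in nhds p. g s = f s"
  shows "vanishes_to_order N g p"
proof -
  obtain C where "\<forall>\<^sub>F w in nhds 0. norm (f (p + w)) \<le> C * norm w ^ N"
    using assms by (auto simp: vanishes_to_order_def)
  with assms(2)[unfolded eventually_nhds_shift_iff[where p = p]]
  have "\<forall>\<^sub>F w in nhds 0. norm (g (p + w)) \<le> C * norm w ^ N"
    by eventually_elim simp
  then show ?thesis by (auto simp: vanishes_to_order_def)
qed

lemma vanishes_0_if_isCont:
  assumes "isCont f p"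
  shows "vanishes_to_order 0 f p"
proof -
  have "\<forall>\<^sub>F s in nhds p. dist (f s) (f p) < 1"
    using assms[unfolded isCont_def tendsto_at_iff_tendsto_nhds] by (rule tendstoD) simp
  then have "\<forall>\<^sub>F w in nhds 0. norm (f (p + w)) \<le> (norm (f p) + 1) * norm w ^ 0"
    unfolding eventually_nhds_shift_iff[where p = p]
  proof eventually_elim
    case (elim w)
    then show ?case
      using norm_triangle_sub[of "f (p + w)" "f p"] by (simp add: dist_norm)
  qed
  then show ?thesis by (auto simp: vanishes_to_order_def)
qed

lemma vanishes_mult_isCont:
  fixes f g :: "'a::real_normed_vector \<Rightarrow> 'b::real_normed_field"
  assumes "vanishes_to_order N f p" "isCont g p"
  shows "vanishes_to_order N (\<lambda>s. f s * g s) p"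
  using vanishes_mult[OF assms(1) vanishes_0_if_isCont[OF assms(2)]] by simp

lemma vanishes_Suc_imp:
  assumes "vanishes_to_order (Suc N) f p"
  shows "vanishes_to_order N f p"
proof -
  obtain C where C: "\<forall>\<^sub>F w in nhds 0. norm (f (p + w)) \<le> C * norm w ^ Suc N"
    using assms by (auto simp: vanishes_to_order_def)
  have "\<forall>\<^sub>F w :: 'a in nhds 0. norm w < 1"
    by (auto simp: eventually_nhds_metric dist_norm intro!: exI[of _ 1])
  with C have "\<forall>\<^sub>F w in nhds 0. norm (f (p + w)) \<le> \<bar>C\<bar> * norm w ^ N"
  proof eventually_elim
    case (elim w)
    have "C * norm w ^ Suc N \<le> \<bar>C\<bar> * norm w ^ Suc N" by (intro mult_right_mono) auto
    also have "\<dots> \<le> \<bar>C\<bar> * norm w ^ N"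
      using elim by (intro mult_left_mono power_decreasing) auto
    finally show ?case using elim by linarith
  qed
  then show ?thesis by (auto simp: vanishes_to_order_def)
qed

lemma vanishes_1_if_has_derivative:
  fixes f :: "'a::real_normed_vector \<Rightarrow> 'b::real_normed_vector"
  assumes "(f has_derivative D) (at p)"
  shows "vanishes_to_order 1 (\<lambda>s. f s - f p) p"
proof -
  obtain K where K: "\<And>w. norm (D w) \<le> norm w * K"
    using bounded_linear.bounded[OF has_derivative_bounded_linear[OF assms]] by blast
  obtain d where d: "d > 0" "\<And>y. norm (y - p) < d \<Longrightarrow> norm (f y - f p - D (y - p)) \<le> 1 * norm (y - p)"
    using assms[unfolded has_derivative_at_alt] zero_less_one by blast
  have "\<forall>\<^sub>F w :: 'a in nhds 0. norm w < d"
    using d(1) by (auto simp: eventually_nhds_metric dist_norm intro!: exI[of _ d])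
  then have "\<forall>\<^sub>F w in nhds 0. norm (f (p + w) - f p) \<le> (1 + K) * norm w ^ 1"
  proof eventually_elim
    case (elim w)
    have "norm (f (p + w) - f p) \<le> norm (f (p + w) - f p - D w) + norm (D w)"
      using norm_triangle_ineq[of "f (p + w) - f p - D w" "D w"] by simp
    also have "\<dots> \<le> norm w + norm w * K" using d(2)[of "p + w"] elim K[of w] by simp
    finally show ?case by (simp add: algebra_simps)
  qed
  then show ?thesis by (auto simp: vanishes_to_order_def)
qed

lemma isCont_real_polynomial_function:
  "real_polynomial_function Q \<Longrightarrow> isCont Q x"
  using continuous_real_polymonial_function by blast

text \<open>
  What smoothness at a single point contributes to the proof: approximation by polynomials to every
  order. Unlike smoothness itself this is inherited by products and compositions without any
  calculus of higher derivatives.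
\<close>

definition has_polynomial_jets :: "(real \<times> real \<Rightarrow> real) \<Rightarrow> real \<times> real \<Rightarrow> bool"
  where "has_polynomial_jets f p \<longleftrightarrow> (\<forall>N. \<exists>Q. real_polynomial_function Q \<and>
    vanishes_to_order N (\<lambda>s. f s - Q (s - p)) p)"

lemma jetsE:
  assumes "has_polynomial_jets f p"
  obtains Q where "real_polynomial_function Q" "vanishes_to_order N (\<lambda>s. f s - Q (s - p)) p"
  using assms unfolding has_polynomial_jets_def by blast

lemma jets_const: "has_polynomial_jets (\<lambda>_. c) p"
  unfolding has_polynomial_jets_def
  by (auto intro!: exI[of _ "\<lambda>_. c"] exI[of _ 0] real_polynomial_function.intros simp: vanishes_to_order_def)

lemma jets_add:
  assumes "has_polynomial_jets f p" "has_polynomial_jets g p"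
  shows "has_polynomial_jets (\<lambda>s. f s + g s) p"
  unfolding has_polynomial_jets_def
proof
  fix N
  obtain Q1 where Q1: "real_polynomial_function Q1" "vanishes_to_order N (\<lambda>s. f s - Q1 (s - p)) p"
    using assms(1) by (rule jetsE)
  obtain Q2 where Q2: "real_polynomial_function Q2" "vanishes_to_order N (\<lambda>s. g s - Q2 (s - p)) p"
    using assms(2) by (rule jetsE)
  note Q = Q1 Q2
  have "vanishes_to_order N (\<lambda>s. (f s - Q1 (s - p)) + (g s - Q2 (s - p))) p"
    using Q by (intro vanishes_add)
  then have "vanishes_to_order N (\<lambda>s. f s + g s - (\<lambda>w. Q1 w + Q2 w) (s - p)) p"
    by (simp add: algebra_simps)
  moreover have "real_polynomial_function (\<lambda>w. Q1 w + Q2 w)"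
    using Q by (intro real_polynomial_function.intros(3))
  ultimately show "\<exists>Q. real_polynomial_function Q \<and> vanishes_to_order N (\<lambda>s. f s + g s - Q (s - p)) p"
    by (intro exI[of _ "\<lambda>w. Q1 w + Q2 w"] conjI)
qed

lemma jets_mult:
  assumes "has_polynomial_jets f p" "has_polynomial_jets g p"
  shows "has_polynomial_jets (\<lambda>s. f s * g s) p"
  unfolding has_polynomial_jets_def
proof
  fix N
  obtain Q1 where Q1: "real_polynomial_function Q1" "vanishes_to_order N (\<lambda>s. f s - Q1 (s - p)) p"
    using assms(1) by (rule jetsE)
  obtain Q2 where Q2: "real_polynomial_function Q2" "vanishes_to_order N (\<lambda>s. g s - Q2 (s - p)) p"
    using assms(2) by (rule jetsE)
  note Q = Q1 Q2
  obtain Q3 where Q3: "real_polynomial_function Q3" "vanishes_to_order 0 (\<lambda>s. g s - Q3 (s - p)) p"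
    using assms(2) by (rule jetsE)
  have cont: "isCont (\<lambda>s. Q (s - p)) p" if "real_polynomial_function Q" for Q
    by (rule isCont_o2[where g = Q]) (auto intro!: isCont_real_polynomial_function that continuous_intros)
  have "vanishes_to_order 0 (\<lambda>s. (g s - Q3 (s - p)) + Q3 (s - p)) p"
    by (rule vanishes_add[OF Q3(2) vanishes_0_if_isCont[OF cont[OF Q3(1)]]])
  then have g0: "vanishes_to_order 0 g p" by simp
  have "vanishes_to_order (N + 0) (\<lambda>s. (f s - Q1 (s - p)) * g s) p"
    by (rule vanishes_mult[OF Q(2) g0])
  moreover have "vanishes_to_order N (\<lambda>s. (g s - Q2 (s - p)) * Q1 (s - p)) p"
    by (rule vanishes_mult_isCont[OF Q(4) cont[OF Q(1)]])
  ultimately have "vanishes_to_order N (\<lambda>s. (f s - Q1 (s - p)) * g s + (g s - Q2 (s - p)) * Q1 (s - p)) p"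
    by (simp add: vanishes_add)
  then have "vanishes_to_order N (\<lambda>s. f s * g s - (\<lambda>w. Q1 w * Q2 w) (s - p)) p"
    by (simp add: algebra_simps)
  moreover have "real_polynomial_function (\<lambda>w. Q1 w * Q2 w)"
    using Q by (intro real_polynomial_function.intros(4))
  ultimately show "\<exists>Q. real_polynomial_function Q \<and> vanishes_to_order N (\<lambda>s. f s * g s - Q (s - p)) p"
    by (intro exI[of _ "\<lambda>w. Q1 w * Q2 w"] conjI)
qed

lemma jets_polynomial_compose:
  assumes Q: "real_polynomial_function Q"
    and g: "has_polynomial_jets (fst \<circ> g) p" "has_polynomial_jets (snd \<circ> g) p"
  shows "has_polynomial_jets (\<lambda>s. Q (g s - b)) p"
  using Q
proof induction
  case (linear Q)
  interpret bounded_linear Q by (rule linear)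
  have Qv: "Q v = fst v * Q (1, 0) + snd v * Q (0, 1)" for v
    using add[of "(fst v, 0)" "(0, snd v)"] scaleR[of "fst v" "(1, 0)"] scaleR[of "snd v" "(0, 1)"]
    by simp
  have "(\<lambda>s. Q (g s - b)) =
      (\<lambda>s. ((fst \<circ> g) s + - fst b) * Q (1, 0) + ((snd \<circ> g) s + - snd b) * Q (0, 1))"
    by (rule ext, subst Qv) simp
  then show ?case
    by (simp only:) (intro jets_add jets_mult jets_const g)
qed (auto intro: jets_const jets_add jets_mult)

text \<open>
  The approximating polynomial of \<open>f\<close> may be composed with \<open>g\<close>, because \<open>g s - g p\<close> is at most of the size
  of \<open>s - p\<close>.
\<close>

lemma jets_compose:
  assumes f: "has_polynomial_jets f (g p)"
    and g: "has_polynomial_jets (fst \<circ> g) p" "has_polynomial_jets (snd \<circ> g) p"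
    and der: "(g has_derivative D) (at p)"
  shows "has_polynomial_jets (\<lambda>s. f (g s)) p"
  unfolding has_polynomial_jets_def
proof
  fix N
  obtain Q where Q: "real_polynomial_function Q" "vanishes_to_order N (\<lambda>s. f s - Q (s - g p)) (g p)"
    using f by (rule jetsE)
  obtain C where C: "\<forall>\<^sub>F v in nhds 0. norm (f (g p + v) - Q v) \<le> C * norm v ^ N"
    using Q(2) by (auto simp: vanishes_to_order_def)
  obtain L where L: "\<forall>\<^sub>F w in nhds 0. norm (g (p + w) - g p) \<le> L * norm w ^ 1"
    using vanishes_1_if_has_derivative[OF der] by (auto simp: vanishes_to_order_def)
  have "isCont (\<lambda>w. g (p + w)) 0"
    by (rule isCont_o2[where f = "\<lambda>w. p + w"]) (auto simp: has_derivative_continuous[OF der])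
  then have "isCont (\<lambda>w. g (p + w) - g p) 0"
    by (rule isCont_diff) simp
  then have "filterlim (\<lambda>w. g (p + w) - g p) (nhds 0) (nhds 0)"
    by (auto dest: isCont_imp_filterlim_nhds)
  from eventually_compose_filterlim[OF C this] L
  have "\<forall>\<^sub>F w in nhds 0. norm (f (g (p + w)) - Q (g (p + w) - g p)) \<le> (\<bar>C\<bar> * L ^ N) * norm w ^ N"
  proof eventually_elim
    case (elim w)
    have "norm (f (g (p + w)) - Q (g (p + w) - g p)) \<le> C * norm (g (p + w) - g p) ^ N"
      using elim(1) by simp
    also have "\<dots> \<le> \<bar>C\<bar> * norm (g (p + w) - g p) ^ N" by (intro mult_right_mono) auto
    also have "\<dots> \<le> \<bar>C\<bar> * (L * norm w) ^ N"
      using elim(2) by (intro mult_left_mono power_mono) auto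
    finally show ?case by (simp add: power_mult_distrib mult_ac)
  qed
  then have 1: "vanishes_to_order N (\<lambda>s. f (g s) - Q (g s - g p)) p"
    by (auto simp: vanishes_to_order_def)
  obtain Q' where Q': "real_polynomial_function Q'" "vanishes_to_order N (\<lambda>s. Q (g s - g p) - Q' (s - p)) p"
    using jets_polynomial_compose[OF Q(1) g] by (rule jetsE)
  show "\<exists>Q. real_polynomial_function Q \<and> vanishes_to_order N (\<lambda>s. f (g s) - Q (s - p)) p"
    using vanishes_add[OF 1 Q'(2)] Q'(1) by auto
qed

text \<open>
  The \<open>j\<close>-fold derivative in the direction \<open>w\<close>. Recursion on the innermost partial derivative matches the
  recursion in the definition of \<open>C\<^sup>k\<close>, so that statements about all \<open>f\<close> follow by induction on \<open>j\<close>.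
\<close>

fun dirderiv :: "nat \<Rightarrow> (real \<times> real \<Rightarrow> real) \<Rightarrow> real \<times> real \<Rightarrow> real \<times> real \<Rightarrow> real"
  where
    "dirderiv 0 f w x = f x"
  | "dirderiv (Suc j) f w x = fst w * dirderiv j (pdu f) w x + snd w * dirderiv j (pdv f) w x"

lemma has_derivative_pd:
  assumes "f differentiable (at p)"
  shows "(f has_derivative (\<lambda>w. fst w * pdu f p + snd w * pdv f p)) (at (p :: real \<times> real))"
proof -
  obtain D where D: "(f has_derivative D) (at p)"
    using assms by (auto simp: differentiable_def)
  interpret bounded_linear D using D by (rule has_derivative_bounded_linear)
  have "D w = fst w * pdu f p + snd w * pdv f p" for w
    using add[of "(fst w, 0)" "(0, snd w)"] scaleR[of "fst w" "(1, 0)"] scaleR[of "snd w" "(0, 1)"]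
      pd_of_has_derivative(3,4)[OF D] by simp
  then have "D = (\<lambda>w. fst w * pdu f p + snd w * pdv f p)" by (rule ext)
  with D show ?thesis by simp
qed

lemma dirderiv_has_derivative:
  assumes "Ck_on (Suc j) V f" "x + t *\<^sub>R w \<in> V"
  shows "((\<lambda>t. dirderiv j f w (x + t *\<^sub>R w)) has_real_derivative dirderiv (Suc j) f w (x + t *\<^sub>R w)) (at t)"
  using assms(1)
proof (induction j arbitrary: f)
  case 0
  have "f differentiable (at (x + t *\<^sub>R w))" using 0 assms(2) by auto
  from has_derivative_pd[OF this]
  have "((\<lambda>t. f (x + t *\<^sub>R w)) has_derivative (\<lambda>h. fst (h *\<^sub>R w) * pdu f (x + t *\<^sub>R w) + snd (h *\<^sub>R w) * pdv f (x + t *\<^sub>R w))) (at t)"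
    by (rule has_derivative_compose[rotated]) (auto intro!: derivative_eq_intros)
  moreover have "(\<lambda>h. fst (h *\<^sub>R w) * pdu f (x + t *\<^sub>R w) + snd (h *\<^sub>R w) * pdv f (x + t *\<^sub>R w))
      = (*) (fst w * pdu f (x + t *\<^sub>R w) + snd w * pdv f (x + t *\<^sub>R w))"
    by (simp add: fun_eq_iff algebra_simps)
  ultimately show ?case
    by (simp add: has_field_derivative_def)
next
  case (Suc j)
  have "Ck_on (Suc j) V (pdu f)" "Ck_on (Suc j) V (pdv f)" using Suc.prems by auto
  note d = this[THEN Suc.IH]
  show ?case
    using DERIV_add[OF DERIV_cmult[OF d(1), of "fst w"] DERIV_cmult[OF d(2), of "snd w"]]
    by simp
qed

lemma dirderiv_bound:
  assumes "Ck_on j V f" "compact K" "K \<subseteq> V"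
  shows "\<exists>B. \<forall>x\<in>K. \<forall>w. \<bar>dirderiv j f w x\<bar> \<le> B * norm w ^ j"
  using assms(1)
proof (induction j arbitrary: f)
  case 0
  have "bounded (f ` K)"
    using 0 assms by (intro compact_imp_bounded compact_continuous_image) (auto intro: continuous_on_subset)
  then show ?case by (auto simp: bounded_iff)
next
  case (Suc j)
  obtain B where B: "\<And>x w. x \<in> K \<Longrightarrow> \<bar>dirderiv j (pdu f) w x\<bar> \<le> B * norm w ^ j"
    using Suc.IH[of "pdu f"] Suc.prems by auto
  obtain C where C: "\<And>x w. x \<in> K \<Longrightarrow> \<bar>dirderiv j (pdv f) w x\<bar> \<le> C * norm w ^ j"
    using Suc.IH[of "pdv f"] Suc.prems by auto
  have "\<bar>dirderiv (Suc j) f w x\<bar> \<le> (B + C) * norm w ^ Suc j" if "x \<in> K" for x w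
  proof -
    have n: "\<bar>fst w\<bar> \<le> norm w" "\<bar>snd w\<bar> \<le> norm w"
      using norm_fst_le[of "fst w" "snd w"] norm_snd_le[of "snd w" "fst w"] by auto
    have "\<bar>dirderiv (Suc j) f w x\<bar> \<le> \<bar>fst w\<bar> * \<bar>dirderiv j (pdu f) w x\<bar> + \<bar>snd w\<bar> * \<bar>dirderiv j (pdv f) w x\<bar>"
      by (simp add: abs_mult[symmetric] abs_triangle_ineq)
    also have "\<dots> \<le> norm w * (B * norm w ^ j) + norm w * (C * norm w ^ j)"
      using B[OF that, of w] C[OF that, of w] n by (intro add_mono mult_mono) auto
    finally show ?thesis by (simp add: algebra_simps)
  qed
  then show ?case by blast
qed

lemma dirderiv_polynomial: "real_polynomial_function (\<lambda>w. dirderiv j f w x)"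
proof (induction j arbitrary: f)
  case (Suc j)
  show ?case
    unfolding dirderiv.simps
    by (intro real_polynomial_function.intros(3,4) Suc
        real_polynomial_function.intros(1)[OF bounded_linear_fst]
        real_polynomial_function.intros(1)[OF bounded_linear_snd])
qed (auto intro: real_polynomial_function.intros)

text \<open>
  The one-variable Taylor formula along the segment from \<open>p\<close> to \<open>p + w\<close>; the remainder is uniformly bounded on a compact
  ball.
\<close>

lemma taylor_vanishes:
  assumes N: "N > 0" and C: "Ck_on N V f" and Cj: "\<And>j. j < N \<Longrightarrow> Ck_on (Suc j) V f" and V: "open V" "p \<in> V"
  shows "vanishes_to_order N (\<lambda>s. f s - (\<Sum>j<N. dirderiv j f (s - p) p / fact j)) p"
proof -
  obtain e where e: "e > 0" "cball p e \<subseteq> V"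
    using V open_contains_cball by blast
  obtain B where B: "\<And>x w. x \<in> cball p e \<Longrightarrow> \<bar>dirderiv N f w x\<bar> \<le> B * norm w ^ N"
    using dirderiv_bound[OF C compact_cball e(2)] by blast
  have "\<forall>\<^sub>F w :: real \<times> real in nhds 0. norm w \<le> e"
    using e by (auto simp: eventually_nhds_metric dist_norm intro!: exI[of _ e])
  then have "\<forall>\<^sub>F w in nhds 0. norm (f (p + w) - (\<Sum>j<N. dirderiv j f (p + w - p) p / fact j)) \<le> B * norm w ^ N"
  proof eventually_elim
    case (elim w)
    have inV: "p + t *\<^sub>R w \<in> cball p e" if "0 \<le> t" "t \<le> 1" for t
    proof -
      have "\<bar>t\<bar> * norm w \<le> 1 * e" using that elim by (intro mult_mono) auto
      then show ?thesis by (simp add: dist_norm)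
    qed
    have "\<forall>m t. m < N \<and> 0 \<le> t \<and> t \<le> 1 \<longrightarrow>
        ((\<lambda>t. dirderiv m f w (p + t *\<^sub>R w)) has_real_derivative dirderiv (Suc m) f w (p + t *\<^sub>R w)) (at t)"
    proof (intro allI impI, elim conjE)
      fix m and t :: real assume mt: "m < N" "0 \<le> t" "t \<le> 1"
      show "((\<lambda>t. dirderiv m f w (p + t *\<^sub>R w)) has_real_derivative dirderiv (Suc m) f w (p + t *\<^sub>R w)) (at t)"
        by (rule dirderiv_has_derivative[OF Cj[OF mt(1)]]) (use inV[OF mt(2,3)] e(2) in blast)
    qed
    from Maclaurin[where diff = "\<lambda>m t. dirderiv m f w (p + t *\<^sub>R w)" and f = "\<lambda>t. f (p + t *\<^sub>R w)", OF zero_less_one N _ this]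
    obtain t where t: "0 < t" "t < 1" and
      eq: "f (p + w) = (\<Sum>m<N. dirderiv m f w p / fact m) + dirderiv N f w (p + t *\<^sub>R w) / fact N"
      by auto
    have "\<bar>dirderiv N f w (p + t *\<^sub>R w) / fact N\<bar> \<le> \<bar>dirderiv N f w (p + t *\<^sub>R w)\<bar> / 1"
      unfolding abs_divide by (intro divide_left_mono) auto
    also have "\<dots> \<le> B * norm w ^ N" using B[OF inV[of t], of w] t by simp
    finally show ?case using eq by simp
  qed
  then show ?thesis by (auto simp: vanishes_to_order_def)
qed

lemma jets_if_smooth:
  assumes "\<And>k. Ck_on k V f" "open V" "p \<in> V"
  shows "has_polynomial_jets f p"
  unfolding has_polynomial_jets_def
proof
  fix N
  let ?Q = "\<lambda>w. \<Sum>j<Suc N. dirderiv j f w p * inverse (fact j)"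
  have "vanishes_to_order (Suc N) (\<lambda>s. f s - ?Q (s - p)) p"
    using taylor_vanishes[of "Suc N" V f p] assms by (simp add: divide_inverse)
  then have "vanishes_to_order N (\<lambda>s. f s - ?Q (s - p)) p"
    by (rule vanishes_Suc_imp)
  moreover have "real_polynomial_function ?Q"
    by (intro real_polynomial_function_sum real_polynomial_function.intros(4) dirderiv_polynomial
        real_polynomial_function.intros(2)) simp
  ultimately show "\<exists>Q. real_polynomial_function Q \<and> vanishes_to_order N (\<lambda>s. f s - Q (s - p)) p"
    by blast
qed

section \<open>The Euler relation after a smooth change of coordinates\<close>

lemma smooth_map_has_derivative:
  assumes "smooth_map_on V h" "s \<in> V"
  shows "(h has_derivative (\<lambda>w. (fst w * pdu (fst \<circ> h) s + snd w * pdv (fst \<circ> h) s,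
      fst w * pdu (snd \<circ> h) s + snd w * pdv (snd \<circ> h) s))) (at s)"
proof -
  have "Ck_on 1 V (fst \<circ> h)" "Ck_on 1 V (snd \<circ> h)"
    using assms(1) unfolding smooth_map_on_def by blast+
  then have "(fst \<circ> h) differentiable (at s)" "(snd \<circ> h) differentiable (at s)"
    using assms(2) by auto
  from has_derivative_Pair[OF this[THEN has_derivative_pd]] show ?thesis by simp
qed

text \<open>
  With \<open>g\<close> the inverse of \<open>h\<close> one has \<open>\<delta> = P \<circ> g\<close>, and the chain rule for \<open>P = \<delta> \<circ> h\<close> expresses the partial
  derivatives of \<open>P\<close> by those of \<open>\<delta>\<close>. Inserting this into the Euler relation of \<open>P\<close> gives the
  coefficients \<open>R\<close> and \<open>S\<close>; they vanish at \<open>q\<close> since each term contains a component of \<open>g\<close>.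
\<close>

lemma quasi_homogeneous_euler_relation:
  assumes \<delta>: "\<forall>\<^sub>F s in nhds q. \<delta> differentiable (at s)"
    and P: "quasi_homogeneous P" and R: "R_equivalent \<delta> q P (0, 0)"
  obtains R S where "has_polynomial_jets R q" "has_polynomial_jets S q" "R q = 0" "S q = 0"
    "\<forall>\<^sub>F s in nhds q. \<delta> s = R s * pdu \<delta> s + S s * pdv \<delta> s"
proof -
  obtain r1 r2 :: rat where euler:
    "\<And>u v. P (u, v) = of_rat r1 * u * pdu P (u, v) + of_rat r2 * v * pdv P (u, v)"
    using P unfolding quasi_homogeneous_def by blast
  obtain h V W g where V: "open V" "open W" "(0, 0) \<in> V" "h (0, 0) = q" "homeomorphism V W h g"
    and h: "smooth_map_on V h" and g: "smooth_map_on W g"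
    and hP: "\<forall>\<^sub>F s in nhds (0, 0). \<delta> (h s) = P s"
    using R unfolding R_equivalent_def diffeo_germ_def by blast
  have gq: "g q = (0, 0)" and qW: "q \<in> W"
    using V homeomorphism_apply1[OF V(5)] homeomorphism_image1[OF V(5)] by (metis, metis image_eqI)
  have hcont: "filterlim h (nhds q) (nhds (0, 0))"
    using isCont_imp_filterlim_nhds[OF has_derivative_continuous[OF smooth_map_has_derivative[OF h V(3)]]] V(4)
    by simp
  have gcont: "filterlim g (nhds (0, 0)) (nhds q)"
    using isCont_imp_filterlim_nhds[OF has_derivative_continuous[OF smooth_map_has_derivative[OF g qW]]] gq
    by simp
  define h1 where "h1 = fst \<circ> h"
  define h2 where "h2 = snd \<circ> h"
  have hP': "\<forall>\<^sub>F s in nhds (0, 0). \<forall>\<^sub>F t in nhds s. \<delta> (h t) = P t"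
    using hP by (simp only: eventually_eventually)
  have "\<forall>\<^sub>F s in nhds (0, 0). (\<forall>\<^sub>F s in nhds s. \<delta> (h s) = P s) \<and> \<delta> differentiable (at (h s)) \<and> s \<in> V"
    using hP' eventually_compose_filterlim[OF \<delta> hcont] eventually_nhds_in_open[OF V(1,3)]
    by eventually_elim auto
  then have chain: "\<forall>\<^sub>F s in nhds (0, 0).
      pdu P s = pdu h1 s * pdu \<delta> (h s) + pdu h2 s * pdv \<delta> (h s) \<and>
      pdv P s = pdv h1 s * pdu \<delta> (h s) + pdv h2 s * pdv \<delta> (h s)"
  proof eventually_elim
    case (elim s)
    have sV: "s \<in> V" and \<delta>s: "\<delta> differentiable (at (h s))" using elim by auto
    have dh: "(h has_derivative (\<lambda>w. (fst w * pdu h1 s + snd w * pdv h1 s,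
        fst w * pdu h2 s + snd w * pdv h2 s))) (at s)"
      unfolding h1_def h2_def by (rule smooth_map_has_derivative[OF h sV])
    have "((\<lambda>s. \<delta> (h s)) has_derivative (\<lambda>w. (fst w * pdu h1 s + snd w * pdv h1 s) * pdu \<delta> (h s)
        + (fst w * pdu h2 s + snd w * pdv h2 s) * pdv \<delta> (h s))) (at s)"
      using has_derivative_compose[OF dh has_derivative_pd[OF \<delta>s]] by (simp only: fst_conv snd_conv)
    moreover have "\<forall>\<^sub>F t in at s. \<delta> (h t) = P t" "\<delta> (h s) = P s"
      using elim by (auto simp: eventually_nhds_conv_at)
    ultimately have "(P has_derivative (\<lambda>w. (fst w * pdu h1 s + snd w * pdv h1 s) * pdu \<delta> (h s)
        + (fst w * pdu h2 s + snd w * pdv h2 s) * pdv \<delta> (h s))) (at s)"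
      by (rule has_derivative_transform_eventually) auto
    from pd_of_has_derivative(3,4)[OF this] show ?case by simp
  qed
  define R where "R = (\<lambda>s. of_rat r1 * (fst \<circ> g) s * pdu h1 (g s) + of_rat r2 * (snd \<circ> g) s * pdv h1 (g s))"
  define S where "S = (\<lambda>s. of_rat r1 * (fst \<circ> g) s * pdu h2 (g s) + of_rat r2 * (snd \<circ> g) s * pdv h2 (g s))"
  have "Ck_on (Suc k) V h1" "Ck_on (Suc k) V h2" for k
    using h unfolding smooth_map_on_def h1_def h2_def by blast+
  then have "Ck_on k V (pdu h1)" "Ck_on k V (pdv h1)" "Ck_on k V (pdu h2)" "Ck_on k V (pdv h2)" for k
    by auto
  note jh = this[THEN jets_if_smooth, OF V(1,3), folded gq]
  have "Ck_on k W (fst \<circ> g)" "Ck_on k W (snd \<circ> g)" for k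
    using g unfolding smooth_map_on_def by blast+
  note jg = this[THEN jets_if_smooth, OF V(2) qW]
  note comp = jets_compose[OF _ jg smooth_map_has_derivative[OF g qW]]
  show ?thesis
  proof (rule that)
    show "has_polynomial_jets R q" "has_polynomial_jets S q"
      unfolding R_def S_def by (intro jets_add jets_mult jets_const jg jh[THEN comp])+
    show "R q = 0" "S q = 0" by (simp_all add: R_def S_def gq)
    have hg: "h (g s) = s" if "s \<in> W" for s
      using homeomorphism_apply2[OF V(5) that] .
    show "\<forall>\<^sub>F s in nhds q. \<delta> s = R s * pdu \<delta> s + S s * pdv \<delta> s"
      using eventually_compose_filterlim[OF chain gcont] eventually_compose_filterlim[OF hP gcont]
        eventually_nhds_in_open[OF V(2) qW]
    proof eventually_elim
      case (elim s)
      have "\<delta> s = P (fst (g s), snd (g s))" using elim hg by simp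
      also have "\<dots> = R s * pdu \<delta> s + S s * pdv \<delta> s"
        unfolding euler using elim hg by (simp add: R_def S_def algebra_simps)
      finally show ?case .
    qed
  qed
qed

section \<open>The umbilic ideal and the gradient ideal\<close>

lemma analytic2_isCont:
  fixes f :: "real \<times> real \<Rightarrow> real"
  assumes "analytic2_at f p" shows "isCont f p"
  using has_derivative_continuous[OF analytic2_has_derivative[OF assms]] .

lemma analytic2_polynomial:
  fixes p :: "real \<times> real"
  assumes "real_polynomial_function Q"
  shows "analytic2_at (\<lambda>s. Q (s - p)) q"
  using assms
proof induction
  case (linear Q)
  interpret bounded_linear Q by (rule linear)
  have Qv: "Q v = fst v * Q (1, 0) + snd v * Q (0, 1)" for v
    using add[of "(fst v, 0)" "(0, snd v)"] scaleR[of "fst v" "(1, 0)"] scaleR[of "snd v" "(0, 1)"]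
    by simp
  have "(\<lambda>s. Q (s - p)) = (\<lambda>s. (fst s - fst p) * Q (1, 0) + (snd s - snd p) * Q (0, 1))"
    by (rule ext, subst Qv) simp
  then show ?case by simp
qed auto

lemma vanishes_if_eventually_0:
  assumes "\<forall>\<^sub>F s in nhds q. f s = 0"
  shows "vanishes_to_order N f q"
proof (rule vanishes_cong[OF _ assms])
  show "vanishes_to_order N (\<lambda>s. 0) q"
    by (auto simp: vanishes_to_order_def intro: exI[of _ 0])
qed

lemma intersection_mult_eq_of_matrix:
  fixes f1 f2 g1 g2 a11 a12 a21 a22 :: "real \<times> real \<Rightarrow> real"
  assumes "analytic2_at f1 q" "analytic2_at f2 q" "analytic2_at g1 q" "analytic2_at g2 q"
    and "analytic2_at a11 q" "analytic2_at a12 q" "analytic2_at a21 q" "analytic2_at a22 q"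
    and "a11 q * a22 q - a12 q * a21 q \<noteq> 0"
    and "\<forall>\<^sub>F s in nhds q. f1 s = a11 s * g1 s + a12 s * g2 s"
    and "\<forall>\<^sub>F s in nhds q. f2 s = a21 s * g1 s + a22 s * g2 s"
  shows "intersection_mult q f1 f2 = intersection_mult q g1 g2"
proof (rule intersection_mult_eq_if_equal_mod_powers)
  fix N
  have "vanishes_to_order N (\<lambda>s. f1 s - (a11 s * g1 s + a12 s * g2 s)) q"
    "vanishes_to_order N (\<lambda>s. f2 s - (a21 s * g1 s + a22 s * g2 s)) q"
    using assms(10,11) by (auto intro!: vanishes_if_eventually_0 elim: eventually_mono)
  then show "\<exists>a11 a12 a21 a22. analytic2_at a11 q \<and> analytic2_at a12 q \<and>
      analytic2_at a21 q \<and> analytic2_at a22 q \<and> a11 q * a22 q - a12 q * a21 q \<noteq> 0 \<and>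
      vanishes_to_order N (\<lambda>s. f1 s - (a11 s * g1 s + a12 s * g2 s)) q \<and>
      vanishes_to_order N (\<lambda>s. f2 s - (a21 s * g1 s + a22 s * g2 s)) q"
    using assms by blast
qed (use assms in auto)

lemma intersection_mult_commute: "intersection_mult q f g = intersection_mult q g f"
  by (simp add: intersection_mult_def insert_commute)

text \<open>
  Replacing \<open>R\<close> and \<open>S\<close> by Taylor polynomials makes the coefficients analytic, at the price of a remainder of high order.
  The extra order in the choice of the polynomial forces it to vanish at \<open>q\<close>, even for \<open>N = 0\<close>.
\<close>

lemma euler_relation_mod_power:
  assumes R: "has_polynomial_jets R q" "R q = 0" and S: "has_polynomial_jets S q" "S q = 0"
    and an: "analytic2_at du q" "analytic2_at dv q"
    and rel: "\<forall>\<^sub>F s in nhds q. d s = R s * du s + S s * dv s"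
  obtains Q1 Q2 where "analytic2_at Q1 q" "Q1 q = 0" "analytic2_at Q2 q" "Q2 q = 0"
    "vanishes_to_order N (\<lambda>s. d s - (Q1 s * du s + Q2 s * dv s)) q"
proof -
  have jet: "\<exists>Q1. analytic2_at Q1 q \<and> Q1 q = 0 \<and> vanishes_to_order N (\<lambda>s. R s - Q1 s) q"
    if jets: "has_polynomial_jets R q" and R0: "R q = 0" for R
  proof -
    obtain Q where Q: "real_polynomial_function Q" "vanishes_to_order (Suc N) (\<lambda>s. R s - Q (s - q)) q"
      using jets by (rule jetsE)
    obtain C where "\<forall>\<^sub>F w in nhds 0. norm (R (q + w) - Q (q + w - q)) \<le> C * norm w ^ Suc N"
      using Q(2) by (auto simp: vanishes_to_order_def)
    from eventually_nhds_x_imp_x[OF this] have "Q (q - q) = 0" using R0 by simp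
    then show ?thesis
      using analytic2_polynomial[OF Q(1), of q q] vanishes_Suc_imp[OF Q(2)]
      by (intro exI[of _ "\<lambda>s. Q (s - q)"]) simp
  qed
  obtain Q1 where Q1: "analytic2_at Q1 q" "Q1 q = 0" "vanishes_to_order N (\<lambda>s. R s - Q1 s) q"
    using jet[OF R] by blast
  obtain Q2 where Q2: "analytic2_at Q2 q" "Q2 q = 0" "vanishes_to_order N (\<lambda>s. S s - Q2 s) q"
    using jet[OF S] by blast
  have "vanishes_to_order N (\<lambda>s. (R s - Q1 s) * du s + (S s - Q2 s) * dv s) q"
    by (intro vanishes_add vanishes_mult_isCont Q1 Q2 analytic2_isCont an)
  then have "vanishes_to_order N (\<lambda>s. d s - (Q1 s * du s + Q2 s * dv s)) q"
    by (rule vanishes_cong) (use rel in \<open>auto elim!: eventually_mono simp: algebra_simps\<close>)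
  with Q1 Q2 show ?thesis by (intro that)
qed

text \<open>
  Pointwise elimination of \<open>\<alpha>\<close>. The roles in the application: \<open>d\<close> is the discriminant \<open>\<delta>\<close> with partial
  derivatives \<open>du, dv\<close>, the coefficients \<open>\<alpha>, \<beta>\<close> are those of the normal in the frame \<open>x\<^sub>u, x\<^sub>v, T\<close>, and
  \<open>k1, k2, t1\<close> are the pairings of \<open>T\<close> with \<open>N\<^sub>u, N\<^sub>v, x\<^sub>u\<close>, which only multiply \<open>d\<close>.
\<close>

lemma umbilic_ideal_identities:
  fixes E F G l m n \<alpha> \<beta> D k1 k2 t1 d du dv :: real
  assumes du: "D * du = 2 * (- \<alpha> * l - \<beta> * m + d * k1)"
    and dv: "D * dv = 2 * (- \<alpha> * m - \<beta> * n + d * k2)"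
    and tu: "\<alpha> * E + \<beta> * F + d * t1 = 0"
    and d: "d = F\<^sup>2 - E * G"
  shows "\<beta> * (E * m - F * l) = - (E * D / 2) * du + d * (l * t1 + E * k1)"
    and "\<beta> * E * (E * n - G * l) = - (F * E * D / 2) * du - (E\<^sup>2 * D / 2) * dv
      + d * (F * (l * t1 + E * k1) + \<beta> * l + E * (t1 * m + E * k2))"
proof -
  have \<alpha>E: "\<alpha> * E = - \<beta> * F - d * t1" using tu by simp
  have "E * (D * du) = 2 * (- (\<alpha> * E) * l - \<beta> * E * m + E * d * k1)"
    unfolding du by (simp add: algebra_simps)
  also have "\<dots> = 2 * (- \<beta> * (E * m - F * l) + d * (l * t1 + E * k1))"
    unfolding \<alpha>E by (simp add: algebra_simps)
  finally show 1: "\<beta> * (E * m - F * l) = - (E * D / 2) * du + d * (l * t1 + E * k1)"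
    by (simp add: algebra_simps)
  have EG: "E * G = F\<^sup>2 - d" using d by simp
  have "E * (E * (D * dv)) = 2 * E * (- (\<alpha> * E) * m - \<beta> * E * n + E * d * k2)"
    unfolding dv by (simp add: algebra_simps)
  also have "\<dots> = 2 * (- \<beta> * E * (E * n - G * l) - \<beta> * (E * G) * l + \<beta> * F * E * m + d * E * (t1 * m + E * k2))"
    unfolding \<alpha>E by (simp add: algebra_simps)
  also have "\<dots> = 2 * (- \<beta> * E * (E * n - G * l) + F * (\<beta> * (E * m - F * l)) + d * (\<beta> * l + E * (t1 * m + E * k2)))"
    unfolding EG by (simp add: algebra_simps power2_eq_square)
  finally show "\<beta> * E * (E * n - G * l) = - (F * E * D / 2) * du - (E\<^sup>2 * D / 2) * dv
      + d * (F * (l * t1 + E * k1) + \<beta> * l + E * (t1 * m + E * k2))"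
    unfolding 1 by (simp add: algebra_simps power2_eq_square)
qed

text \<open>
  In the basis \<open>du, dv\<close> the pair of generators on the left has a matrix that is antitriangular at \<open>q\<close>, because the
  contribution of \<open>d\<close> vanishes there; its antidiagonal entries are multiples of \<open>E\<^sup>2 D\<close> and \<open>E D\<close> by units.
  The functions are kept abstract so that the lemma applies a second time with the two coordinates
  exchanged, that is, with \<open>G, n, \<beta>\<close> in place of \<open>E, l, \<alpha>\<close>.
\<close>

lemma umbilic_intersection_eq_milnor:
  fixes E F G l m n \<alpha> \<beta> D k1 k2 t1 d du dv R S :: "real \<times> real \<Rightarrow> real"
  assumes an: "analytic2_at E q" "analytic2_at F q" "analytic2_at G q" "analytic2_at l q"
      "analytic2_at m q" "analytic2_at n q" "analytic2_at \<alpha> q" "analytic2_at \<beta> q" "analytic2_at D q"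
      "analytic2_at k1 q" "analytic2_at k2 q" "analytic2_at t1 q"
      "analytic2_at d q" "analytic2_at du q" "analytic2_at dv q"
    and du: "\<forall>\<^sub>F s in nhds q. D s * du s = 2 * (- \<alpha> s * l s - \<beta> s * m s + d s * k1 s)"
    and dv: "\<forall>\<^sub>F s in nhds q. D s * dv s = 2 * (- \<alpha> s * m s - \<beta> s * n s + d s * k2 s)"
    and tu: "\<forall>\<^sub>F s in nhds q. \<alpha> s * E s + \<beta> s * F s + d s * t1 s = 0"
    and d: "\<forall>\<^sub>F s in nhds q. d s = (F s)\<^sup>2 - E s * G s"
    and q: "D q \<noteq> 0" "E q \<noteq> 0" "d q = 0" "\<alpha> q \<noteq> 0 \<or> \<beta> q \<noteq> 0"
    and R: "has_polynomial_jets R q" "R q = 0" and S: "has_polynomial_jets S q" "S q = 0"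
    and rel: "\<forall>\<^sub>F s in nhds q. d s = R s * du s + S s * dv s"
  shows "intersection_mult q (\<lambda>s. E s * n s - G s * l s) (\<lambda>s. E s * m s - F s * l s) = intersection_mult q du dv"
proof (rule intersection_mult_eq_if_equal_mod_powers)
  fix N
  have "\<alpha> q * E q + \<beta> q * F q = 0"
    using eventually_nhds_x_imp_x[OF tu] q by simp
  then have \<beta>q: "\<beta> q \<noteq> 0" using q by auto
  \<comment> \<open>\<open>i\<close> and \<open>j\<close> stand for the reciprocals of \<open>\<beta>\<close> and \<open>E\<close>.\<close>
  obtain i where i: "analytic2_at i q" "\<forall>\<^sub>F s in nhds q. \<beta> s * i s = 1"
    using an(8) \<beta>q by (rule analytic2_reciprocal)
  obtain j where j: "analytic2_at j q" "\<forall>\<^sub>F s in nhds q. E s * j s = 1"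
    using an(1) q(2) by (rule analytic2_reciprocal)
  have iq: "i q \<noteq> 0" "j q \<noteq> 0"
    using eventually_nhds_x_imp_x[OF i(2)] eventually_nhds_x_imp_x[OF j(2)] by auto
  obtain Q1 Q2 where Q: "analytic2_at Q1 q" "Q1 q = 0" "analytic2_at Q2 q" "Q2 q = 0"
    and van: "vanishes_to_order N (\<lambda>s. d s - (Q1 s * du s + Q2 s * dv s)) q"
    using euler_relation_mod_power[OF R S an(14,15) rel] .
  define w1 where "w1 = (\<lambda>s. l s * t1 s + E s * k1 s)"
  define w2 where "w2 = (\<lambda>s. F s * w1 s + \<beta> s * l s + E s * (t1 s * m s + E s * k2 s))"
  have w: "analytic2_at w1 q" "analytic2_at w2 q"
    unfolding w1_def w2_def using an by simp_all
  define a11 where "a11 = (\<lambda>s. i s * j s * (- (F s * E s * D s * (1/2)) + w2 s * Q1 s))"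
  define a12 where "a12 = (\<lambda>s. i s * j s * (- ((E s)\<^sup>2 * D s * (1/2)) + w2 s * Q2 s))"
  define a21 where "a21 = (\<lambda>s. i s * (- (E s * D s * (1/2)) + w1 s * Q1 s))"
  define a22 where "a22 = (\<lambda>s. i s * (w1 s * Q2 s))"
  let ?e = "\<lambda>s. d s - (Q1 s * du s + Q2 s * dv s)"
  show "\<exists>a11 a12 a21 a22. analytic2_at a11 q \<and> analytic2_at a12 q \<and>
      analytic2_at a21 q \<and> analytic2_at a22 q \<and> a11 q * a22 q - a12 q * a21 q \<noteq> 0 \<and>
      vanishes_to_order N (\<lambda>s. E s * n s - G s * l s - (a11 s * du s + a12 s * dv s)) q \<and>
      vanishes_to_order N (\<lambda>s. E s * m s - F s * l s - (a21 s * du s + a22 s * dv s)) q"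
  proof (intro exI conjI)
    show "analytic2_at a11 q" "analytic2_at a12 q" "analytic2_at a21 q" "analytic2_at a22 q"
      unfolding a11_def a12_def a21_def a22_def
      by (intro analytic2_mult analytic2_add analytic2_uminus analytic2_power analytic2_const
          an i(1) j(1) Q w)+
    show "a11 q * a22 q - a12 q * a21 q \<noteq> 0"
      unfolding a11_def a12_def a21_def a22_def using q iq Q by simp
    have "vanishes_to_order N (\<lambda>s. ?e s * (i s * j s * w2 s)) q"
      by (intro vanishes_mult_isCont van analytic2_isCont) (use i j w in simp)
    then show "vanishes_to_order N (\<lambda>s. E s * n s - G s * l s - (a11 s * du s + a12 s * dv s)) q"
    proof (rule vanishes_cong)
      show "\<forall>\<^sub>F s in nhds q. E s * n s - G s * l s - (a11 s * du s + a12 s * dv s) = ?e s * (i s * j s * w2 s)"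
        using du dv tu d i(2) j(2)
      proof eventually_elim
        case (elim s)
        have "E s * n s - G s * l s = (\<beta> s * i s) * (E s * j s) * (E s * n s - G s * l s)"
          using elim by simp
        also have "\<dots> = i s * j s * (\<beta> s * E s * (E s * n s - G s * l s))" by (simp only: mult_ac)
        also note umbilic_ideal_identities(2)[OF elim(1-4)]
        finally show ?case
          by (simp add: a11_def a12_def w2_def w1_def algebra_simps)
      qed
    qed
    have "vanishes_to_order N (\<lambda>s. ?e s * (i s * w1 s)) q"
      by (intro vanishes_mult_isCont van analytic2_isCont) (use i w in simp)
    then show "vanishes_to_order N (\<lambda>s. E s * m s - F s * l s - (a21 s * du s + a22 s * dv s)) q"
    proof (rule vanishes_cong)
      show "\<forall>\<^sub>F s in nhds q. E s * m s - F s * l s - (a21 s * du s + a22 s * dv s) = ?e s * (i s * w1 s)"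
        using du dv tu d i(2)
      proof eventually_elim
        case (elim s)
        have "E s * m s - F s * l s = (\<beta> s * i s) * (E s * m s - F s * l s)"
          using elim by simp
        also have "\<dots> = i s * (\<beta> s * (E s * m s - F s * l s))" by (simp only: mult_ac)
        also note umbilic_ideal_identities(1)[OF elim(1-4)]
        finally show ?case
          by (simp add: a21_def a22_def w1_def algebra_simps)
      qed
    qed
  qed
qed (use an in simp_all)

section \<open>Analytic maps into Minkowski space\<close>

definition analytic_comps :: "(real \<times> real) set \<Rightarrow> (real \<times> real \<Rightarrow> real^3) \<Rightarrow> bool"
  where "analytic_comps U y \<longleftrightarrow> (\<forall>s\<in>U. \<forall>i. analytic2_at (\<lambda>s. y s $ i) s)"

lemma has_vector_derivative_vec:
  fixes f :: "real \<Rightarrow> real^'n"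
  assumes "\<And>i. ((\<lambda>t. f t $ i) has_vector_derivative f' $ i) (at a)"
  shows "(f has_vector_derivative f') (at a)"
  unfolding has_vector_derivative_def
  by (subst has_derivative_componentwise_within)
    (use assms in \<open>auto simp: Basis_vec_def inner_axis has_vector_derivative_def\<close>)

lemma pd_nth:
  assumes "analytic_comps U y" "s \<in> U"
  shows "pdu y s $ i = pdu (\<lambda>s. y s $ i) s" and "pdv y s $ i = pdv (\<lambda>s. y s $ i) s"
proof -
  have an: "analytic2_at (\<lambda>s. y s $ i) s" for i using assms by (simp add: analytic_comps_def)
  note pd = pd_of_has_derivative(1,2)[OF analytic2_has_derivative[OF an]]
  have "((\<lambda>t. y (t, snd s)) has_vector_derivative (\<chi> i. pdu (\<lambda>s. y s $ i) s)) (at (fst s))"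
    by (rule has_vector_derivative_vec) (use pd(1) in simp)
  then have "pdu y s = (\<chi> i. pdu (\<lambda>s. y s $ i) s)" unfolding pdu_def[of y] by (rule vector_derivative_at)
  then show "pdu y s $ i = pdu (\<lambda>s. y s $ i) s" by simp
  have "((\<lambda>t. y (fst s, t)) has_vector_derivative (\<chi> i. pdv (\<lambda>s. y s $ i) s)) (at (snd s))"
    by (rule has_vector_derivative_vec) (use pd(2) in simp)
  then have "pdv y s = (\<chi> i. pdv (\<lambda>s. y s $ i) s)" unfolding pdv_def[of y] by (rule vector_derivative_at)
  then show "pdv y s $ i = pdv (\<lambda>s. y s $ i) s" by simp
qed

lemma eventually_open_eq:
  assumes "open U" "s \<in> U" "\<And>t. t \<in> U \<Longrightarrow> f t = g t"
  shows "\<forall>\<^sub>F t in nhds s. f t = g t"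
  using eventually_nhds_in_open[OF assms(1,2)] by (rule eventually_mono) (rule assms(3))

lemma analytic_comps_pd:
  assumes "analytic_comps U y" "open U"
  shows "analytic_comps U (pdu y)" "analytic_comps U (pdv y)"
proof -
  have an: "analytic2_at (\<lambda>s. y s $ i) s" if "s \<in> U" for s i using assms that by (simp add: analytic_comps_def)
  show "analytic_comps U (pdu y)"
    unfolding analytic_comps_def
  proof (intro ballI allI)
    fix s i assume s: "s \<in> U"
    show "analytic2_at (\<lambda>s. pdu y s $ i) s"
      using analytic2_pdu[OF an[OF s, of i]]
      by (rule analytic2_cong) (rule eventually_open_eq[OF assms(2) s pd_nth(1)[OF assms(1)]])
  qed
  show "analytic_comps U (pdv y)"
    unfolding analytic_comps_def
  proof (intro ballI allI)
    fix s i assume s: "s \<in> U"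
    show "analytic2_at (\<lambda>s. pdv y s $ i) s"
      using analytic2_pdv[OF an[OF s, of i]]
      by (rule analytic2_cong) (rule eventually_open_eq[OF assms(2) s pd_nth(2)[OF assms(1)]])
  qed
qed

lemma pd_cong:
  assumes "open U" "s \<in> U" "\<And>t. t \<in> U \<Longrightarrow> f t = g t" and f: "analytic2_at f s"
  shows "pdu g s = pdu f s" "pdv g s = pdv f s"
proof -
  have "(g has_derivative (\<lambda>w. fst w * pdu f s + snd w * pdv f s)) (at s)"
    by (rule has_derivative_transform_within_open[OF analytic2_has_derivative[OF f] assms(1-3)])
  from pd_of_has_derivative(3,4)[OF this] show "pdu g s = pdu f s" "pdv g s = pdv f s" by auto
qed

lemma mixed_partials_vec:
  assumes "analytic_comps U y" "open U" "s \<in> U"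
  shows "pdv (pdu y) s = pdu (pdv y) s"
proof (rule vec_eq_iff[THEN iffD2], rule allI)
  fix i
  have an: "analytic2_at (\<lambda>s. y s $ i) s" using assms by (simp add: analytic_comps_def)
  have "pdv (pdu y) s $ i = pdv (\<lambda>s. pdu y s $ i) s"
    using pd_nth(2)[OF analytic_comps_pd(1)[OF assms(1,2)] assms(3)] .
  also have "\<dots> = pdv (pdu (\<lambda>s. y s $ i)) s"
    by (rule pd_cong(2)[OF assms(2,3)]) (use pd_nth[OF assms(1)] an in simp_all)
  also have "\<dots> = pdu (pdv (\<lambda>s. y s $ i)) s"
    by (rule pdu_pdv_commute[OF an])
  also have "\<dots> = pdu (\<lambda>s. pdv y s $ i) s"
    by (rule pd_cong(1)[OF assms(2,3), symmetric]) (use pd_nth[OF assms(1)] an in simp_all)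
  also have "\<dots> = pdu (pdv y) s $ i"
    using pd_nth(1)[OF analytic_comps_pd(2)[OF assms(1,2)] assms(3)] by simp
  finally show "pdv (pdu y) s $ i = pdu (pdv y) s $ i" .
qed

lemma analytic2_mink:
  assumes "analytic_comps U y" "analytic_comps U z" "s \<in> U"
  shows "analytic2_at (\<lambda>s. mink (y s) (z s)) s"
  using assms unfolding mink_def analytic_comps_def by simp

lemma pd_mink:
  assumes "analytic_comps U y" "analytic_comps U z" "s \<in> U"
  shows "pdu (\<lambda>s. mink (y s) (z s)) s = mink (pdu y s) (z s) + mink (y s) (pdu z s)"
    and "pdv (\<lambda>s. mink (y s) (z s)) s = mink (pdv y s) (z s) + mink (y s) (pdv z s)"
proof -
  have "analytic2_at (\<lambda>s. y s $ i) s" "analytic2_at (\<lambda>s. z s $ i) s" for i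
    using assms by (simp_all add: analytic_comps_def)
  note D = this[THEN analytic2_has_derivative]
  note Dm = has_derivative_mult[OF D]
  from has_derivative_diff[OF has_derivative_add[OF Dm[of 1 1] Dm[of 2 2]] Dm[of 3 3]]
  have der: "((\<lambda>s. mink (y s) (z s)) has_derivative (\<lambda>w.
      mink (fst w *\<^sub>R pdu y s + snd w *\<^sub>R pdv y s) (z s) + mink (y s) (fst w *\<^sub>R pdu z s + snd w *\<^sub>R pdv z s))) (at s)"
    unfolding mink_def
    by (rule has_derivative_eq_rhs)
      (simp add: fun_eq_iff pd_nth[OF assms(1,3)] pd_nth[OF assms(2,3)] algebra_simps)
  from pd_of_has_derivative(3,4)[OF der]
  show "pdu (\<lambda>s. mink (y s) (z s)) s = mink (pdu y s) (z s) + mink (y s) (pdu z s)"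
    "pdv (\<lambda>s. mink (y s) (z s)) s = mink (pdv y s) (z s) + mink (y s) (pdv z s)"
    by simp_all
qed

lemma mink_cross_nth:
  "mink_cross u v $ 1 = u $ 2 * v $ 3 - u $ 3 * v $ 2"
  "mink_cross u v $ 2 = u $ 3 * v $ 1 - u $ 1 * v $ 3"
  "mink_cross u v $ 3 = - (u $ 1 * v $ 2 - u $ 2 * v $ 1)"
  by (simp_all add: mink_cross_def cross3_simps)

lemma analytic_comps_mink_cross:
  assumes "analytic_comps U y" "analytic_comps U z"
  shows "analytic_comps U (\<lambda>s. mink_cross (y s) (z s))"
  using assms unfolding analytic_comps_def forall_3 by (simp add: mink_cross_nth)

lemma mink_lagrange: "mink (mink_cross u v) (mink_cross u v) = (mink u v)\<^sup>2 - mink u u * mink v v"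
  by (simp add: mink_def mink_cross_nth power2_eq_square algebra_simps)

lemma mink_cross_orthogonal: "mink (mink_cross u v) u = 0" "mink (mink_cross u v) v = 0"
  by (simp_all add: mink_def mink_cross_nth algebra_simps)

lemma mink_commute: "mink u v = mink v u"
  by (simp add: mink_def mult.commute)

text \<open>
  Cramer's rule for \<open>w\<close> in the frame \<open>u, v, T\<close>, paired with \<open>y\<close> and freed of denominators; the determinants are
  written as pairings with cross products.
\<close>

lemma mink_cramer:
  fixes u v w T y :: "real^3"
  shows "mink (mink_cross u v) T * mink w y
    = mink (mink_cross w v) T * mink u y + mink (mink_cross u w) T * mink v y
      + mink (mink_cross u v) w * mink T y"
  by (simp add: mink_def mink_cross_nth algebra_simps)

lemma mink_cross_eq_0_imp_dependent:
  assumes "mink_cross u v = 0"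
  obtains a b where "a *\<^sub>R u + b *\<^sub>R v = 0" "a \<noteq> 0 \<or> b \<noteq> 0"
proof -
  have c: "u $ 2 * v $ 3 = u $ 3 * v $ 2" "u $ 3 * v $ 1 = u $ 1 * v $ 3" "u $ 1 * v $ 2 = u $ 2 * v $ 1"
    using mink_cross_nth[of u v] assms by simp_all
  show ?thesis
  proof (cases "u = 0")
    case True
    then show ?thesis by (intro that[of 1 0]) auto
  next
    case False
    then obtain i where i: "u $ i \<noteq> 0" by (auto simp: vec_eq_iff)
    have "u $ k * v $ i = u $ i * v $ k" for k
      using c by (cases k rule: exhaust_3[THEN disjE]; cases i rule: exhaust_3[THEN disjE]; auto simp: mult.commute)
    then show ?thesis
      using i by (intro that[of "- (v $ i)" "u $ i"]) (auto simp: vec_eq_iff mult.commute)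
  qed
qed

text \<open>
  A plane on which the metric vanishes identically does not exist in signature \<open>(2, 1)\<close>: the timelike components determine the
  Euclidean Gram matrix of the spacelike ones, and its determinant is zero,
  which makes the two vectors proportional.
\<close>

lemma isotropic_imp_mink_cross_eq_0:
  assumes "mink u u = 0" "mink u v = 0" "mink v v = 0"
  shows "mink_cross u v = 0"
proof -
  have uu: "(u $ 1)\<^sup>2 + (u $ 2)\<^sup>2 = (u $ 3)\<^sup>2" and vv: "(v $ 1)\<^sup>2 + (v $ 2)\<^sup>2 = (v $ 3)\<^sup>2"
    and uv: "u $ 1 * v $ 1 + u $ 2 * v $ 2 = u $ 3 * v $ 3"
    using assms by (simp_all add: mink_def power2_eq_square)
  have "(u $ 1 * v $ 2 - u $ 2 * v $ 1)\<^sup>2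
      = ((u $ 1)\<^sup>2 + (u $ 2)\<^sup>2) * ((v $ 1)\<^sup>2 + (v $ 2)\<^sup>2) - (u $ 1 * v $ 1 + u $ 2 * v $ 2)\<^sup>2"
    by (simp add: power2_eq_square algebra_simps)
  then have 3: "u $ 1 * v $ 2 - u $ 2 * v $ 1 = 0"
    unfolding uu vv uv by (simp add: power_mult_distrib)
  have "(u $ 2 * v $ 3 - u $ 3 * v $ 2)\<^sup>2 + (u $ 3 * v $ 1 - u $ 1 * v $ 3)\<^sup>2
      = (v $ 3)\<^sup>2 * ((u $ 1)\<^sup>2 + (u $ 2)\<^sup>2) + (u $ 3)\<^sup>2 * ((v $ 1)\<^sup>2 + (v $ 2)\<^sup>2)
        - 2 * (u $ 3 * v $ 3) * (u $ 1 * v $ 1 + u $ 2 * v $ 2)"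
    by (simp add: power2_eq_square algebra_simps)
  also have "\<dots> = 0" unfolding uu vv uv by (simp add: power2_eq_square algebra_simps)
  finally have "u $ 2 * v $ 3 - u $ 3 * v $ 2 = 0 \<and> u $ 3 * v $ 1 - u $ 1 * v $ 3 = 0"
    by (simp add: sum_power2_eq_zero_iff)
  with 3 show ?thesis by (simp add: vec_eq_iff forall_3 mink_cross_nth)
qed

section \<open>Lightlike umbilic points and the Milnor number\<close>

theorem theorem3p14:
  fixes M :: "(real^3) set" and p :: "real^3"
    and U :: "(real \<times> real) set" and x :: "real \<times> real \<Rightarrow> real^3" and q :: "real \<times> real"
    and P :: "real \<times> real \<Rightarrow> real"
  assumes "regular_analytic_surface M" and "p \<in> M"
    and "local_parametrisation M U x" and "q \<in> U" and "x q = p"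
    and "lightlike_umbilic x q"
    and "LD_singular x q"
    and "quasi_homogeneous P" and "R_equivalent (LD_delta x) q P (0, 0)"
  shows "umbilic_mult x q = milnor_number q (LD_delta x)"
proof -
  note U = \<open>q \<in> U\<close>
  have opU: "open U" and x: "analytic_comps U x"
    and indep: "\<And>s a b. s \<in> U \<Longrightarrow> a *\<^sub>R pdu x s + b *\<^sub>R pdv x s = 0 \<Longrightarrow> a = 0 \<and> b = 0"
    using assms(3) unfolding local_parametrisation_def analytic_comps_def by blast+
  note xu = analytic_comps_pd(1)[OF x opU] and xv = analytic_comps_pd(2)[OF x opU]
  note xuu = analytic_comps_pd(1)[OF xu opU] and xuv = analytic_comps_pd(2)[OF xu opU]
    and xvv = analytic_comps_pd(2)[OF xv opU]
  define N where "N = (\<lambda>s. mink_cross (pdu x s) (pdv x s))"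
  have N: "analytic_comps U N" unfolding N_def by (rule analytic_comps_mink_cross[OF xu xv])
  note Nu = analytic_comps_pd(1)[OF N opU] and Nv = analytic_comps_pd(2)[OF N opU]
  have N0: "N q \<noteq> 0"
    unfolding N_def using indep[OF U] mink_cross_eq_0_imp_dependent by metis
  define d where "d = LD_delta x"
  define E where "E = coef_E x"
  define F where "F = coef_F x"
  define G where "G = coef_G x"
  define l where "l = coef_l x"
  define m where "m = coef_m x"
  define n where "n = coef_n x"
  have E: "E = (\<lambda>s. mink (pdu x s) (pdu x s))" and F: "F = (\<lambda>s. mink (pdu x s) (pdv x s))"
    and G: "G = (\<lambda>s. mink (pdv x s) (pdv x s))"
    by (auto simp: E_def F_def G_def coef_E_def coef_F_def coef_G_def)
  have l: "l = (\<lambda>s. mink (N s) (pdu (pdu x) s))" and m: "m = (\<lambda>s. mink (N s) (pdv (pdu x) s))"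
    and n: "n = (\<lambda>s. mink (N s) (pdv (pdv x) s))"
    by (auto simp: l_def m_def n_def coef_l_def coef_m_def coef_n_def N_def)
  have d: "d s = (F s)\<^sup>2 - E s * G s" for s
    by (simp add: d_def LD_delta_def E_def F_def G_def)
  have dN: "d = (\<lambda>s. mink (N s) (N s))"
    unfolding fun_eq_iff d E F G N_def mink_lagrange by simp
  have du: "pdu d s = 2 * mink (N s) (pdu N s)" and dv: "pdv d s = 2 * mink (N s) (pdv N s)"
    if "s \<in> U" for s
    unfolding dN using pd_mink[OF N N that] by (simp_all add: mink_commute)
  have Nxu: "(\<lambda>s. mink (N s) (pdu x s)) = (\<lambda>s. 0)" and Nxv: "(\<lambda>s. mink (N s) (pdv x s)) = (\<lambda>s. 0)"
    by (simp_all add: N_def mink_cross_orthogonal)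
  have pd0: "pdu (\<lambda>s. 0 :: real) s = 0" "pdv (\<lambda>s. 0 :: real) s = 0" for s
    by (simp_all add: pdu_def pdv_def)
  \<comment> \<open>Differentiating \<open>\<langle>N, x\<^sub>u\<rangle> = \<langle>N, x\<^sub>v\<rangle> = 0\<close>.\<close>
  have weingarten:
    "mink (pdu x s) (pdu N s) = - l s" "mink (pdv x s) (pdu N s) = - m s"
    "mink (pdu x s) (pdv N s) = - m s" "mink (pdv x s) (pdv N s) = - n s"
    if s: "s \<in> U" for s
    using pd_mink[OF N xu s, unfolded Nxu pd0] pd_mink[OF N xv s, unfolded Nxv pd0]
      mixed_partials_vec[OF x opU s]
    by (simp_all add: l m n mink_commute)
  \<comment> \<open>The pairing of \<open>N(q)\<close> with this vector is the Euclidean square norm of \<open>N(q)\<close>.\<close>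
  define T :: "real^3" where "T = vector [N q $ 1, N q $ 2, - (N q $ 3)]"
  define D where "D = (\<lambda>s. mink (N s) T)"
  define \<alpha> where "\<alpha> = (\<lambda>s. mink (mink_cross (N s) (pdv x s)) T)"
  define \<beta> where "\<beta> = (\<lambda>s. mink (mink_cross (pdu x s) (N s)) T)"
  have T: "analytic_comps U (\<lambda>s. T)" by (simp add: analytic_comps_def)
  have Dq: "D q \<noteq> 0"
  proof
    assume "D q = 0"
    then have "(N q $ 1)\<^sup>2 + (N q $ 2)\<^sup>2 + (N q $ 3)\<^sup>2 = 0"
      by (simp add: D_def T_def mink_def power2_eq_square)
    then have "N q $ i = 0" for i
      using exhaust_3[of i] by (auto simp: sum_power2_eq_zero_iff add_nonneg_eq_0_iff)
    with N0 show False by (simp add: vec_eq_iff)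
  qed
  have frame: "D s * mink (N s) y = \<alpha> s * mink (pdu x s) y + \<beta> s * mink (pdv x s) y + d s * mink T y" for s y
    using mink_cramer[of "pdu x s" "pdv x s" T "N s" y] by (simp add: D_def \<alpha>_def \<beta>_def dN N_def)
  have tu: "\<alpha> s * E s + \<beta> s * F s + d s * mink T (pdu x s) = 0" for s
    using frame[of s "pdu x s"] fun_cong[OF Nxu, of s] by (simp add: E F mink_commute)
  have tv: "\<beta> s * G s + \<alpha> s * F s + d s * mink T (pdv x s) = 0" for s
    using frame[of s "pdv x s"] fun_cong[OF Nxv, of s] by (simp add: G F mink_commute)
  have Du: "D s * pdu d s = 2 * (- \<alpha> s * l s - \<beta> s * m s + d s * mink T (pdu N s))"
    and Dv: "D s * pdv d s = 2 * (- \<alpha> s * m s - \<beta> s * n s + d s * mink T (pdv N s))" if "s \<in> U" for s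
    using frame[of s "pdu N s"] frame[of s "pdv N s"] weingarten[OF that] du[OF that] dv[OF that]
    by (simp_all add: algebra_simps)
  have \<alpha>\<beta>: "\<alpha> q \<noteq> 0 \<or> \<beta> q \<noteq> 0"
  proof (rule ccontr)
    assume "\<not> ?thesis"
    moreover have "d q = 0" using assms(6) by (simp add: lightlike_umbilic_def d_def)
    ultimately have "D q * mink (N q) T = 0" using frame[of q T] by simp
    then show False using Dq by (simp add: D_def)
  qed
  have dq: "d q = 0" using assms(6) by (simp add: lightlike_umbilic_def d_def)
  note an_mink = analytic2_mink[OF _ _ U]
  have an: "analytic2_at E q" "analytic2_at F q" "analytic2_at G q" "analytic2_at l q" "analytic2_at m q"
    "analytic2_at n q" "analytic2_at d q"
    unfolding E F G l m n dN by (intro an_mink xu xv xuu xuv xvv N)+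
  have an': "analytic2_at \<alpha> q" "analytic2_at \<beta> q" "analytic2_at D q"
    "analytic2_at (\<lambda>s. mink T (pdu N s)) q" "analytic2_at (\<lambda>s. mink T (pdv N s)) q"
    "analytic2_at (\<lambda>s. mink T (pdu x s)) q" "analytic2_at (\<lambda>s. mink T (pdv x s)) q"
    unfolding \<alpha>_def \<beta>_def D_def by (intro an_mink analytic_comps_mink_cross T xu xv N Nu Nv)+
  have and': "analytic2_at (pdu d) q" "analytic2_at (pdv d) q" using an by simp_all
  have evU: "\<forall>\<^sub>F s in nhds q. s \<in> U" using eventually_nhds_in_open[OF opU U] .
  have "\<forall>\<^sub>F s in nhds q. d differentiable (at s)"
    using evU
  proof eventually_elim
    case (elim s)
    have "analytic2_at d s" unfolding dN by (rule analytic2_mink[OF N N elim])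
    then show ?case using analytic2_has_derivative differentiableI by blast
  qed
  then obtain R S where R: "has_polynomial_jets R q" and S: "has_polynomial_jets S q"
    and R0: "R q = 0" and S0: "S q = 0"
    and rel: "\<forall>\<^sub>F s in nhds q. d s = R s * pdu d s + S s * pdv d s"
    using quasi_homogeneous_euler_relation[OF _ assms(8), of d q] assms(9) unfolding d_def by blast
  define \<mu> where "\<mu> = intersection_mult q (pdu d) (pdv d)"
  define a where "a = coef_a x"
  define b where "b = coef_b x"
  define c where "c = coef_c x"
  have a: "a s = F s * n s - G s * m s" and b: "b s = E s * n s - G s * l s"
    and c: "c s = E s * m s - F s * l s" for s
    by (simp_all add: a_def b_def c_def coef_a_def coef_b_def coef_c_def E_def F_def G_def l_def m_def n_def)
  have abc: "analytic2_at a q" "analytic2_at b q" "analytic2_at c q"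
    unfolding a_def b_def c_def
    using an unfolding coef_a_def coef_b_def coef_c_def E_def F_def G_def l_def m_def n_def by simp_all
  have bc: "intersection_mult q b c = \<mu>" if "E q \<noteq> 0"
  proof -
    have "intersection_mult q (\<lambda>s. E s * n s - G s * l s) (\<lambda>s. E s * m s - F s * l s)
        = intersection_mult q (pdu d) (pdv d)"
      by (rule umbilic_intersection_eq_milnor[OF an(1-6) an'(1-6) an(7) and'
            eventually_mono[OF evU Du] eventually_mono[OF evU Dv] always_eventually[OF allI[OF tu]]
            always_eventually[OF allI[OF d]] Dq that dq \<alpha>\<beta> R R0 S S0 rel])
    then show ?thesis by (simp only: \<mu>_def b[abs_def, symmetric] c[abs_def, symmetric])
  qed
  \<comment> \<open>The previous case with the two coordinates exchanged; signs and order of the generators change.\<close>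
  have ab: "intersection_mult q a b = \<mu>" if "G q \<noteq> 0"
  proof -
    have "intersection_mult q a b
        = intersection_mult q (\<lambda>s. G s * l s - E s * n s) (\<lambda>s. G s * m s - F s * n s)"
      by (rule intersection_mult_eq_of_matrix[where ?a11.0 = "\<lambda>s. 0" and ?a12.0 = "\<lambda>s. -1"
            and ?a21.0 = "\<lambda>s. -1" and ?a22.0 = "\<lambda>s. 0"])
        (use abc an in \<open>auto simp: a b\<close>)
    also have "\<dots> = intersection_mult q (pdv d) (pdu d)"
    proof (rule umbilic_intersection_eq_milnor[OF an(3,2,1,6,5,4) an'(2,1,3,5,4,7) an(7) and'(2,1)
          _ _ _ _ Dq that dq _ S S0 R R0])
      show "\<beta> q \<noteq> 0 \<or> \<alpha> q \<noteq> 0" using \<alpha>\<beta> by blast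
      show "\<forall>\<^sub>F s in nhds q. d s = S s * pdv d s + R s * pdu d s"
        using rel by (simp add: add.commute)
      show "\<forall>\<^sub>F s in nhds q. D s * pdv d s = 2 * (- \<beta> s * n s - \<alpha> s * m s + d s * mink T (pdv N s))"
        using evU by (rule eventually_mono) (simp add: Dv)
      show "\<forall>\<^sub>F s in nhds q. D s * pdu d s = 2 * (- \<beta> s * m s - \<alpha> s * l s + d s * mink T (pdu N s))"
        using evU by (rule eventually_mono) (simp add: Du)
      show "\<forall>\<^sub>F s in nhds q. \<beta> s * G s + \<alpha> s * F s + d s * mink T (pdv x s) = 0"
        by (rule always_eventually[OF allI[OF tv]])
      show "\<forall>\<^sub>F s in nhds q. d s = (F s)\<^sup>2 - G s * E s"
        by (rule always_eventually) (simp add: d mult.commute)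
    qed
    finally show ?thesis by (simp add: \<mu>_def intersection_mult_commute)
  qed
  have FEG: "(F q)\<^sup>2 = E q * G q" using d[of q] dq by simp
  have ac: "intersection_mult q a c = \<mu>" if Fq: "F q \<noteq> 0"
  proof -
    have Eq: "E q \<noteq> 0" using FEG Fq by auto
    obtain j where j: "analytic2_at j q" "\<forall>\<^sub>F s in nhds q. E s * j s = 1"
      using an(1) Eq by (rule analytic2_reciprocal)
    have jq: "j q \<noteq> 0" using eventually_nhds_x_imp_x[OF j(2)] by auto
    have "intersection_mult q a c = intersection_mult q b c"
    proof (rule intersection_mult_eq_of_matrix[where ?a11.0 = "\<lambda>s. F s * j s" and ?a12.0 = "\<lambda>s. - (G s * j s)"
            and ?a21.0 = "\<lambda>s. 0" and ?a22.0 = "\<lambda>s. 1"])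
      show "\<forall>\<^sub>F s in nhds q. a s = F s * j s * b s + - (G s * j s) * c s"
        using j(2)
      proof eventually_elim
        case (elim s)
        have "a s = (E s * j s) * a s" using elim by simp
        also have "\<dots> = j s * (F s * b s - G s * c s)" by (simp add: a b c algebra_simps)
        finally show ?case by (simp add: algebra_simps)
      qed
    qed (use abc an j Fq jq in auto)
    with bc[OF Eq] show ?thesis by simp
  qed
  have nz: "E q \<noteq> 0 \<or> F q \<noteq> 0 \<or> G q \<noteq> 0"
  proof (rule ccontr)
    assume "\<not> ?thesis"
    then have "N q = 0"
      unfolding N_def E F G by (intro isotropic_imp_mink_cross_eq_0) auto
    with N0 show False ..
  qed
  have "umbilic_mult x q = \<mu>"
    unfolding umbilic_mult_def a_def[symmetric] b_def[symmetric] c_def[symmetric]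
      E_def[symmetric] F_def[symmetric] G_def[symmetric]
    by (rule the_equality) (use ab bc ac nz in auto)
  then show ?thesis by (simp add: \<mu>_def milnor_number_def d_def)
qed

end
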